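(* Let $m\ge1$ and let $G\subset\mathbb{R}^{m+1}$ be a bounded domain with $C^2$-smooth boundary, with Szeg\"o kernel $K_G$. Then the Szeg\"o metric $ds_G=K_G(z,z)\,|dz|$ on $G$ is complete; that is, $G$ endowed with the distance function $d_S$ associated to $ds_G$ is a complete metric space.
   Context: Let $e_1,\dots,e_m$ be the standard basis of $\mathbb{R}^m$ and $\mathcal{C}l_{0m}$ the real Clifford algebra with $e_ie_j+e_je_i=-2\delta_{ij}e_0$, $e_0=1$; its elements are $a=\sum_{A\subseteq\{1,\dots,m\}}a_Ae_A$ with $a_A\in\mathbb{R}$ and $e_A=e_{l_1}\cdots e_{l_r}$ for $A=\{l_1<\dots<l_r\}$, $e_\emptyset=1$. Clifford conjugation $a\mapsto\overline a$ is the anti-automorphism with $\overline{e_j}=-e_j$ for $j\ge1$ and $\overline{1}=1$. $\mathrm{Sc}(a)$ is the coefficient $a_\emptyset$, and $|a|=(\sum_A|a_A|^2)^{1/2}$. $\mathbb{R}^{m+1}$ is identified with the space of paravectors $z=z_0+z_1e_1+\dots+z_me_m$. Put $D=\frac{\partial}{\partial z_0}+\sum_{j=1}^m e_j\frac{\partial}{\partial z_j}$. A real differentiable $f:G\to\mathcal{C}l_{0m}$ on an open set $G\subseteq\mathbb{R}^{m+1}$ is left monogenic if $Df=0$ on $G$ (with $D$ acting from the left). The Hardy space $H^2(\partial G,\mathcal{C}l_{0m})$ is the closure, in the $L^2$-norm on $\partial G$, of the set of functions that are left monogenic in $G$ and square integrable on the boundary; its elements are regarded as monogenic functions on $G$.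 It carries the Clifford-valued inner product $(f,g)=\int_{\partial G}\overline{f(w)}\,g(w)\,dS_w$ ($dS$ = surface measure), norm $\|f\|=\mathrm{Sc}((f,f))^{1/2}$, and satisfies $|f(z)|\le C(z)\|f\|$ for each $z\in G$. The Szeg\"o kernel $K_G$ is its unique reproducing kernel: $f(z)=\int_{\partial G}K_G(z,w)f(w)\,dS_w$ for all $f$ in the Hardy space and $z\in G$, where $\overline{K_G(z,\cdot)}$ lies in the Hardy space. $K_G(z,z)$ is real and positive. The Szeg\"o metric on $G$ is the Hermitian metric with line element $ds_G=K_G(z,z)\,|dz|$. For a Hermitian metric $ds=\lambda(z)|dz|$ on $G$, the length of a piecewise continuously differentiable path $C$ in $G$ is $L_{ds}(C)=\int_C\lambda(z)|dz|$, and the associated distance function is $d(z_1,z_2)=\inf\{L_{ds}(C): C\text{ a path in }G\text{ from }z_1\text{ to }z_2\}$. *)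

theory Defs
  imports "HOL-Analysis.Analysis"
begin

section \<open>The Clifford algebra\<close>

text \<open>
  The generators are indexed by a finite linearly ordered type \<open>'n\<close>, so that \<open>m = CARD('n)\<close>.
  The coordinate of an element at a set \<open>A\<close> of indices is its coefficient at \<open>e\<^sub>A\<close>; the Euclidean
  norm of \<^typ>\<open>real ^ 'n set\<close> is the norm \<open>|a|\<close> of the Clifford algebra.
  (The library's multiplication on \<^typ>\<open>real ^ 'n set\<close> is componentwise and is not used.)
\<close>

type_synonym 'n clifford = "real ^ 'n set"

definition blade :: "'n::{finite,linorder} set \<Rightarrow> 'n clifford" where
  "blade A = axis A 1"

text \<open>
  \<open>e\<^sub>A e\<^sub>B = \<plusminus> e\<^sub>C\<close>, where \<open>C\<close> is the symmetric difference of \<open>A\<close> and \<open>B\<close>: sorting the factors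
  gives one sign change for each pair \<open>j < i\<close> with \<open>i \<in> A\<close>, \<open>j \<in> B\<close>, and each common index
  contributes a further one since \<open>e\<^sub>i e\<^sub>i = -1\<close>.
\<close>

definition blade_sign :: "'n::{finite,linorder} set \<Rightarrow> 'n set \<Rightarrow> real" where
  "blade_sign A B = (-1) ^ card {(i, j). i \<in> A \<and> j \<in> B \<and> j \<le> i}"

definition cmult :: "'n::{finite,linorder} clifford \<Rightarrow> 'n clifford \<Rightarrow> 'n clifford"
    (infixl "\<odot>" 70) where
  "a \<odot> b = (\<Sum>A\<in>UNIV. \<Sum>B\<in>UNIV. (a $ A * b $ B * blade_sign A B) *\<^sub>R blade (sym_diff A B))"

text \<open>
  The sign below is the one for which \<open>cconj\<close> reverses products and negates the generators;
  see \<open>cconj_cmult\<close> and \<open>cconj_generator\<close>.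
\<close>

definition cconj :: "'n::{finite,linorder} clifford \<Rightarrow> 'n clifford" where
  "cconj a = (\<chi> A. (-1) ^ (card A * (card A + 1) div 2) * a $ A)"

definition Sc :: "'n::{finite,linorder} clifford \<Rightarrow> real" where
  "Sc a = a $ {}"

lemma blade_sign_prod:
  "blade_sign A B = (\<Prod>i\<in>A. \<Prod>j\<in>B. if j \<le> i then -1 else 1)"
proof -
  have "(\<Prod>i\<in>A. \<Prod>j\<in>B. if j \<le> i then -1 else (1::real))
      = (\<Prod>p\<in>A \<times> B. if snd p \<le> fst p then -1 else 1)"
    by (simp only: prod.cartesian_product split_def)
  also have "\<dots> = (\<Prod>p\<in>{p \<in> A \<times> B. snd p \<le> fst p}. -1)"
    by (rule prod.inter_filter[symmetric]) (rule finite)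
  also have "{p \<in> A \<times> B. snd p \<le> fst p} = {(i, j). i \<in> A \<and> j \<in> B \<and> j \<le> i}"
    by auto
  finally show ?thesis
    by (simp add: blade_sign_def)
qed

lemma prod_sym_diff:
  fixes f :: "'n::finite \<Rightarrow> real"
  assumes "\<And>i. f i * f i = 1"
  shows "prod f (sym_diff A B) = prod f A * prod f B"
proof -
  have "prod f (A \<inter> B) * prod f (A \<inter> B) = (\<Prod>i\<in>A \<inter> B. f i * f i)"
    by (rule prod.distrib[symmetric])
  then have sq: "prod f (A \<inter> B) * prod f (A \<inter> B) = 1"
    by (simp add: assms)
  have "prod f A * prod f B = (prod f (A \<inter> B) * prod f (A - B)) * (prod f (A \<inter> B) * prod f (B - A))"
    using prod.Int_Diff[of A f B] prod.Int_Diff[of B f A] by (simp add: Int_commute)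
  also have "\<dots> = (prod f (A \<inter> B) * prod f (A \<inter> B)) * (prod f (A - B) * prod f (B - A))"
    by (simp only: mult_ac)
  also have "\<dots> = prod f (A - B) * prod f (B - A)"
    by (simp only: sq mult_1)
  also have "\<dots> = prod f (sym_diff A B)"
    by (rule prod.union_disjoint[symmetric]) auto
  finally show ?thesis ..
qed

lemma blade_sign_left: "blade_sign (sym_diff A B) C = blade_sign A C * blade_sign B C"
  unfolding blade_sign_prod
  by (rule prod_sym_diff) (simp add: prod.distrib[symmetric] if_distrib cong: if_cong)

lemma blade_sign_right: "blade_sign C (sym_diff A B) = blade_sign C A * blade_sign C B"
  unfolding blade_sign_prod prod.distrib[symmetric]
  by (rule prod.cong[OF refl], rule prod_sym_diff) simp

lemma blade_nth: "blade A $ B = (if B = A then 1 else 0)"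
  by (simp add: blade_def axis_def)

lemma cmult_blade: "blade A \<odot> blade B = blade_sign A B *\<^sub>R blade (sym_diff A B)"
proof -
  have "blade A \<odot> blade B = (\<Sum>A'\<in>UNIV. if A' = A then
      \<Sum>B'\<in>UNIV. if B' = B then blade_sign A B *\<^sub>R blade (sym_diff A B) else 0 else 0)"
    unfolding cmult_def
  proof (intro sum.cong refl)
    fix A' :: "'a set"
    show "(\<Sum>B'\<in>UNIV. (blade A $ A' * blade B $ B' * blade_sign A' B') *\<^sub>R blade (sym_diff A' B'))
        = (if A' = A then \<Sum>B'\<in>UNIV. if B' = B then blade_sign A B *\<^sub>R blade (sym_diff A B)
             else 0 else 0)"
    proof (cases "A' = A")
      case True
      have "(\<Sum>B'\<in>UNIV. (blade A $ A * blade B $ B' * blade_sign A B') *\<^sub>R blade (sym_diff A B'))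
          = (\<Sum>B'\<in>UNIV. if B' = B then blade_sign A B *\<^sub>R blade (sym_diff A B) else 0)"
        by (rule sum.cong) (simp_all add: blade_nth)
      with True show ?thesis by simp
    qed (simp add: blade_nth)
  qed
  then show ?thesis by simp
qed

lemma bilinear_cmult: "bilinear (\<odot>)"
  unfolding bilinear_def linear_iff cmult_def
  by (simp add: sum.distrib[symmetric] scaleR_add_left[symmetric] scaleR_sum_right
      distrib_left distrib_right mult.assoc)
     (simp add: mult.left_commute)

lemma clifford_expand: "a = (\<Sum>A\<in>UNIV. a $ A *\<^sub>R blade A)"
  by (simp add: vec_eq_iff blade_def axis_def if_distrib cong: if_cong)

lemma linear_cmult: "linear (\<lambda>a. a \<odot> b)" "linear (\<lambda>b. a \<odot> b)"
  using bilinear_cmult unfolding bilinear_def by auto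

lemma linear_eq_blade:
  assumes "linear f" "linear g" "\<And>A. f (blade A) = g (blade A)"
  shows "f a = g a"
  by (subst (1 2) clifford_expand[of a])
     (simp add: linear_sum[OF assms(1)] linear_sum[OF assms(2)] linear_cmul[OF assms(1)]
       linear_cmul[OF assms(2)] assms(3))

lemma linear_comp: "linear f \<Longrightarrow> linear g \<Longrightarrow> linear (\<lambda>x. f (g x))"
  using linear_compose[of g f] by (simp add: o_def)

lemma cmult_one: "blade {} \<odot> a = a" "a \<odot> blade {} = a"
proof -
  show "blade {} \<odot> a = a"
    by (rule linear_eq_blade[where g="\<lambda>x. x"])
       (auto simp: cmult_blade blade_sign_def linear_cmult linear_id[unfolded id_def])
  show "a \<odot> blade {} = a"
    by (rule linear_eq_blade[where g="\<lambda>x. x"])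
       (auto simp: cmult_blade blade_sign_def linear_cmult linear_id[unfolded id_def])
qed

lemma cmult_assoc: "(a \<odot> b) \<odot> c = a \<odot> (b \<odot> c)"
proof -
  have s: "sym_diff (sym_diff A B) C = sym_diff A (sym_diff B C)" for A B C :: "'a set"
    by auto
  have 1: "(blade A \<odot> blade B) \<odot> blade C = blade A \<odot> (blade B \<odot> blade C)" for A B C :: "'a set"
    by (simp add: cmult_blade linear_cmul[OF linear_cmult(1)] linear_cmul[OF linear_cmult(2)]
        blade_sign_left blade_sign_right s mult_ac)
  have 2: "(blade A \<odot> blade B) \<odot> c = blade A \<odot> (blade B \<odot> c)" for A B :: "'a set"
    by (rule linear_eq_blade[OF linear_cmult(2) linear_comp[OF linear_cmult(2) linear_cmult(2)] 1])
  have 3: "(blade A \<odot> b) \<odot> c = blade A \<odot> (b \<odot> c)" for A :: "'a set"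
    by (rule linear_eq_blade[OF linear_comp[OF linear_cmult(1) linear_cmult(2)]
          linear_comp[OF linear_cmult(2) linear_cmult(1)] 2])
  show ?thesis
    by (rule linear_eq_blade[OF linear_comp[OF linear_cmult(1) linear_cmult(1)] linear_cmult(1) 3])
qed

lemma cmult_generators:
  "blade {i} \<odot> blade {j} + blade {j} \<odot> blade {i} = (if i = j then - 2 else 0) *\<^sub>R blade {}"
proof (cases "i = j")
  case True
  then show ?thesis
    by (simp add: cmult_blade blade_sign_prod flip: scaleR_2)
next
  case False
  then have "sym_diff {i} {j} = sym_diff {j} {i}" "i < j \<or> j < i"
    by auto
  with False show ?thesis
    by (auto simp: cmult_blade blade_sign_prod)
qed

lemma blade_insert:
  assumes "\<And>i. i \<in> A \<Longrightarrow> l < i"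
  shows "blade (insert l A) = blade {l} \<odot> blade A"
proof -
  have "\<not> i \<le> l" if "i \<in> A" for i
    using assms[OF that] by simp
  then have "sym_diff {l} A = insert l A" "blade_sign {l} A = 1"
    by (auto simp: blade_sign_prod intro!: prod.neutral)
  then show ?thesis by (simp add: cmult_blade)
qed

lemma cconj_generator: "cconj (blade {j}) = - blade {j}"
  by (simp add: cconj_def blade_def axis_def vec_eq_iff)

lemma cconj_one: "cconj (blade {}) = blade {}"
  by (simp add: cconj_def blade_def axis_def vec_eq_iff)

lemma cconj_sign:
  fixes A :: "'n::{finite,linorder} set"
  shows "(-1::real) ^ (card A * (card A + 1) div 2) = blade_sign A A"
proof (induction A rule: finite_linorder_max_induct[OF finite])
  case 1
  show ?case by (simp add: blade_sign_def)
next
  case (2 b A)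
  have n: "b \<notin> A" using 2(2) by auto
  have tri: "(n + 1) * (n + 2) div 2 = n * (n + 1) div 2 + (n + 1)" for n :: nat
    by (simp add: algebra_simps)
  have a: "(\<Prod>i\<in>A. \<Prod>j\<in>insert b A. if j \<le> i then -1 else (1::real))
     = (\<Prod>i\<in>A. \<Prod>j\<in>A. if j \<le> i then -1 else 1)"
  proof (rule prod.cong[OF refl])
    fix i assume "i \<in> A"
    with 2(2) have "\<not> b \<le> i" by (auto simp: not_le)
    with n show "(\<Prod>j\<in>insert b A. if j \<le> i then -1 else (1::real)) = (\<Prod>j\<in>A. if j \<le> i then -1 else 1)"
      by simp
  qed
  have b: "(\<Prod>j\<in>insert b A. if j \<le> b then -1 else (1::real)) = (-1) ^ (card A + 1)"
  proof -
    have "j \<le> b" if "j \<in> insert b A" for j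
      using 2(2) that by (auto intro: less_imp_le)
    then have "(\<Prod>j\<in>insert b A. if j \<le> b then -1 else (1::real)) = (\<Prod>j\<in>insert b A. -1)"
      by (intro prod.cong) simp_all
    with n show ?thesis by simp
  qed
  have "blade_sign (insert b A) (insert b A) = (-1) ^ (card A + 1) * blade_sign A A"
    unfolding blade_sign_prod by (subst prod.insert[OF finite n]) (simp only: a b)
  with 2 n show ?case
    using tri[of "card A"] by (simp add: power_add)
qed

lemma cconj_cmult: "cconj (a \<odot> b) = cconj b \<odot> cconj a"
proof -
  have c: "linear cconj"
    by (auto simp: linear_iff cconj_def vec_eq_iff algebra_simps)
  have cb: "cconj (blade A) = blade_sign A A *\<^sub>R blade A" for A :: "'a set"
    unfolding cconj_sign[symmetric] by (simp add: cconj_def blade_def axis_def vec_eq_iff)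
  have sq: "blade_sign A B * blade_sign A B = 1" for A B :: "'a set"
    by (simp add: blade_sign_def flip: power_add)
  have 1: "cconj (blade A \<odot> blade B) = cconj (blade B) \<odot> cconj (blade A)" for A B :: "'a set"
  proof -
    have "sym_diff A B = sym_diff B A" by auto
    moreover have "blade_sign A B * (blade_sign A B * x) = x" for x
      using sq by (simp flip: mult.assoc)
    ultimately show ?thesis
      by (simp add: cmult_blade linear_cmul[OF c] cb linear_cmul[OF linear_cmult(1)]
         linear_cmul[OF linear_cmult(2)] blade_sign_left blade_sign_right mult_ac)
  qed
  have 2: "cconj (blade A \<odot> b) = cconj b \<odot> cconj (blade A)" for A :: "'a set"
    by (rule linear_eq_blade[OF linear_comp[OF c linear_cmult(2)] linear_comp[OF linear_cmult(1) c] 1])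
  show ?thesis
    by (rule linear_eq_blade[OF linear_comp[OF c linear_cmult(1)] linear_comp[OF linear_cmult(2) c] 2])
qed


section \<open>Monogenic functions\<close>

text \<open>\<open>(z\<^sub>0, (z\<^sub>1, \<dots>, z\<^sub>m))\<close> stands for the paravector \<open>z\<^sub>0 + z\<^sub>1 e\<^sub>1 + \<dots> + z\<^sub>m e\<^sub>m\<close>.\<close>

type_synonym 'n paravector = "real \<times> (real ^ 'n)"

definition dirac ::
    "('n::{finite,linorder} paravector \<Rightarrow> 'n clifford) \<Rightarrow> 'n paravector \<Rightarrow> 'n clifford" where
  "dirac f z = frechet_derivative f (at z) (1, 0)
     + (\<Sum>j\<in>UNIV. blade {j} \<odot> frechet_derivative f (at z) (0, axis j 1))"

definition left_monogenic ::
    "'n::{finite,linorder} paravector set \<Rightarrow> ('n paravector \<Rightarrow> 'n clifford) \<Rightarrow> bool" where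
  "left_monogenic G f \<longleftrightarrow> (\<forall>z\<in>G. f differentiable (at z) \<and> dirac f z = 0)"


section \<open>Domains with smooth boundary and surface measure\<close>

definition C2_function :: "('a::euclidean_space \<Rightarrow> real) \<Rightarrow> bool" where
  "C2_function g \<longleftrightarrow> (\<exists>g' g''.
     (\<forall>x. (g has_derivative blinfun_apply (g' x)) (at x)) \<and>
     (\<forall>x. (g' has_derivative blinfun_apply (g'' x)) (at x)) \<and>
     continuous_on UNIV (g'' :: 'a \<Rightarrow> 'a \<Rightarrow>\<^sub>L 'a \<Rightarrow>\<^sub>L real))"

text \<open>
  Near every boundary point the set is, in suitable orthonormal coordinates, the region
  on one side of the graph of a \<open>C\<^sup>2\<close> function.
\<close>

definition C2_boundary :: "'n::finite paravector set \<Rightarrow> bool" where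
  "C2_boundary G \<longleftrightarrow> (\<forall>p\<in>frontier G. \<exists>U T \<gamma>. open U \<and> p \<in> U \<and>
     orthogonal_transformation (T :: 'n paravector \<Rightarrow> 'n paravector) \<and>
     C2_function (\<gamma> :: real ^ 'n \<Rightarrow> real) \<and>
     G \<inter> U = {x \<in> U. fst (T x) > \<gamma> (snd (T x))})"

text \<open>
  Surface measure is the Hausdorff measure of dimension \<open>m\<close>, normalised so that it agrees with
  Lebesgue measure on \<open>m\<close>-dimensional subspaces.
\<close>

definition hausdorff_pre :: "nat \<Rightarrow> real \<Rightarrow> 'a::metric_space set \<Rightarrow> ennreal" where
  "hausdorff_pre d \<delta> A =
     (INF C\<in>{C :: nat \<Rightarrow> 'a set. A \<subseteq> (\<Union>i. C i) \<and> (\<forall>i. bounded (C i) \<and> diameter (C i) \<le> \<delta>)}.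
        \<Sum>i. ennreal (unit_ball_vol (real d) * (diameter (C i) / 2) ^ d))"

definition hausdorff_outer :: "nat \<Rightarrow> 'a::metric_space set \<Rightarrow> ennreal" where
  "hausdorff_outer d A = (SUP \<delta>\<in>{0<..}. hausdorff_pre d \<delta> A)"

definition hausdorff_measure :: "nat \<Rightarrow> 'a::metric_space measure" where
  "hausdorff_measure d = measure_of UNIV (sets borel) (hausdorff_outer d)"

text \<open>
  \<^const>\<open>measure_of\<close> yields the intended values only because the outer measure is countably
  additive on Borel sets (Caratheodory's criterion for metric outer measures); this is
  \<open>emeasure_hausdorff_measure\<close> below.
\<close>

lemma hausdorff_pre_mono: "A \<subseteq> B \<Longrightarrow> hausdorff_pre d \<delta> A \<le> hausdorff_pre d \<delta> B"
  unfolding hausdorff_pre_def by (rule INF_superset_mono) auto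

lemma hausdorff_outer_mono: "A \<subseteq> B \<Longrightarrow> hausdorff_outer d A \<le> hausdorff_outer d B"
  unfolding hausdorff_outer_def by (intro SUP_mono' hausdorff_pre_mono)

lemma hausdorff_pre_antimono: "\<delta> \<le> \<epsilon> \<Longrightarrow> hausdorff_pre d \<epsilon> A \<le> hausdorff_pre d \<delta> A"
  unfolding hausdorff_pre_def by (rule INF_superset_mono) (auto intro: order_trans)

lemma hausdorff_outer_empty:
  assumes "d > 0"
  shows "hausdorff_outer d {} = 0"
proof -
  have "hausdorff_pre d \<delta> ({} :: 'a set) \<le> 0" if "\<delta> > 0" for \<delta>
    unfolding hausdorff_pre_def
    by (rule INF_lower2[of "\<lambda>_. {}"]) (use that assms in \<open>auto simp: zero_power\<close>)
  then show ?thesis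
    by (auto simp: hausdorff_outer_def)
qed

lemma hausdorff_pre_UN:
  "hausdorff_pre d \<delta> (\<Union>n. A n) \<le> (\<Sum>n. hausdorff_pre d \<delta> (A n))"
proof (rule ennreal_le_epsilon)
  fix e :: real
  assume fin: "(\<Sum>n. hausdorff_pre d \<delta> (A n)) < top" and e: "0 < e"
  let ?c = "\<lambda>S. ennreal (unit_ball_vol (real d) * (diameter S / 2) ^ d)"
  have "\<exists>C. A n \<subseteq> (\<Union>i. C i) \<and> (\<forall>i. bounded (C i) \<and> diameter (C i) \<le> \<delta>)
      \<and> (\<Sum>i. ?c (C i)) \<le> hausdorff_pre d \<delta> (A n) + e * (1/2) ^ Suc n" for n
  proof -
    have "hausdorff_pre d \<delta> (A n) < top"
      using fin by (auto simp: less_top dest!: ennreal_suminf_lessD)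
    then have "hausdorff_pre d \<delta> (A n) \<noteq> \<infinity>" by auto
    from INF_approx_ennreal[OF _ hausdorff_pre_def this, of "e * (1/2) ^ Suc n"] e
    show ?thesis by (auto intro: less_imp_le)
  qed
  then obtain C where C: "\<And>n. A n \<subseteq> (\<Union>i. C n i)"
      "\<And>n i. bounded (C n i)" "\<And>n i. diameter (C n i) \<le> \<delta>"
      "\<And>n. (\<Sum>i. ?c (C n i)) \<le> hausdorff_pre d \<delta> (A n) + e * (1/2) ^ Suc n"
    by metis
  define D where "D = case_prod C \<circ> prod_decode"
  have "(\<Union>n. A n) \<subseteq> (\<Union>k. D k)"
    using C(1) by (auto simp add: D_def subset_eq) (metis prod.case prod_encode_inverse)
  then have "hausdorff_pre d \<delta> (\<Union>n. A n) \<le> (\<Sum>k. ?c (D k))"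
    unfolding hausdorff_pre_def using C(2,3)
    by (intro INF_lower) (auto simp: D_def split: prod.split)
  also have "\<dots> = (\<Sum>k. (\<lambda>p. ?c (case_prod C p)) (prod_decode k))"
    by (simp add: D_def)
  also have "\<dots> = (\<Sum>n. \<Sum>i. ?c (C n i))"
    by (rule suminf_ennreal_2dimen) simp
  also have "\<dots> \<le> (\<Sum>n. hausdorff_pre d \<delta> (A n) + e * (1/2) ^ Suc n)"
    by (intro suminf_le allI C(4)) auto
  also have "\<dots> = (\<Sum>n. hausdorff_pre d \<delta> (A n)) + (\<Sum>n. ennreal e * ennreal ((1/2) ^ Suc n))"
    using e by (subst suminf_add)
      (auto simp del: ennreal_suminf_cmult simp add: ennreal_mult[symmetric])
  also have "\<dots> = (\<Sum>n. hausdorff_pre d \<delta> (A n)) + e"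
    unfolding ennreal_suminf_cmult
    by (subst suminf_ennreal_eq[OF zero_le_power power_half_series]) auto
  finally show "hausdorff_pre d \<delta> (\<Union>n. A n) \<le> (\<Sum>n. hausdorff_pre d \<delta> (A n)) + ennreal e" .
qed

lemma hausdorff_outer_UN:
  "hausdorff_outer d (\<Union>n. A n) \<le> (\<Sum>n. hausdorff_outer d (A n))"
  unfolding hausdorff_outer_def
proof (rule SUP_least)
  fix \<delta> :: real assume \<delta>: "\<delta> \<in> {0<..}"
  have "hausdorff_pre d \<delta> (\<Union>n. A n) \<le> (\<Sum>n. hausdorff_pre d \<delta> (A n))"
    by (rule hausdorff_pre_UN)
  also have "\<dots> \<le> (\<Sum>n. SUP \<delta>\<in>{0<..}. hausdorff_pre d \<delta> (A n))"
    using \<delta> by (intro suminf_le allI SUP_upper) auto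
  finally show "hausdorff_pre d \<delta> (\<Union>n. A n) \<le> (\<Sum>n. SUP \<delta>\<in>{0<..}. hausdorff_pre d \<delta> (A n))" .
qed

lemma outer_measure_space_hausdorff:
  "d > 0 \<Longrightarrow> outer_measure_space (Pow UNIV) (hausdorff_outer d)"
  by (auto simp: outer_measure_space_def positive_def increasing_def countably_subadditive_def
      hausdorff_outer_empty hausdorff_outer_mono hausdorff_outer_UN)

lemma hausdorff_outer_Un:
  assumes "d > 0"
  shows "hausdorff_outer d (A \<union> B) \<le> hausdorff_outer d A + hausdorff_outer d B"
proof -
  have "hausdorff_outer d (\<Union>n. if n = 0 then A else if n = (1::nat) then B else {})
      \<le> (\<Sum>n. hausdorff_outer d (if n = 0 then A else if n = (1::nat) then B else {}))"
    by (rule hausdorff_outer_UN)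
  also have "\<dots> = (\<Sum>n\<in>{0,1}. hausdorff_outer d (if n = 0 then A else if n = (1::nat) then B else {}))"
    by (rule suminf_finite) (auto simp: hausdorff_outer_empty[OF assms])
  also have "(\<Union>n. (\<lambda>n. if n = 0 then A else if n = (1::nat) then B else {}) n) = A \<union> B"
    by (auto split: if_splits)
  finally show ?thesis by simp
qed

lemma hausdorff_outer_separated:
  assumes d: "d > 0" and r: "r > 0" and sep: "\<And>x y. x \<in> A \<Longrightarrow> y \<in> B \<Longrightarrow> r \<le> dist x y"
  shows "hausdorff_outer d A + hausdorff_outer d B \<le> hausdorff_outer d (A \<union> B)"
proof -
  let ?c = "\<lambda>S. ennreal (unit_ball_vol (real d) * (diameter S / 2) ^ d)"
  have *: "hausdorff_pre d \<delta> A + hausdorff_pre d \<delta> B \<le> hausdorff_pre d \<delta> (A \<union> B)"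
    if \<delta>: "0 < \<delta>" "\<delta> < r" for \<delta>
    unfolding hausdorff_pre_def[of d \<delta> "A \<union> B"]
  proof (rule INF_greatest)
    fix C :: "nat \<Rightarrow> 'a set"
    assume C: "C \<in> {C. A \<union> B \<subseteq> (\<Union>i. C i) \<and> (\<forall>i. bounded (C i) \<and> diameter (C i) \<le> \<delta>)}"
    define C1 where "C1 i = (if C i \<inter> A = {} then {} else C i)" for i
    define C2 where "C2 i = (if C i \<inter> B = {} then {} else C i)" for i
    have "C i \<inter> A = {} \<or> C i \<inter> B = {}" for i
    proof (rule ccontr)
      assume "\<not> ?thesis"
      then obtain x y where "x \<in> C i" "x \<in> A" "y \<in> C i" "y \<in> B" by auto
      moreover from this C have "dist x y \<le> diameter (C i)"
        by (intro diameter_bounded_bound) auto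
      moreover have "diameter (C i) \<le> \<delta>" using C by auto
      ultimately show False using sep[of x y] \<delta> by simp
    qed
    then have le: "?c (C1 i) + ?c (C2 i) \<le> ?c (C i)" for i
      using d by (cases "C i \<inter> A = {}"; cases "C i \<inter> B = {}")
        (auto simp: C1_def C2_def zero_power)
    have "hausdorff_pre d \<delta> A \<le> (\<Sum>i. ?c (C1 i))"
      unfolding hausdorff_pre_def
      by (rule INF_lower) (use C \<delta> in \<open>fastforce simp: C1_def\<close>)
    moreover have "hausdorff_pre d \<delta> B \<le> (\<Sum>i. ?c (C2 i))"
      unfolding hausdorff_pre_def
      by (rule INF_lower) (use C \<delta> in \<open>fastforce simp: C2_def\<close>)
    ultimately have "hausdorff_pre d \<delta> A + hausdorff_pre d \<delta> B \<le> (\<Sum>i. ?c (C1 i)) + (\<Sum>i. ?c (C2 i))"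
      by (rule add_mono)
    also have "\<dots> = (\<Sum>i. ?c (C1 i) + ?c (C2 i))"
      by (rule suminf_add) auto
    also have "\<dots> \<le> (\<Sum>i. ?c (C i))"
      by (intro suminf_le allI le) auto
    finally show "hausdorff_pre d \<delta> A + hausdorff_pre d \<delta> B \<le> (\<Sum>i. ?c (C i))" .
  qed
  have "hausdorff_outer d A + hausdorff_outer d B
      = (SUP \<delta>\<in>{0<..}. hausdorff_outer d A + hausdorff_pre d \<delta> B)"
    unfolding hausdorff_outer_def[of d B] by (simp add: ennreal_SUP_add_right)
  also have "\<dots> = (SUP \<delta>\<in>{0<..}. SUP \<epsilon>\<in>{0<..}. hausdorff_pre d \<epsilon> A + hausdorff_pre d \<delta> B)"
    unfolding hausdorff_outer_def[of d A]
    by (intro SUP_cong refl ennreal_SUP_add_left[symmetric]) auto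
  also have "\<dots> \<le> hausdorff_outer d (A \<union> B)"
  proof (intro SUP_least)
    fix \<delta> \<epsilon> :: real assume "\<delta> \<in> {0<..}" "\<epsilon> \<in> {0<..}"
    define \<eta> where "\<eta> = min (min \<delta> \<epsilon>) (r / 2)"
    have \<eta>: "0 < \<eta>" "\<eta> < r" "\<eta> \<le> \<delta>" "\<eta> \<le> \<epsilon>"
      using \<open>\<delta> \<in> _\<close> \<open>\<epsilon> \<in> _\<close> r by (auto simp: \<eta>_def)
    have "hausdorff_pre d \<epsilon> A + hausdorff_pre d \<delta> B \<le> hausdorff_pre d \<eta> A + hausdorff_pre d \<eta> B"
      by (intro add_mono hausdorff_pre_antimono \<eta>)
    also have "\<dots> \<le> hausdorff_pre d \<eta> (A \<union> B)" by (intro * \<eta>)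
    also have "\<dots> \<le> hausdorff_outer d (A \<union> B)"
      unfolding hausdorff_outer_def using \<eta> by (intro SUP_upper) auto
    finally show "hausdorff_pre d \<epsilon> A + hausdorff_pre d \<delta> B \<le> hausdorff_outer d (A \<union> B)" .
  qed
  finally show ?thesis .
qed

lemma hausdorff_outer_closed:
  fixes F :: "'a::metric_space set"
  assumes d: "d > 0" and F: "closed F"
  shows "hausdorff_outer d (F \<inter> X) + hausdorff_outer d (X - F) \<le> hausdorff_outer d X"
proof (cases "F = {} \<or> hausdorff_outer d X = top")
  case True
  then show ?thesis by (auto simp: hausdorff_outer_empty[OF d])
next
  case False
  let ?H = "hausdorff_outer d"
  define Y where "Y n = {y \<in> X. infdist y F > 1 / (real n + 1)}" for n
  define R where "R n = Y (Suc n) - Y n" for n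
  have lip: "infdist x F \<le> infdist y F + dist x y" for x y
    by (rule infdist_triangle)
  have part: "(\<Sum>i<n. ?H (R (2 * i + p))) \<le> ?H (\<Union>i<n. R (2 * i + p))" for n p
  proof (induction n)
    case (Suc n)
    let ?U = "\<Union>i<n. R (2 * i + p)"
    define q where "q = real (2 * n + p)"
    have "?H ?U + ?H (R (2 * n + p)) \<le> ?H (?U \<union> R (2 * n + p))"
    proof (cases "n = 0")
      case True then show ?thesis by (simp add: hausdorff_outer_empty[OF d])
    next
      case False
      then have q: "q > 0" by (simp add: q_def)
      show ?thesis
      proof (rule hausdorff_outer_separated[OF d, of "1 / q - 1 / (q + 1)"])
        show "0 < 1 / q - 1 / (q + 1)" using q by (simp add: field_simps add_pos_pos)
        fix x y assume "x \<in> ?U" "y \<in> R (2 * n + p)"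
        then obtain i where i: "i < n" "x \<in> R (2 * i + p)" by auto
        then have "infdist x F > 1 / (real (Suc (2 * i + p)) + 1)" by (simp add: R_def Y_def)
        moreover have "1 / q \<le> 1 / (real (Suc (2 * i + p)) + 1)"
          using i(1) by (intro divide_left_mono) (auto simp: q_def)
        moreover have "infdist y F \<le> 1 / (q + 1)"
          using \<open>y \<in> _\<close> by (auto simp: R_def Y_def q_def)
        ultimately show "1 / q - 1 / (q + 1) \<le> dist x y"
          using lip[of x y] by linarith
      qed
    qed
    with add_right_mono[OF Suc, of "?H (R (2 * n + p))"]
    have "(\<Sum>i<n. ?H (R (2 * i + p))) + ?H (R (2 * n + p)) \<le> ?H (?U \<union> R (2 * n + p))"
      by (rule order_trans)
    then show ?case
      by (simp add: lessThan_Suc Un_commute add.commute)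
  qed (simp add: hausdorff_outer_empty[OF d])
  have RX: "R n \<subseteq> X" for n by (auto simp: R_def Y_def)
  have half: "(\<Sum>i<n. ?H (R (2 * i + p))) \<le> ?H X" for n p
    by (rule order_trans[OF part hausdorff_outer_mono]) (use RX in auto)
  have split: "(\<Sum>i<2 * n. ?H (R i)) = (\<Sum>i<n. ?H (R (2 * i + 0))) + (\<Sum>i<n. ?H (R (2 * i + 1)))" for n
    by (induction n) (auto simp: algebra_simps)
  have "(\<Sum>i<n. ?H (R i)) \<le> ?H X + ?H X" for n
  proof -
    have "(\<Sum>i<n. ?H (R i)) \<le> (\<Sum>i<2 * n. ?H (R i))" by (rule sum_mono2) auto
    also have "\<dots> \<le> ?H X + ?H X" unfolding split by (intro add_mono half)
    finally show ?thesis .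
  qed
  then have "(\<Sum>i. ?H (R i)) \<le> ?H X + ?H X"
    by (auto simp: suminf_eq_SUP intro: SUP_least)
  also have "\<dots> < top" using False by (simp add: less_top[symmetric])
  finally have fin: "(\<Sum>i. ?H (R i)) < top" .
  define tail where "tail n = (\<Sum>i. ?H (R (i + n)))" for n
  have tail: "tail \<longlonglongrightarrow> 0"
  proof -
    have s: "(\<lambda>n. \<Sum>i<n. ?H (R i)) \<longlonglongrightarrow> (\<Sum>i. ?H (R i))"
      by (rule summable_LIMSEQ) auto
    have "(\<lambda>n. (\<Sum>i. ?H (R i)) - (\<Sum>i<n. ?H (R i))) \<longlonglongrightarrow> (\<Sum>i. ?H (R i)) - (\<Sum>i. ?H (R i))"
      using fin by (intro tendsto_diff_ennreal s tendsto_const) (auto simp: less_top)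
    moreover have "(\<Sum>i. ?H (R i)) - (\<Sum>i<n. ?H (R i)) = tail n" for n
    proof -
      have "(\<Sum>i. ?H (R i)) = (\<Sum>i<n. ?H (R i)) + tail n"
        unfolding tail_def using suminf_offset[of "\<lambda>i. ?H (R i)" n] by (simp add: add.commute)
      moreover have "(\<Sum>i<n. ?H (R i)) \<noteq> top"
        using fin calculation by (auto simp: less_top)
      ultimately show ?thesis by (simp add: ennreal_add_diff_cancel_left)
    qed
    ultimately show ?thesis using fin by (simp add: less_top ennreal_minus_cancel_iff)
  qed
  have le: "?H (F \<inter> X) + ?H (X - F) \<le> ?H X + tail n" for n
  proof -
    have "X - F \<subseteq> Y n \<union> (\<Union>i. R (i + n))"
    proof
      fix y assume y: "y \<in> X - F"
      then have "infdist y F > 0"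
        using F False by (metis DiffD2 in_closed_iff_infdist_zero infdist_nonneg less_eq_real_def)
      then obtain k where "1 / (real k + 1) < infdist y F"
        using reals_Archimedean[of "infdist y F"] by (auto simp: inverse_eq_divide add.commute)
      then have "y \<in> Y k" using y by (simp add: Y_def)
      have "y \<in> Y n \<or> y \<in> (\<Union>i. R (i + n))"
      proof (rule ccontr)
        assume c: "\<not> ?thesis"
        have "y \<notin> Y (i + n)" for i
        proof (induction i)
          case (Suc i)
          then show ?case using c by (force simp: R_def)
        qed (use c in simp)
        moreover have "y \<in> Y (k + n)"
        proof -
          have "1 / (real (k + n) + 1) \<le> 1 / (real k + 1)" by (intro divide_left_mono) auto
          then show ?thesis using \<open>y \<in> Y k\<close> by (auto simp: Y_def)
        qed
        ultimately show False by blast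
      qed
      then show "y \<in> Y n \<union> (\<Union>i. R (i + n))" by blast
    qed
    then have "?H (X - F) \<le> ?H (Y n \<union> (\<Union>i. R (i + n)))"
      by (rule hausdorff_outer_mono)
    also have "\<dots> \<le> ?H (Y n) + ?H (\<Union>i. R (i + n))"
      by (rule hausdorff_outer_Un[OF d])
    also have "\<dots> \<le> ?H (Y n) + tail n"
      unfolding tail_def by (intro add_left_mono hausdorff_outer_UN)
    finally have 1: "?H (X - F) \<le> ?H (Y n) + tail n" .
    have "?H (F \<inter> X) + ?H (Y n) \<le> ?H ((F \<inter> X) \<union> Y n)"
    proof (rule hausdorff_outer_separated[OF d, of "1 / (real n + 1)"])
      fix x y assume "x \<in> F \<inter> X" "y \<in> Y n"
      then show "1 / (real n + 1) \<le> dist x y"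
        using lip[of y x] by (auto simp: Y_def dist_commute)
    qed simp
    also have "\<dots> \<le> ?H X"
      by (rule hausdorff_outer_mono) (auto simp: Y_def)
    finally have 2: "?H (F \<inter> X) + ?H (Y n) \<le> ?H X" .
    have "?H (F \<inter> X) + ?H (X - F) \<le> ?H (F \<inter> X) + (?H (Y n) + tail n)"
      using 1 by (rule add_left_mono)
    also have "\<dots> = (?H (F \<inter> X) + ?H (Y n)) + tail n" by (simp only: add.assoc)
    also have "\<dots> \<le> ?H X + tail n" using 2 by (rule add_right_mono)
    finally show ?thesis .
  qed
  have "(\<lambda>n. ?H X + tail n) \<longlonglongrightarrow> ?H X + 0"
    by (intro tendsto_add tendsto_const tail)
  then show ?thesis
    using le by (intro LIMSEQ_le_const[where X="\<lambda>n. ?H X + tail n"]) auto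
qed

lemma emeasure_hausdorff_measure:
  assumes d: "d > 0" and A: "A \<in> sets borel"
  shows "emeasure (hausdorff_measure d) A = hausdorff_outer d (A :: 'a::metric_space set)"
proof -
  interpret sigma_algebra "UNIV :: 'a set" "Pow UNIV" by (rule sigma_algebra_Pow)
  let ?L = "lambda_system (UNIV :: 'a set) (Pow UNIV) (hausdorff_outer d)"
  have ms: "measure_space UNIV ?L (hausdorff_outer d)"
    by (rule caratheodory_lemma[OF outer_measure_space_hausdorff[OF d]])
  then interpret L: sigma_algebra UNIV ?L by (simp add: measure_space_def)
  have "F \<in> ?L" if "closed F" for F
  proof -
    have "hausdorff_outer d X \<le> hausdorff_outer d (F \<inter> X) + hausdorff_outer d (X - F)" for X
    proof -
      have "(F \<inter> X) \<union> (X - F) = X" by blast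
      then show ?thesis
        using hausdorff_outer_Un[OF d, of "F \<inter> X" "X - F"] by simp
    qed
    then show ?thesis
      using hausdorff_outer_closed[OF d that]
      by (auto simp: lambda_system_def Diff_eq Int_commute intro!: antisym)
  qed
  then have "sigma_sets UNIV (Collect closed) \<subseteq> ?L"
    by (intro L.sigma_sets_subset) auto
  then have sub: "sets borel \<subseteq> ?L"
    by (simp add: borel_eq_closed)
  show ?thesis
    unfolding hausdorff_measure_def
  proof (rule emeasure_measure_of_sigma)
    show "sigma_algebra UNIV (sets (borel :: 'a measure))"
      using sets.sigma_algebra_axioms[of "borel :: 'a measure"] by simp
    show "positive (sets borel) (hausdorff_outer d :: 'a set \<Rightarrow> ennreal)"
      by (simp add: positive_def hausdorff_outer_empty[OF d])
    show "countably_additive (sets borel) (hausdorff_outer d :: 'a set \<Rightarrow> ennreal)"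
      using ms sub unfolding measure_space_def countably_additive_def by blast
  qed (rule A)
qed

definition surface_measure :: "'n::finite paravector set \<Rightarrow> 'n paravector measure" where
  "surface_measure G = restrict_space (hausdorff_measure CARD('n)) (frontier G)"


section \<open>Hardy space and Szego kernel\<close>

definition square_integrable ::
    "'n::{finite,linorder} paravector set \<Rightarrow> ('n paravector \<Rightarrow> 'n clifford) \<Rightarrow> bool" where
  "square_integrable G f \<longleftrightarrow> f \<in> borel_measurable (surface_measure G) \<and>
     integrable (surface_measure G) (\<lambda>w. (norm (f w))\<^sup>2)"

definition hardy_inner ::
    "'n::{finite,linorder} paravector set \<Rightarrow> ('n paravector \<Rightarrow> 'n clifford) \<Rightarrow>
     ('n paravector \<Rightarrow> 'n clifford) \<Rightarrow> 'n clifford" where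
  "hardy_inner G f g = (\<integral>w. cconj (f w) \<odot> g w \<partial>surface_measure G)"

definition hardy_norm ::
    "'n::{finite,linorder} paravector set \<Rightarrow> ('n paravector \<Rightarrow> 'n clifford) \<Rightarrow> real" where
  "hardy_norm G f = sqrt (Sc (hardy_inner G f f))"

text \<open>
  Functions monogenic in \<open>G\<close> have boundary values through continuity up to the boundary.
\<close>

definition hardy_generators ::
    "'n::{finite,linorder} paravector set \<Rightarrow> ('n paravector \<Rightarrow> 'n clifford) set" where
  "hardy_generators G =
     {f. continuous_on (closure G) f \<and> left_monogenic G f \<and> square_integrable G f}"

text \<open>
  An element of the Hardy space is a single function on the closure of \<open>G\<close>: on the frontier
  it represents a class in the \<open>L\<^sup>2\<close>-closure, and in \<open>G\<close> it is the monogenic function that this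
  class determines, since \<open>L\<^sup>2\<close>-convergence on the boundary forces pointwise convergence in \<open>G\<close>
  (point evaluations are bounded). Values outside the closure of \<open>G\<close> are irrelevant.
\<close>

definition hardy_space ::
    "'n::{finite,linorder} paravector set \<Rightarrow> ('n paravector \<Rightarrow> 'n clifford) set" where
  "hardy_space G = {f. square_integrable G f \<and> left_monogenic G f \<and>
     (\<exists>F. (\<forall>n. F n \<in> hardy_generators G) \<and>
        (\<lambda>n. hardy_norm G (\<lambda>w. F n w - f w)) \<longlonglongrightarrow> 0 \<and>
        (\<forall>z\<in>G. (\<lambda>n. F n z) \<longlonglongrightarrow> f z))}"

text \<open>
  The reproducing property determines \<open>K z w\<close> for \<open>z, w \<in> G\<close>, and for \<open>z \<in> G\<close> and almost every
  \<open>w\<close> in the frontier.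
\<close>

definition szego_kernel ::
    "'n::{finite,linorder} paravector set \<Rightarrow>
     ('n paravector \<Rightarrow> 'n paravector \<Rightarrow> 'n clifford) \<Rightarrow> bool" where
  "szego_kernel G K \<longleftrightarrow> (\<forall>z\<in>G. (\<lambda>w. cconj (K z w)) \<in> hardy_space G \<and>
     (\<forall>f\<in>hardy_space G. f z = (\<integral>w. K z w \<odot> f w \<partial>surface_measure G)))"


section \<open>Conformal metrics\<close>

text \<open>
  The length is an extended nonnegative number because \<^const>\<open>valid_path\<close> does not bound the
  derivative at the exceptional points, so it admits paths of infinite length.
\<close>

definition metric_length :: "('a::euclidean_space \<Rightarrow> real) \<Rightarrow> (real \<Rightarrow> 'a) \<Rightarrow> ennreal" where
  "metric_length lam C =
     (\<integral>\<^sup>+t\<in>{0..1}. ennreal (lam (C t) * norm (vector_derivative C (at t))) \<partial>lborel)"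

definition metric_dist ::
    "'a::euclidean_space set \<Rightarrow> ('a \<Rightarrow> real) \<Rightarrow> 'a \<Rightarrow> 'a \<Rightarrow> real" where
  "metric_dist G lam z1 z2 = enn2real (INF C\<in>{C. valid_path C \<and> path_image C \<subseteq> G \<and>
     pathstart C = z1 \<and> pathfinish C = z2}. metric_length lam C)"

text \<open>Since \<open>K z z\<close> is real, it is represented by its scalar part.\<close>

definition szego_density ::
    "('n::{finite,linorder} paravector \<Rightarrow> 'n paravector \<Rightarrow> 'n clifford) \<Rightarrow>
     'n paravector \<Rightarrow> real" where
  "szego_density K z = Sc (K z z)"

end

theory Submission
  imports Defs
begin

text \<open>
  With the conjugate of \<open>K z\<close> as reproducing element, \<open>K z z\<close> is the supremum of
  \<open>2 Sc (f z) - \<parallel>f\<parallel>\<^sup>2\<close> over the Hardy space; in particular it is lower semicontinuous.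

  Lower bound: a boundary point close to \<open>z\<close> has an exterior point \<open>e\<close> at distance comparable to
  \<open>\<delta> = dist z (\<partial>G)\<close> from both \<open>z\<close> and \<open>\<partial>G\<close>. Testing with the Cauchy kernel with pole \<open>e\<close>, whose
  square norm over \<open>\<partial>G\<close> is \<open>O(\<delta>\<^sup>-\<^sup>m)\<close> because surface balls of radius \<open>r\<close> have measure \<open>O(r\<^sup>m)\<close>,
  gives \<open>K z z \<ge> c \<delta>\<^sup>-\<^sup>m \<ge> c' / \<delta>\<close>.

  Upper bound: multiplying a regularised Cauchy kernel with pole \<open>z\<close> by a cutoff \<open>\<phi>\<close> that vanishes
  near \<open>\<partial>G\<close> represents \<open>f z\<close> by an integral over an \<open>\<epsilon>\<close>-shell along \<open>\<partial>G\<close>, which is at most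
  \<open>C \<integral> |f| dS\<close> because surface balls of radius \<open>r\<close> have measure at least \<open>c r\<^sup>m\<close>. So point
  evaluations, and with them \<open>K z z\<close>, are locally bounded.

  Completeness: by the lower bound, leaving the ball of radius \<open>\<delta> / 2\<close> around \<open>z\<close> costs length at
  least \<open>c' / 3\<close>, so the tail of a Cauchy sequence stays in a compact subset of \<open>G\<close>.
\<close>

section \<open>The divergence theorem for differentiable fields\<close>

text \<open>Two obstacles shape the argument. Monogenic means differentiable with
  \<open>dirac f z = 0\<close>, so integration by parts cannot rely on continuous derivatives; hence
  a divergence theorem in which only the divergence itself has to be continuous. And the surface
  measure is a Hausdorff measure without a normal field, so all identities are volume integrals and
  the frontier enters through the measure of small balls alone. A cutoff built on a finite net of
  the frontier makes this enough: sums over the net compare with integrals over disjoint surface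
  balls.

  Regularising the Cauchy kernel avoids excising a ball around the pole; the resulting bump has mass
  bounded below, and its exact mass is never computed.

  The density is accessible only through the reproducing property. Lower semicontinuity suffices to
  integrate it along paths; local boundedness makes distances finite and turns Euclidean limits into
  limits for the metric. The rate \<open>1 / \<delta>\<close> is the borderline at which the
  frontier becomes infinitely far away; it follows from the power \<open>-m\<close> because
  \<open>m\<close> is at least 1 and \<open>G\<close> is bounded.\<close>

lemma integral_translate_diff_bound:
  fixes r :: "'a::euclidean_space \<Rightarrow> real"
  assumes r: "continuous_on UNIV r" and k: "k \<in> Basis" and h: "0 < h" "h \<le> s" and M: "0 \<le> M"
    and bd: "\<And>x. x \<in> cbox a (a + s *\<^sub>R One) \<Longrightarrow> \<bar>r x\<bar> \<le> M \<and> \<bar>r (x + h *\<^sub>R k)\<bar> \<le> M"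
  shows "\<bar>integral (cbox a (a + s *\<^sub>R One)) (\<lambda>x. r (x + h *\<^sub>R k) - r x)\<bar>
    \<le> 2 * M * h * s ^ (DIM('a) - 1)"
proof -
  define b where "b = a + s *\<^sub>R One"
  have rc: "continuous_on S r" for S using r continuous_on_subset by blast
  have int: "r integrable_on cbox u v" for u v by (rule integrable_continuous) (rule rc)
  have bi: "i \<in> Basis \<Longrightarrow> b \<bullet> i = a \<bullet> i + s" for i by (simp add: b_def inner_simps)
  have "(\<lambda>x. r (x + h *\<^sub>R k)) integrable_on cbox a b"
    by (rule integrable_continuous, rule continuous_on_compose2[OF r]) (auto intro!: continuous_intros)
  then have 1: "integral (cbox a b) (\<lambda>x. r (x + h *\<^sub>R k) - r x)
      = integral (cbox (a + h *\<^sub>R k) (b + h *\<^sub>R k)) r - integral (cbox a b) r"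
    using integral_shift_cbox[of "a + h *\<^sub>R k" "h *\<^sub>R k" "b + h *\<^sub>R k" r]
    by (simp add: integral_diff int)
  \<comment> \<open>The cube and its translate overlap in everything but one slab of thickness
    \<open>h\<close> on each side, and the common part (\<open>mid\<close>) cancels. The slabs carry
    the factor \<open>h\<close> that later pays for the division by \<open>h\<close>.\<close>
  define S1 S2 where "S1 = cbox a (b - (s - h) *\<^sub>R k)" and "S2 = cbox (a + s *\<^sub>R k) (b + h *\<^sub>R k)"
  have ik: "i \<in> Basis \<Longrightarrow> k \<bullet> i = (if i = k then 1 else 0)" for i using k by (auto simp: inner_Basis)
  have s1: "cbox a b \<inter> {x. x \<bullet> k \<le> a \<bullet> k + h} = S1"
    using h k by (auto simp: S1_def mem_box bi ik inner_simps split: if_splits) fastforce+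
  have s2: "cbox (a + h *\<^sub>R k) (b + h *\<^sub>R k) \<inter> {x. b \<bullet> k \<le> x \<bullet> k} = S2"
    using h k by (auto simp: S2_def mem_box bi ik inner_simps split: if_splits) fastforce+
  have mid: "cbox (a + h *\<^sub>R k) (b + h *\<^sub>R k) \<inter> {x. x \<bullet> k \<le> b \<bullet> k}
      = cbox a b \<inter> {x. a \<bullet> k + h \<le> x \<bullet> k}"
    using h k by (auto simp: mem_box bi ik inner_simps split: if_splits) fastforce+
  have "integral (cbox a b) r = integral S1 r + integral (cbox a b \<inter> {x. a \<bullet> k + h \<le> x \<bullet> k}) r"
    using integral_split[OF int k, of a b "a \<bullet> k + h"] by (simp add: s1)
  moreover have "integral (cbox (a + h *\<^sub>R k) (b + h *\<^sub>R k)) r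
      = integral (cbox a b \<inter> {x. a \<bullet> k + h \<le> x \<bullet> k}) r + integral S2 r"
    using integral_split[OF int k, of "a + h *\<^sub>R k" "b + h *\<^sub>R k" "b \<bullet> k"] by (simp add: s2 mid)
  ultimately have 2: "integral (cbox a b) (\<lambda>x. r (x + h *\<^sub>R k) - r x) = integral S2 r - integral S1 r"
    using 1 by simp
  have prod: "(\<Prod>i\<in>Basis. if i = k then h else s) = h * s ^ (DIM('a) - 1)"
    using k by (subst prod.remove[of _ k]) (auto simp: card_Diff_singleton)
  have side: "(b - (s - h) *\<^sub>R k) \<bullet> i - a \<bullet> i = (if i = k then h else s)"
      "(b + h *\<^sub>R k) \<bullet> i - (a + s *\<^sub>R k) \<bullet> i = (if i = k then h else s)" if "i \<in> Basis" for i
    using that by (auto simp: bi ik inner_diff_left inner_add_left)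
  have "a \<bullet> i \<le> (b - (s - h) *\<^sub>R k) \<bullet> i \<and> (a + s *\<^sub>R k) \<bullet> i \<le> (b + h *\<^sub>R k) \<bullet> i"
    if "i \<in> Basis" for i
    using side[OF that] h by (auto split: if_splits)
  then have c1: "measure lborel S1 = h * s ^ (DIM('a) - 1)"
    and c2: "measure lborel S2 = h * s ^ (DIM('a) - 1)"
    unfolding S1_def S2_def prod[symmetric]
    by (subst content_cbox; auto intro!: prod.cong simp: side simp del: inner_simps)+
  have "norm (integral S1 r) \<le> M * measure lborel S1" unfolding S1_def
  proof (rule has_integral_bound[OF M integrable_integral[OF int]])
    fix x assume "x \<in> cbox a (b - (s - h) *\<^sub>R k)"
    then have "x \<in> cbox a b" using s1 S1_def by auto
    then show "norm (r x) \<le> M" using bd by (auto simp: b_def)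
  qed
  moreover have "norm (integral S2 r) \<le> M * measure lborel S2" unfolding S2_def
  proof (rule has_integral_bound[OF M integrable_integral[OF int]])
    fix x assume "x \<in> cbox (a + s *\<^sub>R k) (b + h *\<^sub>R k)"
    then have "x \<in> cbox (a + h *\<^sub>R k) (b + h *\<^sub>R k)" using s2 S2_def by auto
    \<comment> \<open>\<open>S2\<close> sticks out of the original cube, so the bound comes from the
      second half of \<open>bd\<close>, taken at the point shifted back.\<close>
    then have "x - h *\<^sub>R k \<in> cbox a b" by (simp add: mem_box inner_simps le_diff_eq diff_le_eq)
    then show "norm (r x) \<le> M" using bd[of "x - h *\<^sub>R k"] by (auto simp: b_def)
  qed
  ultimately have "\<bar>integral (cbox a b) (\<lambda>x. r (x + h *\<^sub>R k) - r x)\<bar> \<le> M * measure lborel S1 + M * measure lborel S2"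
    unfolding 2 by simp
  then show ?thesis unfolding b_def by (simp add: c1 c2)
qed

text \<open>A cube is halved one coordinate at a time: each cut keeps a bad half, and after all
  coordinates the half is a cube again. The induction therefore runs over sets of directions, and
  \<open>Bad\<close> is stated for boxes.\<close>

lemma bisect_cube:
  fixes a :: "'a::euclidean_space" and Bad :: "'a \<Rightarrow> 'a \<Rightarrow> bool"
  assumes step: "\<And>a b k. k \<in> Basis \<Longrightarrow> (\<And>i. i \<in> Basis \<Longrightarrow> a \<bullet> i \<le> b \<bullet> i) \<Longrightarrow> Bad a b \<Longrightarrow>
      Bad a (b - ((b \<bullet> k - a \<bullet> k) / 2) *\<^sub>R k) \<or> Bad (a + ((b \<bullet> k - a \<bullet> k) / 2) *\<^sub>R k) b"
    and bad: "Bad a (a + s *\<^sub>R One)" and s: "0 \<le> s"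
  obtains a' where "Bad a' (a' + (s / 2) *\<^sub>R One)"
    "cbox a' (a' + (s / 2) *\<^sub>R One) \<subseteq> cbox a (a + s *\<^sub>R One)"
proof -
  \<comment> \<open>Diagonal of the intermediate box: the directions in \<open>B\<close> have been
    halved, the others still have length \<open>s\<close>.\<close>
  define w where "w B = (\<Sum>i\<in>Basis. (if i \<in> B then s / 2 else s) *\<^sub>R i)" for B :: "'a set"
  have wi: "i \<in> Basis \<Longrightarrow> w B \<bullet> i = (if i \<in> B then s / 2 else s)" for B i
    by (simp add: w_def)
  have "\<exists>a'. Bad a' (a' + w B) \<and> cbox a' (a' + w B) \<subseteq> cbox a (a + s *\<^sub>R One)"
    if "finite B" "B \<subseteq> Basis" for B
    using that
  proof (induction B rule: finite_induct)
    case empty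
    have "w {} = s *\<^sub>R One" by (simp add: w_def scaleR_sum_right)
    then show ?case using bad by auto
  next
    case (insert k B)
    then obtain a' where a': "Bad a' (a' + w B)" "cbox a' (a' + w B) \<subseteq> cbox a (a + s *\<^sub>R One)"
      by auto
    have k: "k \<in> Basis" using insert by auto
    have wk: "w (insert k B) = w B - (s / 2) *\<^sub>R k"
      by (rule euclidean_eqI) (use insert k in \<open>auto simp: wi inner_simps inner_Basis\<close>)
    have half: "((a' + w B) \<bullet> k - a' \<bullet> k) / 2 = s / 2"
      using insert k by (simp add: inner_simps wi)
    have "Bad a' (a' + w B - (s / 2) *\<^sub>R k) \<or> Bad (a' + (s / 2) *\<^sub>R k) (a' + w B)"
      using step[OF k _ a'(1)] s unfolding half by (simp add: inner_simps wi)
    then show ?case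
    proof
      assume "Bad a' (a' + w B - (s / 2) *\<^sub>R k)"
      moreover have "cbox a' (a' + w (insert k B)) \<subseteq> cbox a' (a' + w B)"
        using s by (subst subset_box) (auto simp: wi inner_simps)
      ultimately show ?thesis using a'(2) wk by (intro exI[of _ a']) (auto simp: wk add_diff_eq)
    next
      assume *: "Bad (a' + (s / 2) *\<^sub>R k) (a' + w B)"
      have e: "a' + (s / 2) *\<^sub>R k + w (insert k B) = a' + w B" using wk by simp
      moreover have "cbox (a' + (s / 2) *\<^sub>R k) (a' + w B) \<subseteq> cbox a' (a' + w B)"
        using s k by (subst subset_box) (auto simp: inner_simps inner_Basis)
      ultimately have "Bad (a' + (s / 2) *\<^sub>R k) (a' + (s / 2) *\<^sub>R k + w (insert k B)) \<and>
          cbox (a' + (s / 2) *\<^sub>R k) (a' + (s / 2) *\<^sub>R k + w (insert k B)) \<subseteq> cbox a (a + s *\<^sub>R One)"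
        unfolding e using a'(2) * by blast
      then show ?thesis by blast
    qed
  qed
  from this[of Basis] obtain a' where
    "Bad a' (a' + w Basis)" "cbox a' (a' + w Basis) \<subseteq> cbox a (a + s *\<^sub>R One)" by auto
  moreover have "w Basis = (s / 2) *\<^sub>R One" by (simp add: w_def scaleR_sum_right)
  ultimately show thesis using that by auto
qed

text \<open>Subtracting the linear part of \<open>V\<close> at \<open>x0\<close> leaves a remainder
  \<open>r\<close> that is at most a multiple of \<open>\<eta> s\<close> on the cube. A pointwise
  estimate would give this size over \<open>h\<close>, useless as \<open>h\<close> tends to 0; in
  the integral over the cube everything but two slabs cancels, which gains a factor
  \<open>h / s\<close> and makes the bound uniform in \<open>h\<close>.\<close>

lemma integral_divergence_local_bound:
  fixes V :: "'a::euclidean_space \<Rightarrow> 'a"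
  assumes Vc: "continuous_on UNIV V" and V0: "(V has_derivative L) (at x0)"
    and gc: "continuous_on UNIV g" and g0: "g x0 = (\<Sum>i\<in>Basis. L i \<bullet> i)" and \<theta>: "0 < \<theta>"
  shows "\<exists>d>0. \<forall>a s h. x0 \<in> cbox a (a + s *\<^sub>R One) \<longrightarrow> s < d \<longrightarrow> 0 < h \<longrightarrow> h \<le> s \<longrightarrow>
    \<bar>integral (cbox a (a + s *\<^sub>R One)) (\<lambda>x. (\<Sum>i\<in>Basis. (V (x + h *\<^sub>R i) - V x) \<bullet> i) / h - g x)\<bar>
      < \<theta> * s ^ DIM('a)"
proof -
  define n where "n = real DIM('a)"
  have n: "n \<ge> 1" using DIM_positive[where 'a='a] unfolding n_def by linarith
  \<comment> \<open>Makes the \<open>n\<close> coordinate terms add up to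
    \<open>\<theta> / 4\<close>; the oscillation of \<open>g\<close> contributes another
    \<open>\<theta> / 4\<close>, and the slack gives a strict bound.\<close>
  define \<eta> where "\<eta> = \<theta> / (8 * n * (n + 1))"
  have \<eta>: "\<eta> > 0" using n \<theta> by (simp add: \<eta>_def)
  obtain d1 where d1: "d1 > 0"
    "\<And>x. norm (x - x0) < d1 \<Longrightarrow> norm (V x - V x0 - L (x - x0)) \<le> \<eta> * norm (x - x0)"
    using V0 \<eta> unfolding has_derivative_at_alt by blast
  have "isCont g x0" using gc by (simp add: continuous_on_eq_continuous_at)
  then obtain d2 where d2: "d2 > 0" "\<And>x. norm (x - x0) < d2 \<Longrightarrow> \<bar>g x - g x0\<bar> < \<theta> / 4"
    using \<theta> unfolding continuous_at_eps_delta dist_norm real_norm_def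
    by (metis zero_less_divide_iff zero_less_numeral)
  have lin: "linear L" using V0 has_derivative_linear by blast
  define r where "r i x = (V x - V x0 - L (x - x0)) \<bullet> i" for i x
  have "bounded_linear L" using V0 has_derivative_bounded_linear by blast
  then have "continuous_on UNIV (\<lambda>x. L (x - x0))"
    by (rule bounded_linear.continuous_on) (intro continuous_intros)
  then have rc: "continuous_on UNIV (r i)" for i unfolding r_def
    by (intro continuous_on_inner continuous_on_diff Vc continuous_on_const)
  \<comment> \<open>A point of the cube is within \<open>n s\<close> of \<open>x0\<close>, and the
    shift by \<open>h \<le> s\<close> costs one more \<open>s\<close>.\<close>
  define d where "d = min d1 d2 / (n + 1)"
  show ?thesis
  proof (intro exI[of _ d] conjI allI impI)
    show "0 < d" using d1(1) d2(1) n by (simp add: d_def)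
    fix a :: 'a and s h :: real
    assume x0: "x0 \<in> cbox a (a + s *\<^sub>R One)" and sd: "s < d" and h: "0 < h" "h \<le> s"
    let ?Q = "cbox a (a + s *\<^sub>R One)"
    have s: "s > 0" using h by simp
    have sd': "(n + 1) * s < d1" "(n + 1) * s < d2"
      using sd n unfolding d_def by (auto simp: field_simps)
    have near: "norm (x - x0) \<le> n * s" if "x \<in> ?Q" for x
    proof -
      have "norm (x - x0) \<le> (\<Sum>i\<in>Basis. \<bar>(x - x0) \<bullet> i\<bar>)" by (rule norm_le_l1)
      also have "\<dots> \<le> (\<Sum>i\<in>(Basis::'a set). s)"
      proof (rule sum_mono)
        fix i :: 'a assume i: "i \<in> Basis"
        have "a \<bullet> i \<le> y \<bullet> i \<and> y \<bullet> i \<le> a \<bullet> i + s" if "y \<in> ?Q" for y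
          using that i by (auto simp: mem_box inner_add_left)
        from this[OF that] this[OF x0] show "\<bar>(x - x0) \<bullet> i\<bar> \<le> s"
          by (simp add: inner_diff_left abs_le_iff)
      qed
      finally show ?thesis by (simp add: n_def)
    qed
    define M where "M = \<eta> * ((n + 1) * s)"
    have M: "0 \<le> M" using \<eta> n s by (simp add: M_def)
    have rb: "\<bar>r i x\<bar> \<le> M" if "norm (x - x0) \<le> (n + 1) * s" "i \<in> Basis" for i x
    proof -
      have "\<bar>r i x\<bar> \<le> norm (V x - V x0 - L (x - x0))" unfolding r_def
        using that(2) by (rule Basis_le_norm)
      also have "\<dots> \<le> \<eta> * norm (x - x0)" using d1(2)[of x] that sd' by simp
      also have "\<dots> \<le> M" unfolding M_def using that(1) \<eta> by (intro mult_left_mono) auto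
      finally show ?thesis .
    qed
    have 1: "\<bar>integral ?Q (\<lambda>x. r i (x + h *\<^sub>R i) - r i x)\<bar> \<le> 2 * M * h * s ^ (DIM('a) - 1)"
      if i: "i \<in> Basis" for i
    proof (rule integral_translate_diff_bound[OF rc i h M])
      fix x assume x: "x \<in> ?Q"
      have "norm (x + h *\<^sub>R i - x0) \<le> norm (x - x0) + norm (h *\<^sub>R i)"
        using norm_triangle_ineq[of "x - x0" "h *\<^sub>R i"] by (simp add: algebra_simps)
      also have "\<dots> \<le> n * s + s" using near[OF x] i h by (auto intro: add_mono)
      finally show "\<bar>r i x\<bar> \<le> M \<and> \<bar>r i (x + h *\<^sub>R i)\<bar> \<le> M"
        using near[OF x] s i by (auto intro!: rb simp: algebra_simps)
    qed
    have gi: "(\<lambda>x. g x0 - g x) integrable_on ?Q"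
      by (intro integrable_continuous continuous_intros continuous_on_subset[OF gc]) auto
    have rint: "(\<lambda>x. r i (x + h *\<^sub>R i) - r i x) integrable_on ?Q" for i
      by (intro integrable_continuous continuous_intros continuous_on_compose2[OF rc]) auto
    have eq: "(\<Sum>i\<in>Basis. (V (x + h *\<^sub>R i) - V x) \<bullet> i) / h - g x
      = (\<Sum>i\<in>Basis. (r i (x + h *\<^sub>R i) - r i x) / h) + (g x0 - g x)" for x
    proof -
      have "(r i (x + h *\<^sub>R i) - r i x) / h = (V (x + h *\<^sub>R i) - V x) \<bullet> i / h - L i \<bullet> i" for i
      proof -
        have "x + h *\<^sub>R i - x0 = (x - x0) + h *\<^sub>R i" by simp
        then have "L (x + h *\<^sub>R i - x0) = L (x - x0) + h *\<^sub>R L i"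
          using lin by (simp only: linear_add linear_scale)
        then show ?thesis using h by (simp add: r_def inner_simps field_simps)
      qed
      then show ?thesis by (simp add: g0 sum_subtractf sum_divide_distrib)
    qed
    have c: "measure lborel ?Q = s ^ DIM('a)"
      by (subst content_cbox) (use s in \<open>auto simp: inner_simps\<close>)
    have J: "integral ?Q (\<lambda>x. (\<Sum>i\<in>Basis. (V (x + h *\<^sub>R i) - V x) \<bullet> i) / h - g x)
      = (\<Sum>i\<in>Basis. integral ?Q (\<lambda>x. r i (x + h *\<^sub>R i) - r i x) / h) + integral ?Q (\<lambda>x. g x0 - g x)"
      unfolding eq
      by (subst integral_add) (auto intro!: integrable_sum integrable_on_divide rint gi
          simp: integral_sum[OF finite_Basis integrable_on_divide[OF rint]])
    have "\<bar>integral ?Q (\<lambda>x. (\<Sum>i\<in>Basis. (V (x + h *\<^sub>R i) - V x) \<bullet> i) / h - g x)\<bar> \<le> (\<Sum>i\<in>Basis. \<bar>integral ?Q (\<lambda>x. r i (x + h *\<^sub>R i) - r i x) / h\<bar>)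
        + \<bar>integral ?Q (\<lambda>x. g x0 - g x)\<bar>"
      unfolding J by (rule order_trans[OF abs_triangle_ineq add_right_mono[OF sum_abs]])
    also have "\<dots> \<le> (\<Sum>i\<in>(Basis::'a set). 2 * M * s ^ (DIM('a) - 1)) + (\<theta> / 4) * s ^ DIM('a)"
    proof (rule add_mono, rule sum_mono)
      fix i :: 'a assume i: "i \<in> Basis"
      have "\<bar>integral ?Q (\<lambda>x. r i (x + h *\<^sub>R i) - r i x) / h\<bar>
          = \<bar>integral ?Q (\<lambda>x. r i (x + h *\<^sub>R i) - r i x)\<bar> / h"
        using h(1) by (subst abs_divide) (simp only: abs_of_pos)
      also have "\<dots> \<le> (2 * M * h * s ^ (DIM('a) - 1)) / h"
        by (rule divide_right_mono[OF 1[OF i] less_imp_le[OF h(1)]])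
      also have "\<dots> = 2 * M * s ^ (DIM('a) - 1)" using h(1) by simp
      finally show "\<bar>integral ?Q (\<lambda>x. r i (x + h *\<^sub>R i) - r i x) / h\<bar> \<le> 2 * M * s ^ (DIM('a) - 1)" .
    next
      have "norm (integral ?Q (\<lambda>x. g x0 - g x)) \<le> \<theta> / 4 * measure lborel ?Q"
      proof (rule has_integral_bound[OF _ integrable_integral[OF gi]])
        fix x assume "x \<in> ?Q"
        then have "norm (x - x0) < d2" using near[of x] sd' s by (auto simp: algebra_simps)
        then show "norm (g x0 - g x) \<le> \<theta> / 4" using d2(2)[of x] by (simp add: abs_minus_commute)
      qed (use \<theta> in auto)
      then show "\<bar>integral ?Q (\<lambda>x. g x0 - g x)\<bar> \<le> (\<theta> / 4) * s ^ DIM('a)" using c by simp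
    qed
    also have "\<dots> = (2 * n * \<eta> * (n + 1) + \<theta> / 4) * s ^ DIM('a)"
    proof -
      have "s * s ^ (DIM('a) - 1) = s ^ DIM('a)"
        using DIM_positive[where 'a='a] by (metis power_eq_if less_numeral_extra(3))
      from this[symmetric] show ?thesis unfolding M_def n_def
        by (simp only: sum_constant) (simp add: algebra_simps)
    qed
    also have "2 * n * \<eta> * (n + 1) = \<theta> / 4" 
    proof -
      have "\<eta> * (8 * n * (n + 1)) = \<theta>" using n by (simp add: \<eta>_def)
      then show ?thesis by (simp add: algebra_simps)
    qed
    also have "(\<theta> / 4 + \<theta> / 4) * s ^ DIM('a) < \<theta> * s ^ DIM('a)" using \<theta> s by simp
    finally show "\<bar>integral ?Q (\<lambda>x. (\<Sum>i\<in>Basis. (V (x + h *\<^sub>R i) - V x) \<bullet> i) / h - g x)\<bar>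
      < \<theta> * s ^ DIM('a)" .
  qed
qed

text \<open>
  The derivative need not be integrable, so this is proved as Goursat's lemma: a cube with too large
  a flux is bisected repeatedly. The flux through the faces is replaced by the integral of difference
  quotients of step \<open>h\<close>, which is additive over cubes without any reference to faces, and a cube is
  bad if its flux is too large for arbitrarily small \<open>h\<close>.
\<close>

theorem integral_divergence_eq_0:
  fixes V :: "'a::euclidean_space \<Rightarrow> 'a"
  assumes der: "\<And>x. (V has_derivative V' x) (at x)"
    and g_def: "\<And>x. g x = (\<Sum>i\<in>Basis. V' x i \<bullet> i)"
    and gc: "continuous_on UNIV g"
    and supp: "bounded {x. V x \<noteq> 0}"
  shows "(g has_integral 0) UNIV"
proof -
  obtain M where M: "M > 0" "\<And>x. V x \<noteq> 0 \<Longrightarrow> norm x \<le> M"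
    using supp unfolding bounded_pos by auto
  have Vc: "continuous_on UNIV V"
    by (rule continuous_at_imp_continuous_on) (simp add: has_derivative_continuous[OF der])
  \<comment> \<open>The margin 1 around the support of \<open>V\<close> lets the cube contain it
    even after a shift of length at most 1.\<close>
  define a where "a = - (M + 1) *\<^sub>R (One :: 'a)"
  define s where "s = 2 * (M + 1)"
  let ?Q = "cbox a (a + s *\<^sub>R One)"
  have inQ: "x \<in> cbox u (u + s *\<^sub>R One)" if xM: "norm x \<le> M" and uM: "norm (u - a) \<le> 1" for x u
  proof -
    have "u \<bullet> i \<le> x \<bullet> i \<and> x \<bullet> i \<le> (u + s *\<^sub>R One) \<bullet> i" if i: "i \<in> Basis" for i
    proof -
      have "\<bar>x \<bullet> i\<bar> \<le> M" "\<bar>(u - a) \<bullet> i\<bar> \<le> 1"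
        using Basis_le_norm[OF i, of x] Basis_le_norm[OF i, of "u - a"] xM uM by linarith+
      moreover have "a \<bullet> i = - (M + 1)" "(u + s *\<^sub>R One) \<bullet> i = u \<bullet> i + s"
        using i by (simp_all add: a_def inner_add_left)
      ultimately show ?thesis unfolding inner_diff_left by (simp add: s_def; linarith)
    qed
    then show ?thesis by (simp add: mem_box)
  qed
  have gz: "g x = 0" if "norm x > M" for x
  proof -
    have "((\<lambda>x. 0) has_derivative V' x) (at x)"
    proof (rule has_derivative_transform_within_open[OF der])
      have "open (- cball (0::'a) M)" by (rule open_Compl[OF closed_cball])
      moreover have "- cball (0::'a) M = {x. norm x > M}" by (simp add: set_eq_iff not_le)
      ultimately show "open {x::'a. norm x > M}" by simp
    next
      show "x \<in> {x. norm x > M}" using that by simp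
      show "V y = 0" if "y \<in> {x. norm x > M}" for y using that M(2)[of y] by fastforce
    qed
    then have "V' x = (\<lambda>x. 0)" using has_derivative_const has_derivative_unique by blast
    then show ?thesis by (simp add: g_def)
  qed
  have int: "f integrable_on cbox u v" if "continuous_on UNIV f" for f :: "'a \<Rightarrow> real" and u v
    using that continuous_on_subset integrable_continuous by blast
  define D where "D h x = (\<Sum>i\<in>Basis. (V (x + h *\<^sub>R i) - V x) \<bullet> i) / h - g x" for h x
  have Dc: "continuous_on UNIV (D h)" if "h > 0" for h unfolding D_def
    using that by (intro continuous_intros gc continuous_on_compose2[OF Vc]) auto
  \<comment> \<open>Both the cube and its shift contain the support, so each coordinate of the
    difference quotient integrates to exactly 0. The integral of \<open>D h\<close> is then the same
    number for all small \<open>h\<close>.\<close>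
  have JQ: "integral ?Q (D h) = - integral ?Q g" if h: "0 < h" "h < 1" for h
  proof -
    have A: "integral ?Q (\<lambda>x. V (x + h *\<^sub>R i) \<bullet> i) = integral ?Q (\<lambda>x. V x \<bullet> i)" if i: "i \<in> Basis" for i
    proof -
      have c: "continuous_on UNIV (\<lambda>x. V x \<bullet> i)" by (intro continuous_intros Vc)
      have e: "integral (cbox u (u + s *\<^sub>R One)) (\<lambda>x. V x \<bullet> i) = integral UNIV (\<lambda>x. V x \<bullet> i)"
        if "norm (u - a) \<le> 1" for u
        by (rule integral_unique[symmetric], rule has_integral_on_superset[OF integrable_integral[OF int[OF c]]])
          (use M(2) inQ[OF _ that] in \<open>auto, metis inner_zero_left\<close>)
      show ?thesis
        using integral_shift_cbox[of "a + h *\<^sub>R i" "h *\<^sub>R i" "a + s *\<^sub>R One + h *\<^sub>R i" "\<lambda>x. V x \<bullet> i"]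
          e[of a] e[of "a + h *\<^sub>R i"] h i by (simp add: algebra_simps)
    qed
    have B: "(\<lambda>x. V (x + h *\<^sub>R i) \<bullet> i) integrable_on ?Q" "(\<lambda>x. V x \<bullet> i) integrable_on ?Q" for i
      by (intro int continuous_intros continuous_on_compose2[OF Vc] Vc; simp)+
    have "((\<lambda>x. V (x + h *\<^sub>R i) \<bullet> i - V x \<bullet> i) has_integral 0) ?Q" if "i \<in> Basis" for i
      using has_integral_diff[OF integrable_integral[OF B(1)[of i]] integrable_integral[OF B(2)[of i]]]
        A[OF that] by simp
    then have "((\<lambda>x. \<Sum>i\<in>Basis. V (x + h *\<^sub>R i) \<bullet> i - V x \<bullet> i) has_integral (\<Sum>i\<in>(Basis::'a set). 0)) ?Q"
      by (intro has_integral_sum finite_Basis)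
    then have "((\<lambda>x. (\<Sum>i\<in>Basis. V (x + h *\<^sub>R i) \<bullet> i - V x \<bullet> i) / h) has_integral (0 / h)) ?Q"
      by (intro has_integral_divide) simp
    then have "(D h has_integral (0 / h - integral ?Q g)) ?Q"
      unfolding D_def inner_diff_left by (intro has_integral_diff integrable_integral int gc)
    then show ?thesis by (simp add: integral_unique)
  qed
  have "integral ?Q g = 0"
  proof (rule ccontr)
    assume I: "integral ?Q g \<noteq> 0"
    have s: "s > 0" using M by (simp add: s_def)
    define \<theta> where "\<theta> = \<bar>integral ?Q g\<bar> / s ^ DIM('a)"
    have \<theta>: "\<theta> > 0" using I s by (simp add: \<theta>_def)
    have content: "measure lborel (cbox u (u + t *\<^sub>R One)) = t ^ DIM('a)" if "t \<ge> 0" for u :: 'a and t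
      by (subst content_cbox) (use that in \<open>auto simp: inner_simps\<close>)
    define Bad where "Bad u v \<longleftrightarrow>
      (\<exists>\<^sub>F h in at_right 0. \<theta> * measure lborel (cbox u v) \<le> \<bar>integral (cbox u v) (D h)\<bar>)" for u v
    \<comment> \<open>Which half inherits the excess may change with \<open>h\<close>;
      \<open>frequently\<close> distributes over disjunction, so one of the two halves is bad for
      arbitrarily small \<open>h\<close>.\<close>
    have step: "Bad u (v - ((v \<bullet> k - u \<bullet> k) / 2) *\<^sub>R k) \<or> Bad (u + ((v \<bullet> k - u \<bullet> k) / 2) *\<^sub>R k) v"
      if k: "k \<in> Basis" and uv: "\<And>i. i \<in> Basis \<Longrightarrow> u \<bullet> i \<le> v \<bullet> i" and bad: "Bad u v" for u v k
    proof -
      define w where "w = (v \<bullet> k - u \<bullet> k) / 2"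
      have w: "u \<bullet> k + w = v \<bullet> k - w" "w \<ge> 0" using uv[OF k] by (auto simp: w_def field_simps)
      have ik: "i \<in> Basis \<Longrightarrow> k \<bullet> i = (if i = k then 1 else 0)" for i using k by (auto simp: inner_Basis)
      have s1: "cbox u v \<inter> {x. x \<bullet> k \<le> u \<bullet> k + w} = cbox u (v - w *\<^sub>R k)"
        using w k by (auto simp: mem_box ik inner_simps split: if_splits) fastforce+
      have s2: "cbox u v \<inter> {x. u \<bullet> k + w \<le> x \<bullet> k} = cbox (u + w *\<^sub>R k) v"
        using w k by (auto simp: mem_box ik inner_simps split: if_splits) fastforce+
      have pos: "\<forall>\<^sub>F h in at_right (0::real). h > 0" by (simp add: eventually_at_right_less)
      have "\<exists>\<^sub>F h in at_right 0.
          \<theta> * measure lborel (cbox u (v - w *\<^sub>R k)) \<le> \<bar>integral (cbox u (v - w *\<^sub>R k)) (D h)\<bar> \<or>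
          \<theta> * measure lborel (cbox (u + w *\<^sub>R k) v) \<le> \<bar>integral (cbox (u + w *\<^sub>R k) v) (D h)\<bar>"
      proof (rule frequently_rev_mp[OF frequently_eventually_frequently[OF bad[unfolded Bad_def] pos]],
          rule always_eventually, intro allI impI)
        fix h assume h: "\<theta> * measure lborel (cbox u v) \<le> \<bar>integral (cbox u v) (D h)\<bar> \<and> 0 < h"
        have "integral (cbox u v) (D h) =
            integral (cbox u (v - w *\<^sub>R k)) (D h) + integral (cbox (u + w *\<^sub>R k) v) (D h)"
          using integral_split[OF int[OF Dc] k, of h u v "u \<bullet> k + w"] h by (simp add: s1 s2)
        moreover have "measure lborel (cbox u v) =
            measure lborel (cbox u (v - w *\<^sub>R k)) + measure lborel (cbox (u + w *\<^sub>R k) v)"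
          using content_split[OF k, of u v "u \<bullet> k + w"] by (simp add: s1 s2)
        then have "\<theta> * measure lborel (cbox u v) = \<theta> * measure lborel (cbox u (v - w *\<^sub>R k))
            + \<theta> * measure lborel (cbox (u + w *\<^sub>R k) v)" by (simp add: distrib_left)
        ultimately show "\<theta> * measure lborel (cbox u (v - w *\<^sub>R k)) \<le> \<bar>integral (cbox u (v - w *\<^sub>R k)) (D h)\<bar> \<or>
          \<theta> * measure lborel (cbox (u + w *\<^sub>R k) v) \<le> \<bar>integral (cbox (u + w *\<^sub>R k) v) (D h)\<bar>"
          using h by linarith
      qed
      then show ?thesis unfolding Bad_def w_def frequently_disj_iff .
    qed
    have bad: "Bad a (a + s *\<^sub>R One)" unfolding Bad_def
    proof (rule eventually_frequently)
      have "\<forall>\<^sub>F h in at_right (0::real). 0 < h \<and> h < 1"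
        by (rule eventually_at_rightI[of 0 1]) auto
      then show "\<forall>\<^sub>F h in at_right 0. \<theta> * measure lborel ?Q \<le> \<bar>integral ?Q (D h)\<bar>"
        by eventually_elim (use s in \<open>simp add: JQ content \<theta>_def\<close>)
    qed simp
    have "\<exists>u. \<forall>n. Bad (u n) (u n + (s / 2 ^ n) *\<^sub>R One) \<and>
       cbox (u (Suc n)) (u (Suc n) + (s / 2 ^ Suc n) *\<^sub>R One) \<subseteq> cbox (u n) (u n + (s / 2 ^ n) *\<^sub>R One)"
    proof (rule dependent_nat_choice[where P="\<lambda>n u. Bad u (u + (s / 2 ^ n) *\<^sub>R One)" and
        Q="\<lambda>n u u'. cbox u' (u' + (s / 2 ^ Suc n) *\<^sub>R One) \<subseteq> cbox u (u + (s / 2 ^ n) *\<^sub>R One)"])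
      from bad show "\<exists>u. Bad u (u + (s / 2 ^ 0) *\<^sub>R One)" by auto
    next
      fix u n assume "Bad u (u + (s / 2 ^ n) *\<^sub>R One)"
      obtain u' where
        "Bad u' (u' + ((s / 2 ^ n) / 2) *\<^sub>R One)"
        "cbox u' (u' + ((s / 2 ^ n) / 2) *\<^sub>R One) \<subseteq> cbox u (u + (s / 2 ^ n) *\<^sub>R One)"
      proof (rule bisect_cube[of Bad, OF step \<open>Bad u (u + (s / 2 ^ n) *\<^sub>R One)\<close>])
        show "0 \<le> s / 2 ^ n" using s by simp
      qed
      moreover have "s / 2 ^ n / 2 = s / 2 ^ Suc n" by simp
      ultimately show "\<exists>y. Bad y (y + (s / 2 ^ Suc n) *\<^sub>R One) \<and>
             cbox y (y + (s / 2 ^ Suc n) *\<^sub>R One) \<subseteq> cbox u (u + (s / 2 ^ n) *\<^sub>R One)"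
        by metis
    qed
    then obtain u where u: "\<And>n. Bad (u n) (u n + (s / 2 ^ n) *\<^sub>R One)"
       "\<And>n. cbox (u (Suc n)) (u (Suc n) + (s / 2 ^ Suc n) *\<^sub>R One) \<subseteq> cbox (u n) (u n + (s / 2 ^ n) *\<^sub>R One)"
      by blast
    define F where "F n = cbox (u n) (u n + (s / 2 ^ n) *\<^sub>R One)" for n
    have "\<Inter> (range F) \<noteq> {}"
    proof (rule compact_nest)
      show "F n \<subseteq> F m" if "m \<le> n" for m n
        using that u(2) unfolding F_def[symmetric] by (rule lift_Suc_antimono_le[rotated])
      show "compact (F n)" "F n \<noteq> {}" for n
        using s by (auto simp: F_def box_ne_empty inner_simps)
    qed
    then obtain x0 where x0: "\<And>n. x0 \<in> F n" by auto
    obtain d where d: "d > 0" "\<And>a s h. x0 \<in> cbox a (a + s *\<^sub>R One) \<Longrightarrow> s < d \<Longrightarrow> 0 < h \<Longrightarrow> h \<le> s \<Longrightarrow>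
        \<bar>integral (cbox a (a + s *\<^sub>R One)) (D h)\<bar> < \<theta> * s ^ DIM('a)"
      using integral_divergence_local_bound[OF Vc der gc g_def \<theta>] unfolding D_def by blast
    obtain n where "(1/2) ^ n < d / s" using real_arch_pow_inv[of "d / s" "1/2"] d(1) s by auto
    then have n: "s / 2 ^ n < d" using s by (simp add: power_divide field_simps)
    have "\<forall>\<^sub>F h in at_right (0::real). 0 < h \<and> h < s / 2 ^ n"
      by (rule eventually_at_rightI[of 0 "s / 2 ^ n"]) (use s in auto)
    \<comment> \<open>Badness supplies a step \<open>h\<close> below the side of the cube chosen
      last, which is the range in which the local bound applies.\<close>
    from frequently_eventually_frequently[OF u(1)[of n, unfolded Bad_def] this]
    obtain h where "0 < h" "h < s / 2 ^ n"
      "\<theta> * measure lborel (F n) \<le> \<bar>integral (F n) (D h)\<bar>"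
      by (auto dest!: frequently_ex simp: F_def)
    then show False using d(2)[OF x0[of n, unfolded F_def] n, of h] s
      by (simp add: F_def content power_divide)
  qed
  then have "(g has_integral 0) ?Q" using integrable_integral[OF int[OF gc], of a] by metis
  then show ?thesis
  proof (rule has_integral_on_superset)
    show "g x = 0" if "x \<notin> ?Q" for x
      using that gz[of x] inQ[of x a] by fastforce
  qed simp
qed

section \<open>Length metrics of lower semicontinuous densities\<close>

lemma nn_integral_mono_off_finite:
  fixes f g :: "real \<Rightarrow> ennreal"
  assumes "finite S" "\<And>t. t \<notin> S \<Longrightarrow> f t \<le> g t"
  shows "(\<integral>\<^sup>+t. f t \<partial>lborel) \<le> (\<integral>\<^sup>+t. g t \<partial>lborel)"
proof (rule nn_integral_mono_AE)
  have "S \<in> null_sets lborel" using assms(1) by (rule finite_imp_null_set_lborel)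
  then show "AE t in lborel. f t \<le> g t" by (rule AE_I') (use assms(2) in auto)
qed

text \<open>At exceptional times \<open>vector_derivative\<close> has no geometric meaning; they
  form a null set, so a derivative found at all other times bounds the length. Monotonicity of the
  nonnegative integral asks for no measurability of the speed.\<close>

lemma metric_length_le:
  assumes "finite S"
    and "\<And>t. t \<in> {0..1} - S \<Longrightarrow> \<exists>v. (C has_vector_derivative v) (at t) \<and> ennreal (lam (C t) * norm v) \<le> F t"
  shows "metric_length lam C \<le> (\<integral>\<^sup>+t. F t \<partial>lborel)"
  unfolding metric_length_def
proof (rule nn_integral_mono_off_finite[OF assms(1)])
  fix t assume "t \<notin> S"
  then show "ennreal (lam (C t) * norm (vector_derivative C (at t))) * indicator {0..1} t \<le> F t"
    using assms(2)[of t] by (cases "t \<in> {0..1}") (auto dest!: vector_derivative_at)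
qed

text \<open>Lower semicontinuity, in the form of open superlevel sets, is what a supremum of
  continuous functions offers. It makes the density Borel, and with it the speed of a path.\<close>

locale lsc_density =
  fixes G :: "'a::euclidean_space set" and lam :: "'a \<Rightarrow> real"
  assumes open_G: "open G" and lsc: "\<And>a. open {z \<in> G. a < lam z}"
begin

lemma density_measurable: "lam \<in> borel_measurable (restrict_space borel G)"
proof (rule borel_measurableI_greater)
  fix a
  have "{z \<in> space (restrict_space borel G). a < lam z} = G \<inter> {z \<in> G. a < lam z}"
    by (auto simp: space_restrict_space)
  also have "\<dots> \<in> sets (restrict_space borel G)"
    unfolding sets_restrict_space by (intro imageI borel_open lsc)
  finally show "{z \<in> space (restrict_space borel G). a < lam z} \<in> sets (restrict_space borel G)" .
qed

text \<open>Replaces the integrand of \<open>metric_length\<close> by a Borel function that vanishes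
  off \<open>[0,1]\<close> and at the break points. Substitution and additivity of the integral
  require this measurability.\<close>

lemma path_speed:
  assumes C: "valid_path C" "path_image C \<subseteq> G"
  obtains S D where "finite S" "continuous_on {0..1} C" "continuous_on ({0..1} - S) D"
    "\<And>t. t \<in> {0..1} - S \<Longrightarrow> (C has_vector_derivative D t) (at t)"
    "(\<lambda>t. ennreal (lam (C t) * norm (D t)) * indicator ({0..1} - S) t) \<in> borel_measurable borel"
    "metric_length lam C = (\<integral>\<^sup>+t. ennreal (lam (C t) * norm (D t)) * indicator ({0..1} - S) t \<partial>lborel)"
proof -
  obtain S D where S: "finite S" and cC: "continuous_on {0..1} C" and
    D: "\<And>t. t \<in> {0..1} - S \<Longrightarrow> (C has_vector_derivative D t) (at t)"
      "continuous_on ({0..1} - S) D"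
    using C(1) unfolding valid_path_def piecewise_C1_differentiable_on_def C1_differentiable_on_def
    by blast
  let ?A = "{0..1} - S"
  have A: "?A \<in> sets borel" using S by (intro sets.Diff) (auto intro: borel_closed finite_imp_closed)
  have "C \<in> restrict_space borel ?A \<rightarrow>\<^sub>M restrict_space borel G"
  proof (rule measurable_restrict_space2)
    show "C \<in> space (restrict_space borel ?A) \<rightarrow> G"
      using C(2) by (auto simp: space_restrict_space path_image_def)
    show "C \<in> borel_measurable (restrict_space borel ?A)"
      by (intro borel_measurable_continuous_on_restrict continuous_on_subset[OF cC]) auto
  qed
  then have "(\<lambda>t. lam (C t)) \<in> borel_measurable (restrict_space borel ?A)"
    using measurable_compose density_measurable by blast
  moreover have "D \<in> borel_measurable (restrict_space borel ?A)"
    by (rule borel_measurable_continuous_on_restrict[OF D(2)])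
  ultimately have "(\<lambda>t. ennreal (lam (C t) * norm (D t))) \<in> borel_measurable (restrict_space borel ?A)"
    by simp
  then have m: "(\<lambda>t. ennreal (lam (C t) * norm (D t)) * indicator ?A t) \<in> borel_measurable borel"
    using A by (subst (asm) borel_measurable_restrict_space_iff_ennreal) auto
  have "metric_length lam C = (\<integral>\<^sup>+t. ennreal (lam (C t) * norm (D t)) * indicator ?A t \<partial>lborel)"
    unfolding metric_length_def
    by (rule antisym; rule nn_integral_mono_off_finite[OF S])
      (use vector_derivative_at[OF D(1)] in \<open>auto simp: indicator_def\<close>)
  from that[OF S cC D(2,1) m this] show thesis .
qed

lemma metric_length_reversepath_le:
  assumes C: "valid_path C" "path_image C \<subseteq> G"
  shows "metric_length lam (reversepath C) \<le> metric_length lam C"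
proof -
  obtain S D where S: "finite S" and c: "continuous_on {0..1} C" "continuous_on ({0..1} - S) D"
    and D: "\<And>t. t \<in> {0..1} - S \<Longrightarrow> (C has_vector_derivative D t) (at t)"
    and m: "(\<lambda>t. ennreal (lam (C t) * norm (D t)) * indicator ({0..1} - S) t) \<in> borel_measurable borel"
    and len: "metric_length lam C = (\<integral>\<^sup>+t. ennreal (lam (C t) * norm (D t)) * indicator ({0..1} - S) t \<partial>lborel)"
    by (rule path_speed[OF C], rule that)
  let ?F = "\<lambda>t. ennreal (lam (C t) * norm (D t)) * indicator ({0..1} - S) t"
  have "metric_length lam (reversepath C) \<le> (\<integral>\<^sup>+t. ?F (1 + (-1) * t) \<partial>lborel)"
  proof (rule metric_length_le[of "(\<lambda>t. 1 - t) ` S"])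
    fix t :: real assume t: "t \<in> {0..1} - (\<lambda>t. 1 - t) ` S"
    have "1 - t \<notin> S"
    proof
      assume "1 - t \<in> S"
      then have "1 - (1 - t) \<in> (\<lambda>t. 1 - t) ` S" by (rule imageI)
      then show False using t by simp
    qed
    then have t': "1 - t \<in> {0..1} - S" using t by auto
    have "((\<lambda>t. 1 - t) has_vector_derivative -1) (at t)"
      by (auto intro!: derivative_eq_intros simp: has_vector_derivative_def)
    then have "(C \<circ> (\<lambda>t. 1 - t) has_vector_derivative (-1) *\<^sub>R D (1 - t)) (at t)"
      by (rule vector_diff_chain_at) (rule D[OF t'])
    then show "\<exists>v. (reversepath C has_vector_derivative v) (at t) \<and>
        ennreal (lam (reversepath C t) * norm v) \<le> ?F (1 + (-1) * t)"
      using t' by (intro exI[of _ "(-1) *\<^sub>R D (1 - t)"]) (simp add: reversepath_def o_def)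
  qed (use S in simp)
  also have "\<dots> = (\<integral>\<^sup>+t. ?F t \<partial>lborel)"
    using nn_integral_real_affine[OF m, of "-1" 1] by simp
  finally show ?thesis by (simp add: len)
qed

lemma metric_length_joinpaths_le:
  assumes C1: "valid_path C1" "path_image C1 \<subseteq> G" and C2: "valid_path C2" "path_image C2 \<subseteq> G"
  shows "metric_length lam (C1 +++ C2) \<le> metric_length lam C1 + metric_length lam C2"
proof -
  obtain S1 D1 where S1: "finite S1" and c1: "continuous_on {0..1} C1" "continuous_on ({0..1} - S1) D1"
    and D1: "\<And>t. t \<in> {0..1} - S1 \<Longrightarrow> (C1 has_vector_derivative D1 t) (at t)"
    and m1: "(\<lambda>t. ennreal (lam (C1 t) * norm (D1 t)) * indicator ({0..1} - S1) t) \<in> borel_measurable borel"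
    and len1: "metric_length lam C1 = (\<integral>\<^sup>+t. ennreal (lam (C1 t) * norm (D1 t)) * indicator ({0..1} - S1) t \<partial>lborel)"
    by (rule path_speed[OF C1], rule that)
  obtain S2 D2 where S2: "finite S2" and c2: "continuous_on {0..1} C2" "continuous_on ({0..1} - S2) D2"
    and D2: "\<And>t. t \<in> {0..1} - S2 \<Longrightarrow> (C2 has_vector_derivative D2 t) (at t)"
    and m2: "(\<lambda>t. ennreal (lam (C2 t) * norm (D2 t)) * indicator ({0..1} - S2) t) \<in> borel_measurable borel"
    and len2: "metric_length lam C2 = (\<integral>\<^sup>+t. ennreal (lam (C2 t) * norm (D2 t)) * indicator ({0..1} - S2) t \<partial>lborel)"
    by (rule path_speed[OF C2], rule that)
  let ?F1 = "\<lambda>t. ennreal (lam (C1 t) * norm (D1 t)) * indicator ({0..1} - S1) t"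
  let ?F2 = "\<lambda>t. ennreal (lam (C2 t) * norm (D2 t)) * indicator ({0..1} - S2) t"
  \<comment> \<open>The break points of both halves in the time of the joined path, together with
    the joint at 1/2.\<close>
  define S where "S = insert (1/2) ((\<lambda>s. s / 2) ` S1 \<union> (\<lambda>s. (s + 1) / 2) ` S2)"
  \<comment> \<open>Each half runs at double speed; \<open>?F1\<close> and \<open>?F2\<close> vanish
    off \<open>[0,1]\<close>, so at most one of them is active on each side of 1/2.\<close>
  have "metric_length lam (C1 +++ C2) \<le> (\<integral>\<^sup>+t. 2 * ?F1 (0 + 2 * t) + 2 * ?F2 (-1 + 2 * t) \<partial>lborel)"
  proof (rule metric_length_le[of S])
    show "finite S" using S1 S2 by (simp add: S_def)
    fix t :: real assume t: "t \<in> {0..1} - S"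
    consider "t < 1/2" | "t > 1/2" using t by (fastforce simp: S_def)
    then show "\<exists>v. ((C1 +++ C2) has_vector_derivative v) (at t) \<and>
        ennreal (lam ((C1 +++ C2) t) * norm v) \<le> 2 * ?F1 (0 + 2 * t) + 2 * ?F2 (-1 + 2 * t)"
    proof cases
      case 1
      have "2 * t \<notin> S1"
      proof
        assume "2 * t \<in> S1"
        then have "2 * t / 2 \<in> (\<lambda>s. s / 2) ` S1" by (rule imageI)
        then show False using t by (simp add: S_def)
      qed
      then have t': "2 * t \<in> {0..1} - S1" using t 1 by auto
      have "((\<lambda>t. 2 * t) has_vector_derivative 2) (at t)"
        by (auto intro!: derivative_eq_intros simp: has_vector_derivative_def)
      then have "(C1 \<circ> (\<lambda>t. 2 * t) has_vector_derivative 2 *\<^sub>R D1 (2 * t)) (at t)"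
        by (rule vector_diff_chain_at) (rule D1[OF t'])
      then have "((C1 +++ C2) has_vector_derivative 2 *\<^sub>R D1 (2 * t)) (at t)"
        by (rule has_vector_derivative_transform_within_open[where S="{..<1/2}"])
          (use 1 in \<open>auto simp: joinpaths_def\<close>)
      moreover have "ennreal (lam ((C1 +++ C2) t) * norm (2 *\<^sub>R D1 (2 * t))) = 2 * ?F1 (0 + 2 * t)"
        using t' 1 by (simp add: joinpaths_def mult.left_commute ennreal_mult'[of 2 "lam (C1 (2 * t)) * norm (D1 (2 * t))"])
      ultimately show ?thesis by (intro exI[of _ "2 *\<^sub>R D1 (2 * t)"]) simp
    next
      case 2
      have "2 * t - 1 \<notin> S2"
      proof
        assume "2 * t - 1 \<in> S2"
        then have "(2 * t - 1 + 1) / 2 \<in> (\<lambda>s. (s + 1) / 2) ` S2" by (rule imageI)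
        then show False using t by (simp add: S_def)
      qed
      then have t': "2 * t - 1 \<in> {0..1} - S2" using t 2 by auto
      have "((\<lambda>t. 2 * t - 1) has_vector_derivative 2) (at t)"
        by (auto intro!: derivative_eq_intros simp: has_vector_derivative_def)
      then have "(C2 \<circ> (\<lambda>t. 2 * t - 1) has_vector_derivative 2 *\<^sub>R D2 (2 * t - 1)) (at t)"
        by (rule vector_diff_chain_at) (rule D2[OF t'])
      then have "((C1 +++ C2) has_vector_derivative 2 *\<^sub>R D2 (2 * t - 1)) (at t)"
        by (rule has_vector_derivative_transform_within_open[where S="{1/2<..}"])
          (use 2 in \<open>auto simp: joinpaths_def\<close>)
      moreover have "ennreal (lam ((C1 +++ C2) t) * norm (2 *\<^sub>R D2 (2 * t - 1))) = 2 * ?F2 (-1 + 2 * t)"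
        using t' 2 by (simp add: joinpaths_def mult.left_commute ennreal_mult'[of 2 "lam (C2 (2 * t - 1)) * norm (D2 (2 * t - 1))"])
      ultimately show ?thesis by (intro exI[of _ "2 *\<^sub>R D2 (2 * t - 1)"]) simp
    qed
  qed
  also have "\<dots> = 2 * (\<integral>\<^sup>+t. ?F1 (0 + 2 * t) \<partial>lborel) + 2 * (\<integral>\<^sup>+t. ?F2 (-1 + 2 * t) \<partial>lborel)"
  proof -
    have "(\<lambda>t. ?F1 (0 + 2 * t)) \<in> borel_measurable borel" "(\<lambda>t. ?F2 (-1 + 2 * t)) \<in> borel_measurable borel"
      by (rule measurable_compose[OF _ m1] measurable_compose[OF _ m2]; simp)+
    then show ?thesis by (subst nn_integral_add; (subst nn_integral_cmult)?; (subst nn_integral_cmult)?; simp?)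
  qed
  also have "\<dots> = metric_length lam C1 + metric_length lam C2"
    unfolding len1 len2
    using nn_integral_real_affine[OF m1, of 2 0] nn_integral_real_affine[OF m2, of 2 "-1"] by simp
  finally show ?thesis .
qed

text \<open>Up to the first time \<open>t1\<close> at which the path has moved away by
  \<open>r\<close> it stays where the density is at least \<open>\<kappa>\<close>, and its Euclidean
  length up to then is at least the displacement.\<close>

lemma metric_length_ge:
  assumes C: "valid_path C" "path_image C \<subseteq> G"
    and lower: "\<And>z. z \<in> G \<Longrightarrow> dist (pathstart C) z < r \<Longrightarrow> \<kappa> \<le> lam z"
    and \<kappa>: "0 \<le> \<kappa>" and r: "r \<le> dist (pathstart C) (pathfinish C)"
  shows "ennreal (\<kappa> * r) \<le> metric_length lam C"
proof -
  obtain S D where S: "finite S" and c: "continuous_on {0..1} C" "continuous_on ({0..1} - S) D"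
    and D: "\<And>t. t \<in> {0..1} - S \<Longrightarrow> (C has_vector_derivative D t) (at t)"
    and m: "(\<lambda>t. ennreal (lam (C t) * norm (D t)) * indicator ({0..1} - S) t) \<in> borel_measurable borel"
    and len: "metric_length lam C = (\<integral>\<^sup>+t. ennreal (lam (C t) * norm (D t)) * indicator ({0..1} - S) t \<partial>lborel)"
    by (rule path_speed[OF C], rule that)
  define T where "T = {t \<in> {0..1}. r \<le> dist (C 0) (C t)}"
  have "closed T" unfolding T_def
    by (intro continuous_on_closed_Collect_le continuous_on_dist continuous_on_const c(1)) auto
  then have "compact T" unfolding compact_eq_bounded_closed
    by (auto simp: T_def intro: bounded_subset[of "{0..1}"])
  moreover have "1 \<in> T" using r by (auto simp: T_def pathstart_def pathfinish_def)
  ultimately obtain t1 where t1: "t1 \<in> T" "\<And>t. t \<in> T \<Longrightarrow> t1 \<le> t"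
    using compact_attains_inf[of T] by auto
  have t1': "0 \<le> t1" "t1 \<le> 1" "r \<le> dist (C 0) (C t1)" using t1(1) by (auto simp: T_def)
  have in_G: "C t \<in> G" if "t \<in> {0..1}" for t using C(2) that by (auto simp: path_image_def)
  have low: "\<kappa> \<le> lam (C t)" if "0 \<le> t" "t < t1" for t
  proof (rule lower)
    show "C t \<in> G" using that t1' by (intro in_G) auto
    have "t \<notin> T" using that(2) t1(2)[of t] by linarith
    then show "dist (pathstart C) (C t) < r"
      using that t1' by (auto simp: T_def pathstart_def not_le)
  qed
  let ?A = "{0..<t1} - S"
  have A: "?A \<in> sets borel" using S by (intro sets.Diff) (auto intro: borel_closed finite_imp_closed)
  define f where "f t = indicator ?A t *\<^sub>R D t" for t
  have "D \<in> borel_measurable (restrict_space borel ?A)"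
    using t1' by (intro borel_measurable_continuous_on_restrict continuous_on_subset[OF c(2)]) auto
  then have fm: "f \<in> borel_measurable borel" unfolding f_def
    using A by (subst (asm) borel_measurable_restrict_space_iff) auto
  have le: "ennreal \<kappa> * (\<integral>\<^sup>+t. ennreal (norm (f t)) \<partial>lborel) \<le> metric_length lam C"
    unfolding len
  proof (subst nn_integral_cmult[symmetric])
    show "(\<lambda>t. ennreal (norm (f t))) \<in> borel_measurable lborel" using fm by simp
    show "(\<integral>\<^sup>+t. ennreal \<kappa> * ennreal (norm (f t)) \<partial>lborel)
        \<le> (\<integral>\<^sup>+t. ennreal (lam (C t) * norm (D t)) * indicator ({0..1} - S) t \<partial>lborel)"
    proof (rule nn_integral_mono)
      fix t
      show "ennreal \<kappa> * ennreal (norm (f t)) \<le> ennreal (lam (C t) * norm (D t)) * indicator ({0..1} - S) t"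
      proof (cases "t \<in> ?A")
        case True
        then have "\<kappa> * norm (D t) \<le> lam (C t) * norm (D t)" by (intro mult_right_mono low) auto
        then show ?thesis using True t1' \<kappa> by (auto simp: f_def ennreal_mult''[symmetric] intro!: ennreal_leI)
      qed (auto simp: f_def)
    qed
  qed
  \<comment> \<open>The fundamental theorem yields a gauge integral, and reading it as a Lebesgue
    integral requires \<open>f\<close> integrable. Infinite Euclidean length is therefore separated
    out, with \<open>\<kappa> = 0\<close> apart because \<open>0\<close> times infinity is
    0.\<close>
  show ?thesis
  proof (cases "(\<integral>\<^sup>+t. ennreal (norm (f t)) \<partial>lborel) = \<infinity>")
    case True
    show ?thesis
    proof (cases "\<kappa> = 0")
      case False
      then have "ennreal \<kappa> \<noteq> 0" using \<kappa> by simp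
      then have "metric_length lam C = \<infinity>" using le True \<kappa> by (simp add: ennreal_mult_eq_top_iff top_unique)
      then show ?thesis by simp
    qed simp
  next
    case False
    then have int: "integrable lborel f" using fm by (intro integrableI_bounded) (auto simp: less_top)
    have "(D has_integral (C t1 - C 0)) {0..t1}"
      using t1' by (intro fundamental_theorem_of_calculus_interior_strong[OF S])
        (auto intro!: D continuous_on_subset[OF c(1)])
    then have "(f has_integral (C t1 - C 0)) {0..t1}"
      by (rule has_integral_spike[of "insert t1 S", rotated 2])
        (use S in \<open>auto simp: f_def indicator_def intro: negligible_finite\<close>)
    then have "(f has_integral (C t1 - C 0)) UNIV"
      by (rule has_integral_on_superset) (auto simp: f_def)
    then have "C t1 - C 0 = (\<integral>t. f t \<partial>lborel)"
      using has_integral_integral_lborel[OF int] has_integral_unique by blast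
    then have "ennreal (norm (C t1 - C 0)) \<le> (\<integral>\<^sup>+t. ennreal (norm (f t)) \<partial>lborel)"
      using integral_norm_bound_ennreal[OF int] by simp
    moreover have "r \<le> norm (C t1 - C 0)" using t1'(3) by (simp add: dist_norm norm_minus_commute)
    ultimately have "ennreal r \<le> (\<integral>\<^sup>+t. ennreal (norm (f t)) \<partial>lborel)"
      by (meson ennreal_leI order_trans)
    then have "ennreal \<kappa> * ennreal r \<le> ennreal \<kappa> * (\<integral>\<^sup>+t. ennreal (norm (f t)) \<partial>lborel)"
      by (rule mult_left_mono) simp
    then show ?thesis using le \<kappa> by (simp add: ennreal_mult')
  qed
qed

text \<open>The infimum before \<open>enn2real\<close>: an infinite distance remains
  \<open>top\<close> instead of turning into 0, so the triangle inequality holds before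
  connectedness has been used.\<close>

definition path_dist :: "'a \<Rightarrow> 'a \<Rightarrow> ennreal" where
  "path_dist x y = (INF C\<in>{C. valid_path C \<and> path_image C \<subseteq> G \<and>
     pathstart C = x \<and> pathfinish C = y}. metric_length lam C)"

lemma metric_dist_eq_path_dist: "metric_dist G lam x y = enn2real (path_dist x y)"
  by (simp add: metric_dist_def path_dist_def)

lemma path_dist_le:
  "valid_path C \<Longrightarrow> path_image C \<subseteq> G \<Longrightarrow> path_dist (pathstart C) (pathfinish C) \<le> metric_length lam C"
  unfolding path_dist_def by (rule INF_lower) auto

lemma path_dist_commute_le: "path_dist x y \<le> path_dist y x"
  unfolding path_dist_def[of y x]
proof (rule INF_greatest)
  fix C assume "C \<in> {C. valid_path C \<and> path_image C \<subseteq> G \<and> pathstart C = y \<and> pathfinish C = x}"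
  then have C: "valid_path C" "path_image C \<subseteq> G" "pathstart C = y" "pathfinish C = x" by auto
  have "path_dist x y \<le> metric_length lam (reversepath C)"
    using path_dist_le[of "reversepath C"] C by (simp add: valid_path_imp_reverse)
  also have "\<dots> \<le> metric_length lam C" using C by (intro metric_length_reversepath_le)
  finally show "path_dist x y \<le> metric_length lam C" .
qed

lemma path_dist_commute: "path_dist x y = path_dist y x"
  by (intro antisym path_dist_commute_le)

lemma path_dist_triangle: "path_dist x z \<le> path_dist x y + path_dist y z"
proof -
  define A where "A x y = {C. valid_path C \<and> path_image C \<subseteq> G \<and> pathstart C = x \<and> pathfinish C = y}" for x y
  have PL: "path_dist x y = (INF C\<in>A x y. metric_length lam C)" for x y
    by (simp add: path_dist_def A_def)
  have "path_dist x z \<le> metric_length lam C1 + metric_length lam C2"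
    if "C1 \<in> A x y" "C2 \<in> A y z" for C1 C2
  proof -
    have "path_dist x z \<le> metric_length lam (C1 +++ C2)"
      using path_dist_le[of "C1 +++ C2"] that
      by (simp add: A_def valid_path_join path_image_join)
    also have "\<dots> \<le> metric_length lam C1 + metric_length lam C2"
      using that by (intro metric_length_joinpaths_le) (auto simp: A_def)
    finally show ?thesis .
  qed
  note join = this
  show ?thesis
  proof (rule ennreal_le_epsilon)
    fix e :: real assume fin: "path_dist x y + path_dist y z < top" and e: "0 < e"
    have "path_dist x y \<noteq> \<infinity>" "path_dist y z \<noteq> \<infinity>" using fin by auto
    moreover have "e / 2 > 0" using e by simp
    ultimately obtain C1 C2 where "C1 \<in> A x y" "metric_length lam C1 < path_dist x y + ennreal (e / 2)"
      "C2 \<in> A y z" "metric_length lam C2 < path_dist y z + ennreal (e / 2)"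
      using INF_approx_ennreal[OF _ PL, of "e / 2"] by blast
    then have "path_dist x z \<le> (path_dist x y + ennreal (e / 2)) + (path_dist y z + ennreal (e / 2))"
      by (intro order_trans[OF join] add_mono less_imp_le)
    also have "\<dots> = path_dist x y + path_dist y z + (ennreal (e / 2) + ennreal (e / 2))"
      by (simp only: ac_simps)
    also have "ennreal (e / 2) + ennreal (e / 2) = ennreal e" using e by (simp flip: ennreal_plus)
    finally show "path_dist x z \<le> path_dist x y + path_dist y z + ennreal e" .
  qed
qed

lemma path_dist_ge:
  assumes "\<And>z. z \<in> G \<Longrightarrow> dist x z < r \<Longrightarrow> \<kappa> \<le> lam z" "0 \<le> \<kappa>" "r \<le> dist x y"
  shows "ennreal (\<kappa> * r) \<le> path_dist x y"
  unfolding path_dist_def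
  by (rule INF_greatest) (use assms in \<open>auto intro!: metric_length_ge\<close>)

lemma path_dist_linepath:
  assumes "closed_segment x y \<subseteq> G" "\<And>z. z \<in> closed_segment x y \<Longrightarrow> lam z \<le> B"
  shows "path_dist x y \<le> ennreal (B * dist x y)"
proof -
  have "path_dist x y \<le> metric_length lam (linepath x y)"
    using path_dist_le[of "linepath x y"] assms(1) by simp
  also have "\<dots> \<le> (\<integral>\<^sup>+(t::real). ennreal (B * dist x y) * indicator {0..1} t \<partial>lborel)"
  proof (rule metric_length_le[of "{}"])
    fix t :: real assume "t \<in> {0..1} - {}"
    then have t: "t \<in> {0..1}" by simp
    then have "linepath x y t \<in> closed_segment x y" by (rule linepath_in_path)
    then have "lam (linepath x y t) * norm (y - x) \<le> B * dist x y"
      using assms(2) by (auto simp: dist_norm norm_minus_commute intro!: mult_right_mono)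
    moreover have "(linepath x y has_vector_derivative (y - x)) (at t)"
      by (rule has_vector_derivative_linepath_within)
    ultimately show "\<exists>v. (linepath x y has_vector_derivative v) (at t) \<and>
        ennreal (lam (linepath x y t) * norm v) \<le> ennreal (B * dist x y) * indicator {0..1} t"
      using t by (auto intro!: exI[of _ "y - x"] ennreal_leI)
  qed simp
  also have "\<dots> = ennreal (B * dist x y)" by (simp add: nn_integral_cmult)
  finally show ?thesis .
qed

end

text \<open>A ball is connected, so one that meets \<open>G\<close> without lying in it meets the
  frontier. With empty frontier the radius is 0 and nothing is claimed.\<close>

lemma ball_infdist_frontier_subset:
  fixes G :: "'a::euclidean_space set"
  assumes "x \<in> G"
  shows "ball x (infdist x (frontier G)) \<subseteq> G"
proof (rule ccontr)
  assume not: "\<not> ?thesis"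
  then obtain y where "y \<in> ball x (infdist x (frontier G))" by blast
  then have "dist x y < infdist x (frontier G)" by simp
  then have "x \<in> ball x (infdist x (frontier G))" by (metis dist_self le_less_trans mem_ball zero_le_dist)
  then have "ball x (infdist x (frontier G)) \<inter> G \<noteq> {}" using assms by blast
  with not have "ball x (infdist x (frontier G)) \<inter> frontier G \<noteq> {}"
    by (intro connected_Int_frontier) auto
  then obtain y where "y \<in> frontier G" "dist x y < infdist x (frontier G)" by auto
  then show False using infdist_le[of y "frontier G" x] by simp
qed

text \<open>Three bounds do three jobs: \<open>bdd\<close> makes distances finite and turns
  Euclidean convergence into convergence for the metric, \<open>pos\<close> turns Cauchy sequences
  into Euclidean ones, and \<open>lower\<close> keeps the Euclidean limit away from the
  frontier.\<close>

theorem (in lsc_density) metric_dist_complete: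
  assumes conn: "connected G" and c: "0 < c" and m: "0 < m"
    and bdd: "\<And>z. z \<in> G \<Longrightarrow> \<exists>r>0. \<exists>B. \<forall>w\<in>ball z r \<inter> G. lam w \<le> B"
    and pos: "\<And>z. z \<in> G \<Longrightarrow> m \<le> lam z"
    and lower: "\<And>z. z \<in> G \<Longrightarrow> c \<le> lam z * infdist z (frontier G)"
  shows "Metric_space G (metric_dist G lam) \<and> Metric_space.mcomplete G (metric_dist G lam)"
proof -
  let ?d = "metric_dist G lam"
  have near: "\<exists>r>0. \<exists>B\<ge>0. ball z r \<subseteq> G \<and> (\<forall>w\<in>ball z r. path_dist z w \<le> ennreal (B * dist z w))"
    if z: "z \<in> G" for z
  proof -
    obtain r1 B where r1: "r1 > 0" "\<forall>w\<in>ball z r1 \<inter> G. lam w \<le> B" using bdd[OF z] by blast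
    obtain r2 where r2: "r2 > 0" "ball z r2 \<subseteq> G" using open_G z open_contains_ball by blast
    define r where "r = min r1 r2"
    have sub: "ball z r \<subseteq> G" "ball z r \<subseteq> ball z r1" using r2 by (auto simp: r_def)
    have "path_dist z w \<le> ennreal (B * dist z w)" if w: "w \<in> ball z r" for w
    proof (rule path_dist_linepath)
      have seg: "closed_segment z w \<subseteq> ball z r"
        using w r1 r2 by (intro closed_segment_subset) (auto simp: r_def)
      then show "closed_segment z w \<subseteq> G" using sub by blast
      show "lam u \<le> B" if "u \<in> closed_segment z w" for u
        using that seg sub r1(2) by blast
    qed
    moreover have "lam z \<le> B" using r1 z by auto
    then have "B \<ge> 0" using m pos[OF z] by linarith
    ultimately show ?thesis using sub r1(1) r2(1) by (intro exI[of _ r]) (auto simp: r_def)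
  qed
  \<comment> \<open>Finite distance is an equivalence relation with open classes, so connectedness
    leaves a single class.\<close>
  have fin: "path_dist x y < \<infinity>" if "x \<in> G" "y \<in> G" for x y
  proof (rule connected_equivalence_relation[OF conn that, where R="\<lambda>x y. path_dist x y < \<infinity>"])
    show "path_dist v u < \<infinity>" if "path_dist u v < \<infinity>" for u v
      using that by (simp add: path_dist_commute)
    show "path_dist u w < \<infinity>" if "path_dist u v < \<infinity>" "path_dist v w < \<infinity>" for u v w
      by (rule le_less_trans[OF path_dist_triangle[of u w v]]) (use that in simp)
    fix u assume "u \<in> G"
    then obtain r B where r: "r > 0" "ball u r \<subseteq> G" "\<forall>w\<in>ball u r. path_dist u w \<le> ennreal (B * dist u w)"
      using near by metis
    have "path_dist u w < \<infinity>" if "w \<in> ball u r" for w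
    proof (rule le_less_trans)
      show "path_dist u w \<le> ennreal (B * dist u w)" using r that by blast
    qed simp
    then show "\<exists>T. openin (top_of_set G) T \<and> u \<in> T \<and> (\<forall>x\<in>T. path_dist u x < \<infinity>)"
      using r by (intro exI[of _ "ball u r"]) (auto simp: open_subset)
  qed
  have d_eq: "ennreal (?d x y) = path_dist x y" if "x \<in> G" "y \<in> G" for x y
    using fin[OF that] by (simp add: metric_dist_eq_path_dist less_top)
  have d_ge: "\<kappa> * r \<le> ?d x y"
    if "x \<in> G" "y \<in> G" "\<And>z. z \<in> G \<Longrightarrow> dist x z < r \<Longrightarrow> \<kappa> \<le> lam z" "0 \<le> \<kappa>" "r \<le> dist x y" for x y r \<kappa>
  proof -
    have "ennreal (\<kappa> * r) \<le> ennreal (?d x y)"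
      unfolding d_eq[OF that(1,2)] by (rule path_dist_ge) (use that in auto)
    moreover have "?d x y \<ge> 0" by (simp add: metric_dist_eq_path_dist)
    ultimately show ?thesis by simp
  qed
  have d_dist: "m * dist x y \<le> ?d x y" if "x \<in> G" "y \<in> G" for x y
    by (rule d_ge) (use that pos m in auto)
  \<comment> \<open>Within \<open>\<delta> / 2\<close> of \<open>x\<close> the distance to the
    frontier is at most \<open>3/2 \<delta>\<close>, so the density is at least
    \<open>c / (3/2 \<delta>)\<close>; crossing that radius costs \<open>c / 3\<close>.\<close>
  have d_near: "dist x y < infdist x (frontier G) / 2" if xy: "x \<in> G" "y \<in> G" and less: "?d x y < c / 3" for x y
  proof (rule ccontr)
    assume far: "\<not> ?thesis"
    define \<delta> where "\<delta> = infdist x (frontier G)"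
    have "lam x * \<delta> > 0" using lower[OF xy(1)] c unfolding \<delta>_def by linarith
    then have \<delta>: "\<delta> > 0" using pos[OF xy(1)] m by (simp add: zero_less_mult_iff)
    have "c / (3/2 * \<delta>) * (\<delta> / 2) \<le> ?d x y"
    proof (rule d_ge[OF xy])
      fix z assume z: "z \<in> G" "dist x z < \<delta> / 2"
      have "infdist z (frontier G) \<le> \<delta> + dist z x"
        unfolding \<delta>_def by (rule infdist_triangle)
      also have "\<dots> \<le> 3/2 * \<delta>" using z(2) by (simp add: dist_commute)
      finally have "lam z * infdist z (frontier G) \<le> lam z * (3/2 * \<delta>)"
        using pos[OF z(1)] m by (intro mult_left_mono) auto
      then have "c \<le> lam z * (3/2 * \<delta>)" using lower[OF z(1)] by linarith
      then show "c / (3/2 * \<delta>) \<le> lam z" using \<delta> by (subst pos_divide_le_eq) auto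
    qed (use far \<delta> c in \<open>auto simp: \<delta>_def\<close>)
    moreover have "c / (3/2 * \<delta>) * (\<delta> / 2) = c / 3" using \<delta> by simp
    ultimately show False using less by simp
  qed
  interpret Metric_space G ?d
  proof
    show "0 \<le> ?d x y" for x y by (simp add: metric_dist_eq_path_dist)
    show "?d x y = ?d y x" for x y by (simp add: metric_dist_eq_path_dist path_dist_commute)
  next
    fix x y assume xy: "x \<in> G" "y \<in> G"
    show "?d x y = 0 \<longleftrightarrow> x = y"
    proof
      assume "?d x y = 0"
      then have "m * dist x y \<le> 0" using d_dist[OF xy] by simp
      then show "x = y" using m by (simp add: mult_le_0_iff)
    next
      assume "x = y"
      obtain B where "path_dist x x \<le> ennreal (B * dist x x)"
        using near[OF xy(1)] by (metis centre_in_ball)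
      then show "?d x y = 0" using \<open>x = y\<close> by (simp add: metric_dist_eq_path_dist)
    qed
  next
    fix x y z assume xyz: "x \<in> G" "y \<in> G" "z \<in> G"
    have "ennreal (?d x z) \<le> ennreal (?d x y) + ennreal (?d y z)"
      using xyz path_dist_triangle by (simp add: d_eq)
    then show "?d x z \<le> ?d x y + ?d y z"
      by (simp add: metric_dist_eq_path_dist flip: ennreal_plus)
  qed
  have mcomplete
    unfolding mcomplete_def
  proof (intro allI impI)
    fix \<sigma> assume \<sigma>: "MCauchy \<sigma>"
    then have inG: "\<sigma> n \<in> G" for n by (auto simp: MCauchy_def)
    have cau: "\<exists>N. \<forall>n n'. N \<le> n \<longrightarrow> N \<le> n' \<longrightarrow> ?d (\<sigma> n) (\<sigma> n') < \<epsilon>" if "\<epsilon> > 0" for \<epsilon>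
      using \<sigma> that unfolding MCauchy_def by blast
    have "Cauchy \<sigma>"
    proof (rule metric_CauchyI)
      fix e :: real assume e: "0 < e"
      then obtain N where N: "\<forall>n n'. N \<le> n \<longrightarrow> N \<le> n' \<longrightarrow> ?d (\<sigma> n) (\<sigma> n') < m * e"
        using cau[of "m * e"] m by auto
      have "dist (\<sigma> n) (\<sigma> n') < e" if "n \<ge> N" "n' \<ge> N" for n n'
      proof -
        have "m * dist (\<sigma> n) (\<sigma> n') < m * e" using N that d_dist[OF inG inG] by (meson le_less_trans)
        then show ?thesis using m by simp
      qed
      then show "\<exists>M. \<forall>m\<ge>M. \<forall>n\<ge>M. dist (\<sigma> m) (\<sigma> n) < e" by blast
    qed
    then obtain x where x: "\<sigma> \<longlonglongrightarrow> x" using Cauchy_convergent_iff convergent_def by blast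
    obtain N where N: "\<forall>n n'. N \<le> n \<longrightarrow> N \<le> n' \<longrightarrow> ?d (\<sigma> n) (\<sigma> n') < c / 3"
      using cau[of "c / 3"] c by auto
    define \<delta> where "\<delta> = infdist (\<sigma> N) (frontier G)"
    have close: "dist (\<sigma> N) (\<sigma> n) \<le> \<delta> / 2" if "n \<ge> N" for n
      using d_near[OF inG inG, of N n] N that by (auto simp: \<delta>_def)
    \<comment> \<open>Comparing \<open>\<sigma> N\<close> with itself: the strict bound of
      \<open>d_near\<close> forces a positive radius.\<close>
    have \<delta>: "0 < \<delta>" using d_near[OF inG inG, of N N] N by (auto simp: \<delta>_def)
    have "dist (\<sigma> N) x \<le> \<delta> / 2"
      by (rule LIMSEQ_le_const2[OF tendsto_dist[OF tendsto_const x]]) (use close in auto)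
    then have "x \<in> ball (\<sigma> N) \<delta>" using \<delta> by auto
    then have xG: "x \<in> G" using ball_infdist_frontier_subset[OF inG, of N] by (auto simp: \<delta>_def)
    obtain r B where r: "r > 0" "B \<ge> 0" "\<forall>w\<in>ball x r. path_dist x w \<le> ennreal (B * dist x w)"
      using near[OF xG] by metis
    have "limitin mtopology \<sigma> x sequentially"
      unfolding limitin_metric
    proof (intro conjI allI impI xG)
      fix \<epsilon> :: real assume \<epsilon>: "0 < \<epsilon>"
      \<comment> \<open>\<open>B + 1\<close> avoids a division by 0 and makes the last estimate
        strict.\<close>
      define \<rho> where "\<rho> = min r (\<epsilon> / (B + 1))"
      have \<rho>: "\<rho> > 0" using r \<epsilon> by (simp add: \<rho>_def)
      have "\<forall>\<^sub>F n in sequentially. dist (\<sigma> n) x < \<rho>" using x \<rho> by (rule tendstoD)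
      then show "\<forall>\<^sub>F n in sequentially. \<sigma> n \<in> G \<and> ?d (\<sigma> n) x < \<epsilon>"
      proof eventually_elim
        case (elim n)
        then have "ennreal (?d x (\<sigma> n)) \<le> ennreal (B * dist x (\<sigma> n))"
          using r(3) by (subst d_eq[OF xG inG]) (auto simp: \<rho>_def dist_commute)
        then have "?d x (\<sigma> n) \<le> B * dist x (\<sigma> n)" using r(2) by simp
        also have "\<dots> \<le> B * (\<epsilon> / (B + 1))"
          using elim r(2) by (intro mult_left_mono) (auto simp: \<rho>_def dist_commute)
        also have "\<dots> < \<epsilon>" using r(2) \<epsilon> by (simp add: field_simps)
        finally show ?case using inG commute by simp
      qed
    qed
    then show "\<exists>x. limitin mtopology \<sigma> x sequentially" by blast
  qed
  then show ?thesis using Metric_space_axioms by blast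
qed

section \<open>Paravectors and the Cauchy kernel\<close>

definition paravec :: "'n::{finite,linorder} paravector \<Rightarrow> 'n clifford" where
  "paravec x = fst x *\<^sub>R blade {} + (\<Sum>j\<in>UNIV. (snd x $ j) *\<^sub>R blade {j})"

lemma linear_paravec: "linear paravec"
  by (rule linearI) (simp_all add: paravec_def scaleR_add_left sum.distrib scaleR_sum_right scaleR_add_right)

lemma linear_cconj: "linear cconj"
  by (auto simp: linear_iff cconj_def vec_eq_iff algebra_simps)

lemma bounded_linear_paravec: "bounded_linear paravec"
  by (rule linear_conv_bounded_linear[THEN iffD1, OF linear_paravec])

lemma bounded_linear_cconj: "bounded_linear cconj"
  by (rule linear_conv_bounded_linear[THEN iffD1, OF linear_cconj])

lemma bounded_bilinear_cmult: "bounded_bilinear (\<odot>)"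
  by (rule bilinear_conv_bounded_bilinear[THEN iffD1, OF bilinear_cmult])

lemmas cmult_simps =
  bounded_bilinear.add_left[OF bounded_bilinear_cmult] bounded_bilinear.add_right[OF bounded_bilinear_cmult]
  bounded_bilinear.scaleR_left[OF bounded_bilinear_cmult] bounded_bilinear.scaleR_right[OF bounded_bilinear_cmult]
  bounded_bilinear.sum_left[OF bounded_bilinear_cmult] bounded_bilinear.sum_right[OF bounded_bilinear_cmult]
  bounded_bilinear.minus_left[OF bounded_bilinear_cmult] bounded_bilinear.minus_right[OF bounded_bilinear_cmult]
  bounded_bilinear.diff_left[OF bounded_bilinear_cmult] bounded_bilinear.diff_right[OF bounded_bilinear_cmult]
  bounded_bilinear.zero_left[OF bounded_bilinear_cmult] bounded_bilinear.zero_right[OF bounded_bilinear_cmult]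

lemma cconj_paravec: "cconj (paravec x) = paravec (fst x, - snd x)"
  by (simp add: paravec_def linear_add[OF linear_cconj] linear_cmul[OF linear_cconj]
      linear_sum[OF linear_cconj] cconj_one cconj_generator)

text \<open>The square of the vector part is a double sum over
  \<open>blade {i} \<odot> blade {j}\<close>; adding its transposed copy leaves only
  anticommutators, which vanish off the diagonal. So a nonzero paravector is inverted by its
  conjugate over its squared norm, the source of the Cauchy kernel.\<close>

lemma paravec_cconj: "paravec x \<odot> cconj (paravec x) = (norm x)\<^sup>2 *\<^sub>R blade {}"
proof -
  define v where "v = (\<Sum>j\<in>UNIV. (snd x $ j) *\<^sub>R blade {j})"
  have A: "v \<odot> v = (\<Sum>i\<in>UNIV. \<Sum>j\<in>UNIV. (snd x $ i * snd x $ j) *\<^sub>R (blade {i} \<odot> blade {j}))"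
    unfolding v_def
    by (subst bounded_bilinear.sum_left[OF bounded_bilinear_cmult],
        subst bounded_bilinear.sum_right[OF bounded_bilinear_cmult]) (simp add: cmult_simps mult.commute)
  have B: "v \<odot> v = (\<Sum>i\<in>UNIV. \<Sum>j\<in>UNIV. (snd x $ i * snd x $ j) *\<^sub>R (blade {j} \<odot> blade {i}))"
    unfolding A by (subst sum.swap) (simp only: mult.commute)
  have "2 *\<^sub>R (v \<odot> v) = v \<odot> v + v \<odot> v" by (rule scaleR_2)
  also have "\<dots> = (\<Sum>i\<in>UNIV. \<Sum>j\<in>UNIV. (snd x $ i * snd x $ j) *\<^sub>R (blade {i} \<odot> blade {j}))
      + (\<Sum>i\<in>UNIV. \<Sum>j\<in>UNIV. (snd x $ i * snd x $ j) *\<^sub>R (blade {j} \<odot> blade {i}))"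
    by (rule arg_cong2[where f="(+)", OF A B])
  also have "\<dots>
      = (\<Sum>i\<in>UNIV. \<Sum>j\<in>UNIV. (snd x $ i * snd x $ j) *\<^sub>R ((if i = j then - 2 else 0) *\<^sub>R blade {}))"
    by (simp only: sum.distrib[symmetric] scaleR_add_right[symmetric] cmult_generators)
  also have "\<dots> = (\<Sum>i\<in>UNIV. (- 2 * (snd x $ i * snd x $ i)) *\<^sub>R blade {})"
    by (rule sum.cong[OF refl], subst sum.remove[of UNIV]) auto
  also have "\<dots> = (- 2 * (snd x \<bullet> snd x)) *\<^sub>R blade {}"
    by (simp add: inner_vec_def scaleR_sum_left sum_distrib_left)
  finally have "2 *\<^sub>R (v \<odot> v) = 2 *\<^sub>R (- (snd x \<bullet> snd x)) *\<^sub>R blade {}" by simp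
  then have vv: "v \<odot> v = - (snd x \<bullet> snd x) *\<^sub>R blade {}"
    by (metis scaleR_cancel_left zero_neq_numeral)
  have p: "paravec x = fst x *\<^sub>R blade {} + v" by (simp add: paravec_def v_def)
  have c: "cconj (paravec x) = fst x *\<^sub>R blade {} - v"
    unfolding cconj_paravec by (simp add: paravec_def v_def sum_negf)
  have "paravec x \<odot> cconj (paravec x) = (fst x * fst x) *\<^sub>R blade {} - v \<odot> v"
    unfolding c unfolding p by (simp add: cmult_simps cmult_one algebra_simps)
  also have "\<dots> = (norm x)\<^sup>2 *\<^sub>R blade {}"
    unfolding vv power2_norm_eq_inner by (simp add: inner_prod_def scaleR_add_left)
  finally show ?thesis .
qed

lemma cconj_paravec_mult: "cconj (paravec x) \<odot> paravec x = (norm x)\<^sup>2 *\<^sub>R blade {}"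
proof -
  have "cconj (cconj (paravec x)) = paravec x" by (simp add: cconj_paravec)
  then show ?thesis
    using paravec_cconj[of "(fst x, - snd x)"] by (simp add: cconj_paravec[symmetric] norm_Pair norm_prod_def)
qed

text \<open>Blades are orthonormal for this form: \<open>cconj (blade A) \<odot> blade B\<close> is
  a signed blade, scalar only if \<open>A = B\<close>, and then the sign squares away. It identifies
  \<open>hardy_norm\<close> with an ordinary \<open>L2\<close> norm and lets the Clifford-valued
  reproducing property be used through real inner products.\<close>

lemma Sc_cconj_cmult: "Sc (cconj a \<odot> b) = a \<bullet> b"
proof -
  have lin: "linear (\<lambda>b. Sc (cconj a \<odot> b))" for a
    unfolding Sc_def by (rule linearI) (simp_all add: cmult_simps)
  have lin': "linear (\<lambda>a. Sc (cconj a \<odot> b))" for b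
    unfolding Sc_def by (rule linearI)
      (simp_all add: cmult_simps linear_add[OF linear_cconj] linear_cmul[OF linear_cconj])
  have cb: "cconj (blade A) = blade_sign A A *\<^sub>R blade A" for A :: "'a set"
    unfolding cconj_sign[symmetric] by (simp add: cconj_def blade_def axis_def vec_eq_iff)
  have sq: "blade_sign A B * blade_sign A B = 1" for A B :: "'a set"
    by (simp add: blade_sign_def flip: power_add)
  have bb: "Sc (cconj (blade A) \<odot> blade B) = blade A \<bullet> blade B" for A B :: "'a set"
  proof -
    have "{} = sym_diff A B \<longleftrightarrow> A = B" by auto
    then show ?thesis using sq[of A A]
      by (simp add: cb cmult_simps cmult_blade Sc_def blade_nth) (auto simp: blade_def inner_axis_axis)
  qed
  have in1: "linear (\<lambda>b. a \<bullet> b)" "linear (\<lambda>b. b \<bullet> a)" for a :: "'a clifford"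
    by (auto intro!: linearI simp: inner_simps)
  have exp: "f a = g a" if "linear f" "linear g" "\<And>A. f (blade A) = g (blade A)"
    for f g :: "'a clifford \<Rightarrow> real" and a
    by (rule linear_eq_blade[OF that])
  have "Sc (cconj (blade A) \<odot> b) = blade A \<bullet> b" for A :: "'a set"
    by (rule exp[OF lin in1(1) bb])
  then show ?thesis by (rule exp[OF lin' in1(2)])
qed

lemma cconj_cconj [simp]: "cconj (cconj a) = a"
  by (simp add: cconj_def vec_eq_iff flip: mult.assoc power_add mult_2)

lemma Sc_cmult_cconj: "Sc (a \<odot> b) = cconj a \<bullet> b"
  using Sc_cconj_cmult[of "cconj a" b] by simp

lemma norm_cconj: "norm (cconj a) = norm a"
proof -
  have "(cconj a $ A)\<^sup>2 = (a $ A)\<^sup>2" for A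
    by (simp add: cconj_def power_mult_distrib flip: power_mult power_mult_distrib)
      (simp add: power2_eq_square flip: power_add mult_2)
  then show ?thesis by (simp add: norm_vec_def L2_set_def)
qed

lemma sum_Basis_paravector:
  fixes g :: "'n::finite paravector \<Rightarrow> 'b::comm_monoid_add"
  shows "(\<Sum>b\<in>Basis. g b) = g (1, 0) + (\<Sum>j\<in>UNIV. g (0, axis j 1))"
proof -
  have B: "(Basis :: (real^'n) set) = range (\<lambda>j. axis j 1)" by (auto simp: Basis_vec_def)
  have "inj (\<lambda>j::'n. axis j (1::real))" by (auto simp: inj_def axis_eq_axis)
  then have "(\<Sum>b\<in>(Basis :: (real^'n) set). g (0, b)) = (\<Sum>j\<in>UNIV. g (0, axis j 1))"
    unfolding B by (simp add: sum.reindex)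
  moreover have "(\<Sum>b\<in>Basis. g b) = (\<Sum>b\<in>(Basis :: real set). g (b, 0)) + (\<Sum>b\<in>Basis. g (0, b))"
  proof -
    have "inj_on (\<lambda>u::real. (u, 0::real^'n)) Basis" "inj_on (\<lambda>u::real^'n. (0::real, u)) Basis"
      by (auto simp: inj_on_def)
    then show ?thesis unfolding Basis_prod_def
      by (subst sum.union_disjoint) (auto simp: sum.reindex)
  qed
  ultimately show ?thesis by simp
qed

lemma paravec_basis: "paravec (1, 0) = blade {}" "paravec (0, axis j 1) = blade {j}"
  by (simp_all add: paravec_def axis_def if_distrib if_distribR cong: if_cong)

lemma dirac_eq: "dirac f z = (\<Sum>b\<in>Basis. paravec b \<odot> frechet_derivative f (at z) b)"
  by (simp add: dirac_def sum_Basis_paravector paravec_basis cmult_one)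

lemma sum_Basis_paravec:
  "(\<Sum>b\<in>Basis. (x \<bullet> b) *\<^sub>R paravec b) = paravec x"
  using linear_sum[OF linear_paravec, of "\<lambda>b. (x \<bullet> b) *\<^sub>R b" Basis]
  by (simp add: linear_cmul[OF linear_paravec] euclidean_representation)

text \<open>
  For \<open>a = 0\<close> this is the Cauchy kernel up to a constant factor; for \<open>a > 0\<close> it is smooth, and
  applying the Dirac operator gives the positive scalar approximate identity \<open>cauchy_density a\<close>.
\<close>

definition cauchy_kernel :: "real \<Rightarrow> 'n::{finite,linorder} paravector \<Rightarrow> 'n clifford" where
  "cauchy_kernel a x = ((norm x)\<^sup>2 + a) powr (- (real DIM('n paravector) / 2)) *\<^sub>R cconj (paravec x)"

definition cauchy_kernel_deriv ::
    "real \<Rightarrow> 'n::{finite,linorder} paravector \<Rightarrow> 'n paravector \<Rightarrow> 'n clifford" where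
  "cauchy_kernel_deriv a x v =
     ((norm x)\<^sup>2 + a) powr (- (real DIM('n paravector) / 2)) *\<^sub>R cconj (paravec v)
     - (real DIM('n paravector) * ((norm x)\<^sup>2 + a) powr (- (real DIM('n paravector) / 2) - 1) * (x \<bullet> v))
       *\<^sub>R cconj (paravec x)"

definition cauchy_density :: "real \<Rightarrow> 'n::{finite,linorder} paravector \<Rightarrow> real" where
  "cauchy_density a x =
     real DIM('n paravector) * a * ((norm x)\<^sup>2 + a) powr (- (real DIM('n paravector) / 2) - 1)"

lemma cauchy_kernel_has_derivative:
  assumes "0 < (norm x)\<^sup>2 + a"
  shows "(cauchy_kernel a has_derivative cauchy_kernel_deriv a x) (at x)"
proof -
  let ?n = "real DIM('a paravector)"
  have bl: "bounded_linear (\<lambda>x. cconj (paravec x) :: 'a clifford)"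
    by (rule bounded_linear_compose[OF bounded_linear_cconj bounded_linear_paravec])
  have dn: "((\<lambda>x. (norm x)\<^sup>2 + a) has_derivative (\<lambda>v. 2 * (x \<bullet> v))) (at x)"
    unfolding power2_norm_eq_inner by (auto intro!: derivative_eq_intros simp: inner_commute)
  have dp: "((\<lambda>s. s powr (- (?n / 2))) has_derivative
      (\<lambda>d. d * (- (?n / 2) * ((norm x)\<^sup>2 + a) powr (- (?n / 2) - 1)))) (at ((norm x)\<^sup>2 + a))"
    using has_real_derivative_powr[OF assms, of "- (?n / 2)"]
    unfolding has_field_derivative_def by (rule has_derivative_eq_rhs) (simp add: fun_eq_iff)
  have coef: "2 * d * (- (n / 2) * q) = - (n * q * d)" for d n q :: real by simp
  from has_derivative_compose[OF dn dp] have "((\<lambda>x. ((norm x)\<^sup>2 + a) powr (- (?n / 2))) has_derivative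
      (\<lambda>v. 2 * (x \<bullet> v) * (- (?n / 2) * ((norm x)\<^sup>2 + a) powr (- (?n / 2) - 1)))) (at x)" .
  from has_derivative_scaleR[OF this bounded_linear.has_derivative[OF bl has_derivative_ident]]
  show ?thesis unfolding cauchy_kernel_def cauchy_kernel_deriv_def
    by (rule has_derivative_eq_rhs) (simp only: coef scaleR_minus_left add_uminus_conv_diff)
qed

text \<open>The two terms of the derivative combine to \<open>n a\<close> times a power of
  \<open>|x|^2 + a\<close>; for \<open>a = 0\<close> they cancel, which is monogenicity of the
  Cauchy kernel. Paravectors stand on the right when the kernel is integrated against
  \<open>f\<close>, on the left when the kernel itself is a test function.\<close>

lemma sum_cauchy_kernel_deriv:
  fixes x :: "'n::{finite,linorder} paravector"
  assumes "0 < (norm x)\<^sup>2 + a"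
  shows "(\<Sum>b\<in>Basis. cauchy_kernel_deriv a x b \<odot> paravec b) = cauchy_density a x *\<^sub>R blade {}" (is "?R = _")
    and "(\<Sum>b\<in>Basis. paravec b \<odot> cauchy_kernel_deriv a x b) = cauchy_density a x *\<^sub>R blade {}" (is "?L = _")
proof -
  define n where "n = real DIM('n paravector)"
  define s where "s = (norm x)\<^sup>2 + a"
  define c where "c = n * s powr (- (n / 2) - 1)"
  have s: "s powr (- (n / 2)) = s powr (- (n / 2) - 1) * s"
    using assms by (simp add: powr_diff s_def[symmetric])
  have D: "cauchy_kernel_deriv a x b = s powr (- (n / 2)) *\<^sub>R cconj (paravec b)
      - (c * (x \<bullet> b)) *\<^sub>R cconj (paravec x)" for b
    by (simp add: cauchy_kernel_deriv_def n_def s_def c_def)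
  have fin: "(n * s powr (- (n / 2)) - c * (norm x)\<^sup>2) *\<^sub>R blade {} = cauchy_density a x *\<^sub>R blade {}"
    unfolding s c_def cauchy_density_def n_def[symmetric] s_def[symmetric]
    by (simp add: s_def algebra_simps)
  have const: "(\<Sum>b\<in>(Basis :: 'n paravector set). blade {}) = n *\<^sub>R (blade {} :: 'n clifford)"
    unfolding n_def by (rule sum_constant_scaleR)
  have "(\<Sum>b\<in>(Basis :: 'n paravector set). cconj (paravec b) \<odot> paravec b) = (\<Sum>b\<in>(Basis :: 'n paravector set). blade {})"
    by (rule sum.cong) (simp_all add: cconj_paravec_mult)
  then have R: "(\<Sum>b\<in>(Basis :: 'n paravector set). cconj (paravec b) \<odot> paravec b) = n *\<^sub>R blade {}"
    unfolding const .
  have "(\<Sum>b\<in>(Basis :: 'n paravector set). paravec b \<odot> cconj (paravec b)) = (\<Sum>b\<in>(Basis :: 'n paravector set). blade {})"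
    by (rule sum.cong) (simp_all add: paravec_cconj)
  then have L: "(\<Sum>b\<in>(Basis :: 'n paravector set). paravec b \<odot> cconj (paravec b)) = n *\<^sub>R blade {}"
    unfolding const .
  have "?R = s powr (- (n / 2)) *\<^sub>R (\<Sum>b\<in>(Basis :: 'n paravector set). cconj (paravec b) \<odot> paravec b)
      - c *\<^sub>R (cconj (paravec x) \<odot> (\<Sum>b\<in>Basis. (x \<bullet> b) *\<^sub>R paravec b))"
    unfolding D by (simp add: cmult_simps scaleR_sum_right sum_subtractf)
  also have "\<dots> = (n * s powr (- (n / 2)) - c * (norm x)\<^sup>2) *\<^sub>R blade {}"
    unfolding sum_Basis_paravec R unfolding cconj_paravec_mult
    by (simp add: scaleR_diff_left mult.commute)
  finally show "?R = cauchy_density a x *\<^sub>R blade {}" unfolding fin .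
  have "?L = s powr (- (n / 2)) *\<^sub>R (\<Sum>b\<in>(Basis :: 'n paravector set). paravec b \<odot> cconj (paravec b))
      - c *\<^sub>R ((\<Sum>b\<in>Basis. (x \<bullet> b) *\<^sub>R paravec b) \<odot> cconj (paravec x))"
    unfolding D by (simp add: cmult_simps scaleR_sum_right sum_subtractf)
  also have "\<dots> = (n * s powr (- (n / 2)) - c * (norm x)\<^sup>2) *\<^sub>R blade {}"
    unfolding sum_Basis_paravec L unfolding paravec_cconj
    by (simp add: scaleR_diff_left mult.commute)
  finally show "?L = cauchy_density a x *\<^sub>R blade {}" unfolding fin .
qed

lemma norm_paravec: "norm (paravec x) = norm x"
proof (rule power2_eq_imp_eq)
  have "(norm (paravec x))\<^sup>2 = Sc (cconj (paravec x) \<odot> paravec x)"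
    by (simp add: Sc_cconj_cmult power2_norm_eq_inner)
  also have "\<dots> = (norm x)\<^sup>2" unfolding cconj_paravec_mult by (simp add: Sc_def blade_nth)
  finally show "(norm (paravec x))\<^sup>2 = (norm x)\<^sup>2" .
qed auto

lemma norm_cauchy_kernel:
  fixes x :: "'n::{finite,linorder} paravector"
  shows "norm (cauchy_kernel a x) = ((norm x)\<^sup>2 + a) powr (- (real DIM('n paravector) / 2)) * norm x"
  unfolding cauchy_kernel_def norm_scaleR norm_cconj norm_paravec by simp

text \<open>Product rule for \<open>h w \<odot> paravec b \<odot> f w\<close>: the terms that
  differentiate \<open>f\<close> assemble to \<open>h w \<odot> dirac f w\<close>, which is 0. The
  remaining divergence is continuous although the derivatives of \<open>f\<close> need not be,
  exactly the setting of \<open>integral_divergence_eq_0\<close>.\<close>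

theorem integral_monogenic_test:
  fixes h :: "'n::{finite,linorder} paravector \<Rightarrow> 'n clifford"
  assumes G: "open G" and f: "left_monogenic G f"
    and S: "compact S" "S \<subseteq> G" and h0: "\<And>w. w \<in> G \<Longrightarrow> w \<notin> S \<Longrightarrow> h w = 0"
    and h': "\<And>w. w \<in> G \<Longrightarrow> (h has_derivative h' w) (at w)"
    and hc: "continuous_on G (\<lambda>w. \<Sum>b\<in>Basis. h' w b \<odot> paravec b)"
  defines "F \<equiv> \<lambda>w. if w \<in> G then (\<Sum>b\<in>Basis. h' w b \<odot> paravec b) \<odot> f w else 0"
  shows "continuous_on UNIV F" and "(F has_integral 0) UNIV"
proof -
  have diff: "(f has_derivative frechet_derivative f (at w)) (at w)" "dirac f w = 0" if "w \<in> G" for w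
    using f that by (auto simp: left_monogenic_def frechet_derivative_works)
  have fc: "continuous_on G f"
    using f by (intro differentiable_imp_continuous_on) 
      (auto simp: left_monogenic_def differentiable_on_def differentiable_at_withinI)
  have oS: "open (- S)" "open (G - S)" using S(1) G by (simp_all add: compact_imp_closed open_Compl open_Diff)
  have h'0: "h' w = (\<lambda>v. 0)" if "w \<in> G - S" for w
  proof -
    have "((\<lambda>w. 0) has_derivative h' w) (at w)"
      by (rule has_derivative_transform_within_open[OF h' oS(2) that]) (use h0 that in auto)
    then show ?thesis by (rule has_derivative_unique) (rule has_derivative_const)
  qed
  have F0: "F w = 0" if "w \<in> - S" for w
    using h'0[of w] that by (simp add: F_def cmult_simps)
  have "continuous_on G F"
  proof -
    have "continuous_on G (\<lambda>w. (\<Sum>b\<in>Basis. h' w b \<odot> paravec b) \<odot> f w)"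
      by (intro bounded_bilinear.continuous_on[OF bounded_bilinear_cmult] fc hc)
    then show ?thesis by (rule continuous_on_eq) (simp add: F_def)
  qed
  moreover have "continuous_on (- S) F"
    by (rule continuous_on_eq[OF continuous_on_const[of _ 0]]) (simp add: F0)
  ultimately have "continuous_on (G \<union> - S) F" using G oS(1) by (intro continuous_on_open_Un)
  moreover have "G \<union> - S = UNIV" using S(2) by auto
  ultimately show Fc: "continuous_on UNIV F" by simp
  show "(F has_integral 0) UNIV"
  proof (rule has_integral_componentwise)
    fix c :: "'n clifford" assume "c \<in> Basis"
    \<comment> \<open>\<open>f\<close> is extended by 0 because off \<open>G\<close> neither
      \<open>f\<close> nor \<open>h\<close> is under control; inside \<open>G\<close> the vanishing
      of \<open>h\<close> off \<open>S\<close> does the same job.\<close>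
    define u where "u w = (if w \<in> G then f w else 0)" for w
    define V where "V w = (\<Sum>b\<in>Basis. (((h w \<odot> paravec b) \<odot> u w) \<bullet> c) *\<^sub>R b)" for w
    define V' where "V' w v = (if w \<in> G then
      (\<Sum>b\<in>Basis. (((h w \<odot> paravec b) \<odot> frechet_derivative f (at w) v + (h' w v \<odot> paravec b) \<odot> f w) \<bullet> c) *\<^sub>R b)
      else 0)" for w v
    have "((\<lambda>w. F w \<bullet> c) has_integral 0) UNIV"
    proof (rule integral_divergence_eq_0)
      fix w
      show "(V has_derivative V' w) (at w)"
      proof (cases "w \<in> G")
        case True
        have bl: "bounded_linear (\<lambda>a. a \<odot> paravec b)" for b :: "'n paravector"
          by (rule bounded_bilinear.bounded_linear_left[OF bounded_bilinear_cmult])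
        have 1: "((\<lambda>w. (h w \<odot> paravec b) \<odot> f w) has_derivative
          (\<lambda>v. (h w \<odot> paravec b) \<odot> frechet_derivative f (at w) v + (h' w v \<odot> paravec b) \<odot> f w)) (at w)" for b
          by (rule bounded_bilinear.FDERIV[OF bounded_bilinear_cmult
                bounded_linear.has_derivative[OF bl h'[OF True]] diff(1)[OF True]])
        have "((\<lambda>w. \<Sum>b\<in>Basis. (((h w \<odot> paravec b) \<odot> f w) \<bullet> c) *\<^sub>R b) has_derivative
          (\<lambda>v. \<Sum>b\<in>Basis. (((h w \<odot> paravec b) \<odot> frechet_derivative f (at w) v + (h' w v \<odot> paravec b) \<odot> f w) \<bullet> c) *\<^sub>R b)) (at w)"
          by (intro has_derivative_sum has_derivative_scaleR_left has_derivative_inner_left 1)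
        then have "(V has_derivative
          (\<lambda>v. \<Sum>b\<in>Basis. (((h w \<odot> paravec b) \<odot> frechet_derivative f (at w) v + (h' w v \<odot> paravec b) \<odot> f w) \<bullet> c) *\<^sub>R b)) (at w)"
          by (rule has_derivative_transform_within_open[OF _ G True]) (simp add: V_def u_def)
        moreover have "V' w = (\<lambda>v. \<Sum>b\<in>Basis. (((h w \<odot> paravec b) \<odot> frechet_derivative f (at w) v + (h' w v \<odot> paravec b) \<odot> f w) \<bullet> c) *\<^sub>R b)"
          using True by (simp add: V'_def fun_eq_iff)
        ultimately show ?thesis by simp
      next
        case False
        then have w: "w \<in> - S" using S(2) by auto
        have "((\<lambda>w. 0) has_derivative (\<lambda>v. 0)) (at w)" by (rule has_derivative_const)
        then have "(V has_derivative (\<lambda>v. 0)) (at w)"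
          by (rule has_derivative_transform_within_open[OF _ oS(1) w]) (simp add: V_def u_def h0 cmult_simps)
        moreover have "V' w = (\<lambda>v. 0)" using False by (simp add: V'_def fun_eq_iff)
        ultimately show ?thesis by simp
      qed
      show "F w \<bullet> c = (\<Sum>i\<in>Basis. V' w i \<bullet> i)"
      proof (cases "w \<in> G")
        case True
        have "(\<Sum>i\<in>Basis. V' w i \<bullet> i) =
          (\<Sum>i\<in>Basis. (h w \<odot> (paravec i \<odot> frechet_derivative f (at w) i) + (h' w i \<odot> paravec i) \<odot> f w) \<bullet> c)"
          using True by (simp add: V'_def cmult_assoc)
        also have "\<dots> = (h w \<odot> dirac f w + (\<Sum>b\<in>Basis. h' w b \<odot> paravec b) \<odot> f w) \<bullet> c"
          unfolding dirac_eq by (simp add: cmult_simps sum.distrib inner_sum_left inner_add_left)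
        finally show ?thesis using True by (simp add: diff F_def cmult_simps)
      qed (simp add: V'_def F_def)
    next
      show "continuous_on UNIV (\<lambda>w. F w \<bullet> c)" by (intro continuous_intros Fc)
      have "V w = 0" if "w \<notin> S" for w using h0[of w] that by (simp add: V_def u_def cmult_simps)
      then have "{w. V w \<noteq> 0} \<subseteq> S" by blast
      then show "bounded {w. V w \<noteq> 0}" using S(1) compact_imp_bounded bounded_subset by blast
    qed
    then show "((\<lambda>w. F w \<bullet> c) has_integral 0 \<bullet> c) UNIV" by simp
  qed
qed

section \<open>Hausdorff measure of the boundary\<close>

lemma hausdorff_pre_le_finite_cover:
  fixes A :: "'a::metric_space set"
  assumes d: "d > 0" and I: "finite I" and A: "A \<subseteq> (\<Union>k\<in>I. D k)"
    and D: "\<And>k. k \<in> I \<Longrightarrow> bounded (D k) \<and> diameter (D k) \<le> \<epsilon>" and \<epsilon>: "0 \<le> \<epsilon>" "\<epsilon> \<le> \<delta>"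
  shows "hausdorff_pre d \<delta> A \<le> ennreal (card I * (unit_ball_vol (real d) * (\<epsilon> / 2) ^ d))"
proof -
  obtain e where e: "bij_betw e {..<card I} I"
    using ex_bij_betw_nat_finite[OF I] by (auto simp: atLeast0LessThan)
  \<comment> \<open>Padding by the empty set, whose summand is 0 since \<open>d > 0\<close>.\<close>
  define C where "C i = (if i < card I then D (e i) else {})" for i
  have eI: "e i \<in> I" if "i < card I" for i using e that by (auto simp: bij_betw_def)
  let ?c = "\<lambda>S::'a set. ennreal (unit_ball_vol (real d) * (diameter S / 2) ^ d)"
  have "A \<subseteq> (\<Union>i. C i)"
  proof
    fix x assume "x \<in> A"
    then obtain k where k: "k \<in> I" "x \<in> D k" using A by blast
    then obtain i where "i < card I" "k = e i" using e unfolding bij_betw_def by (metis imageE lessThan_iff)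
    then show "x \<in> (\<Union>i. C i)" using k by (auto simp: C_def intro!: exI[of _ i])
  qed
  moreover have "bounded (C i) \<and> diameter (C i) \<le> \<delta>" for i
    using D[OF eI] \<epsilon> by (force simp: C_def)
  ultimately have "hausdorff_pre d \<delta> A \<le> (\<Sum>i. ?c (C i))"
    unfolding hausdorff_pre_def by (intro INF_lower) auto
  also have "\<dots> = (\<Sum>i\<in>{..<card I}. ?c (C i))"
    by (rule suminf_finite) (use d in \<open>auto simp: C_def zero_power\<close>)
  also have "\<dots> \<le> (\<Sum>i\<in>{..<card I}. ennreal (unit_ball_vol (real d) * (\<epsilon> / 2) ^ d))"
  proof (intro sum_mono ennreal_leI mult_left_mono power_mono)
    fix i assume "i \<in> {..<card I}"
    then show "diameter (C i) / 2 \<le> \<epsilon> / 2" using D[OF eI] by (simp add: C_def)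
    have "bounded (C i)" using D[OF eI] \<open>i \<in> _\<close> by (simp add: C_def)
    then show "0 \<le> diameter (C i) / 2" using diameter_ge_0 by simp
  qed auto
  also have "\<dots> = ennreal (card I * (unit_ball_vol (real d) * (\<epsilon> / 2) ^ d))"
    using \<epsilon> by (subst sum_ennreal) (auto simp: ennreal_of_nat_eq_real_of_nat)
  finally show ?thesis .
qed

text \<open>Cutting the cube around the ball into \<open>N\<close> parts per axis gives
  \<open>N ^ m\<close> pieces whose images have diameter at most a constant over \<open>N\<close>.
  In the sum of \<open>m\<close>-th powers \<open>N\<close> cancels, so the bound survives refining
  \<open>\<delta>\<close> to 0.\<close>

lemma hausdorff_outer_lipschitz_image_le:
  fixes \<Gamma> :: "real ^ 'n \<Rightarrow> 'a::metric_space"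
  assumes lip: "\<And>y z. y \<in> ball y0 r \<Longrightarrow> z \<in> ball y0 r \<Longrightarrow> dist (\<Gamma> y) (\<Gamma> z) \<le> M * dist y z"
    and M: "0 \<le> M" and r: "0 < r"
  shows "hausdorff_outer CARD('n) (\<Gamma> ` ball y0 r)
    \<le> ennreal (unit_ball_vol (real CARD('n)) * (M * CARD('n) * r) ^ CARD('n))"
  unfolding hausdorff_outer_def
proof (rule SUP_least)
  fix \<delta> :: real assume "\<delta> \<in> {0<..}"
  then have \<delta>: "\<delta> > 0" by simp
  let ?m = "CARD('n)"
  define K where "K = M * ?m * (2 * r)"
  have K: "K \<ge> 0" using M r by (simp add: K_def)
  obtain N :: nat where N: "K / \<delta> < real N" using reals_Archimedean2 by blast
  have N0: "N > 0" using N K \<delta> by (cases N) (auto simp: divide_less_0_iff)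
  define \<epsilon> where "\<epsilon> = K / N"
  have \<epsilon>: "0 \<le> \<epsilon>" "\<epsilon> \<le> \<delta>" using N N0 K \<delta> by (auto simp: \<epsilon>_def field_simps)
  \<comment> \<open>Index of the grid cell of side \<open>2 r / N\<close>; the argument of the floor
    is nonnegative on the ball, so \<open>nat\<close> loses nothing.\<close>
  define cell where "cell y i = nat \<lfloor>(y $ i - y0 $ i + r) * N / (2 * r)\<rfloor>" for y i
  define I where "I = (UNIV :: 'n set) \<rightarrow>\<^sub>E {..<N}"
  define D where "D k = \<Gamma> ` {y \<in> ball y0 r. cell y = k}" for k
  have comp: "\<bar>y $ i - y0 $ i\<bar> < r" if "y \<in> ball y0 r" for y i
    using that component_le_norm_cart[of "y - y0" i] by (simp add: dist_norm norm_minus_commute)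
  have cellI: "cell y \<in> I" if "y \<in> ball y0 r" for y
  proof -
    have less: "(y $ i - y0 $ i + r) * N / (2 * r) < N" for i
    proof -
      have "y $ i - y0 $ i + r < 2 * r" using comp[OF that, of i] by linarith
      then have "(y $ i - y0 $ i + r) * N < 2 * r * N" using N0 by simp
      then show ?thesis using r by (simp add: pos_divide_less_eq mult.commute)
    qed
    have "cell y i < N" for i
    proof -
      have "\<lfloor>(y $ i - y0 $ i + r) * N / (2 * r)\<rfloor> < int N"
        using less[of i] by (subst floor_less_iff) simp
      then show ?thesis unfolding cell_def using N0 by linarith
    qed
    then show ?thesis by (auto simp: I_def PiE_def)
  qed
  have dist: "dist (\<Gamma> y) (\<Gamma> z) \<le> \<epsilon>" if yz: "y \<in> ball y0 r" "z \<in> ball y0 r" "cell y = cell z" for y z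
  proof -
    have "\<bar>(y - z) $ i\<bar> \<le> 2 * r / N" for i
    proof -
      define a b where "a = (y $ i - y0 $ i + r) * N / (2 * r)" and "b = (z $ i - y0 $ i + r) * N / (2 * r)"
      have "a \<ge> 0" "b \<ge> 0" unfolding a_def b_def using comp[OF yz(1), of i] comp[OF yz(2), of i] r
        by (auto intro!: divide_nonneg_nonneg mult_nonneg_nonneg)
      moreover have "cell y i = cell z i" using yz(3) by simp
      ultimately have "\<lfloor>a\<rfloor> = \<lfloor>b\<rfloor>" 
        unfolding cell_def a_def[symmetric] b_def[symmetric]
        by (subst eq_nat_nat_iff[symmetric]) simp_all
      then have "\<bar>a - b\<bar> \<le> 1" by linarith
      moreover have "a - b = (y - z) $ i * (N / (2 * r))" 
        unfolding a_def b_def diff_divide_distrib[symmetric] left_diff_distrib[symmetric] by simp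
      ultimately have "\<bar>(y - z) $ i\<bar> * (N / (2 * r)) \<le> 1"
        using r by (simp add: abs_mult)
      then show ?thesis using r N0 by (simp add: field_simps)
    qed
    then have "(\<Sum>i\<in>UNIV. \<bar>(y - z) $ i\<bar>) \<le> (\<Sum>i\<in>(UNIV::'n set). 2 * r / N)" by (rule sum_mono)
    then have "norm (y - z) \<le> ?m * (2 * r / N)" using norm_le_l1_cart[of "y - z"] by simp
    then have "M * dist y z \<le> M * (?m * (2 * r / N))" unfolding dist_norm by (rule mult_left_mono) (rule M)
    also have "\<dots> = \<epsilon>" by (simp add: \<epsilon>_def K_def)
    finally show ?thesis using lip[OF yz(1,2)] by linarith
  qed
  have "hausdorff_pre ?m \<delta> (\<Gamma> ` ball y0 r) \<le> ennreal (card I * (unit_ball_vol (real ?m) * (\<epsilon> / 2) ^ ?m))"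
  proof (rule hausdorff_pre_le_finite_cover[where D=D])
    show "finite I" by (auto simp: I_def intro: finite_PiE)
    show "\<Gamma> ` ball y0 r \<subseteq> (\<Union>k\<in>I. D k)"
    proof
      fix u assume "u \<in> \<Gamma> ` ball y0 r"
      then obtain y where y: "y \<in> ball y0 r" "u = \<Gamma> y" by blast
      then have "u \<in> D (cell y)" unfolding D_def by blast
      then show "u \<in> (\<Union>k\<in>I. D k)" using cellI[OF y(1)] by blast
    qed
    show "bounded (D k) \<and> diameter (D k) \<le> \<epsilon>" for k
    proof
      have d: "dist u v \<le> \<epsilon>" if "u \<in> D k" "v \<in> D k" for u v
        using that dist by (auto simp: D_def)
      show "bounded (D k)" by (rule bounded_two_points[THEN iffD2]) (use d in blast)
      show "diameter (D k) \<le> \<epsilon>" using d \<epsilon> by (auto simp: diameter_def intro!: cSUP_least)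
    qed
  qed (use \<epsilon> in auto)
  also have "card I * (unit_ball_vol (real ?m) * (\<epsilon> / 2) ^ ?m) = unit_ball_vol (real ?m) * (M * ?m * r) ^ ?m"
  proof -
    have "card I = N ^ ?m" by (simp add: I_def card_PiE)
    moreover have "real N ^ ?m * (\<epsilon> / 2) ^ ?m = (M * ?m * r) ^ ?m"
      using N0 by (simp add: \<epsilon>_def K_def mult.assoc flip: power_mult_distrib)
    ultimately show ?thesis by (simp add: mult.left_commute)
  qed
  finally show "hausdorff_pre ?m \<delta> (\<Gamma> ` ball y0 r) \<le> ennreal (unit_ball_vol (real ?m) * (M * ?m * r) ^ ?m)" .
qed

text \<open>Each covering set projects into a ball whose radius is its full diameter, while the
  Hausdorff sum counts half the diameter; this costs the factor \<open>2 ^ m\<close>, hence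
  \<open>r / 2\<close>. The single scale \<open>\<delta> = 1\<close> is enough because the outer
  measure is a supremum over scales.\<close>

lemma hausdorff_outer_ge_of_projection:
  fixes P :: "'a::metric_space \<Rightarrow> real ^ 'n"
  assumes lip: "\<And>x y. x \<in> A \<Longrightarrow> y \<in> A \<Longrightarrow> dist (P x) (P y) \<le> dist x y"
    and sub: "ball y0 r \<subseteq> P ` A" and r: "0 \<le> r"
  shows "ennreal (unit_ball_vol (real CARD('n)) * (r / 2) ^ CARD('n)) \<le> hausdorff_outer CARD('n) A"
proof -
  let ?m = "CARD('n)"
  let ?w = "unit_ball_vol (real ?m)"
  have w: "?w > 0" by simp
  have "ennreal (?w * (r / 2) ^ ?m) \<le> hausdorff_pre ?m 1 A"
    unfolding hausdorff_pre_def
  proof (rule INF_greatest)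
    fix C :: "nat \<Rightarrow> 'a set"
    assume "C \<in> {C. A \<subseteq> (\<Union>i. C i) \<and> (\<forall>i. bounded (C i) \<and> diameter (C i) \<le> 1)}"
    then have C: "A \<subseteq> (\<Union>i. C i)" "\<And>i. bounded (C i)" by auto
    \<comment> \<open>Where \<open>C i\<close> misses \<open>A\<close> the centre is arbitrary; the
      volume of the ball is the one already accounted for.\<close>
    define B where "B i = cball (P (SOME x. x \<in> C i \<inter> A)) (diameter (C i))" for i
    have "P x \<in> B i" if "x \<in> C i \<inter> A" for x i
    proof -
      have s: "(SOME x. x \<in> C i \<inter> A) \<in> C i \<inter> A" using that by (rule someI)
      then have "dist (P (SOME x. x \<in> C i \<inter> A)) (P x) \<le> dist (SOME x. x \<in> C i \<inter> A) x"
        using that by (intro lip) auto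
      also have "\<dots> \<le> diameter (C i)" using s that C(2) by (intro diameter_bounded_bound) auto
      finally show ?thesis by (simp add: B_def)
    qed
    note PB = this
    have cover: "ball y0 r \<subseteq> (\<Union>i. B i)"
    proof
      fix y assume "y \<in> ball y0 r"
      then obtain x where x: "x \<in> A" "y = P x" using sub by blast
      then obtain i where "x \<in> C i" using C(1) by blast
      then have "y \<in> B i" using PB[of x i] x by simp
      then show "y \<in> (\<Union>i. B i)" by blast
    qed
    have B: "B i \<in> sets lborel" for i by (simp add: B_def)
    have "ennreal (?w * r ^ ?m) = emeasure lborel (ball y0 r)"
      using emeasure_ball[OF r, of y0] by simp
    also have "\<dots> \<le> emeasure lborel (\<Union>i. B i)" by (rule emeasure_mono[OF cover]) (use B in auto)
    also have "\<dots> \<le> (\<Sum>i. emeasure lborel (B i))" by (rule emeasure_subadditive_countably) (use B in auto)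
    also have "\<dots> = (\<Sum>i. ennreal (2 ^ ?m) * ennreal (?w * (diameter (C i) / 2) ^ ?m))"
    proof (rule suminf_cong)
      fix i
      have "emeasure lborel (B i) = ennreal (?w * diameter (C i) ^ ?m)"
        unfolding B_def using emeasure_cball[OF diameter_ge_0[OF C(2)[of i]], of "P (SOME x. x \<in> C i \<inter> A)"] by simp
      also have "?w * diameter (C i) ^ ?m = 2 ^ ?m * (?w * (diameter (C i) / 2) ^ ?m)"
        by (simp add: power_divide)
      also have "ennreal \<dots> = ennreal (2 ^ ?m) * ennreal (?w * (diameter (C i) / 2) ^ ?m)"
        by (rule ennreal_mult') simp
      finally show "emeasure lborel (B i) = ennreal (2 ^ ?m) * ennreal (?w * (diameter (C i) / 2) ^ ?m)" .
    qed
    finally have "ennreal (?w * r ^ ?m) \<le> ennreal (2 ^ ?m) * (\<Sum>i. ennreal (?w * (diameter (C i) / 2) ^ ?m))"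
      by simp
    then have "ennreal (1 / 2 ^ ?m) * ennreal (?w * r ^ ?m)
        \<le> ennreal (1 / 2 ^ ?m) * (ennreal (2 ^ ?m) * (\<Sum>i. ennreal (?w * (diameter (C i) / 2) ^ ?m)))"
      by (rule mult_left_mono) simp
    moreover have "ennreal (1 / 2 ^ ?m) * ennreal (2 ^ ?m) = 1" by (simp flip: ennreal_mult)
    moreover have "ennreal (1 / 2 ^ ?m) * ennreal (?w * r ^ ?m) = ennreal (?w * (r / 2) ^ ?m)"
      by (simp add: power_divide flip: ennreal_mult')
    ultimately show "ennreal (?w * (r / 2) ^ ?m) \<le> (\<Sum>i. ennreal (?w * (diameter (C i) / 2) ^ ?m))"
      by (simp flip: mult.assoc)
  qed
  also have "\<dots> \<le> hausdorff_outer ?m A" unfolding hausdorff_outer_def by (rule SUP_upper) simp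
  finally show ?thesis .
qed

section \<open>Uniform Lipschitz graph charts\<close>

definition lipschitz_chart :: "'n::finite paravector set \<Rightarrow> 'n paravector \<Rightarrow> real \<Rightarrow> real \<Rightarrow> bool" where
  "lipschitz_chart G q R L \<longleftrightarrow> (\<exists>(T :: 'n paravector \<Rightarrow> 'n paravector) \<gamma>.
     orthogonal_transformation T \<and> continuous_on UNIV \<gamma> \<and>
     (\<forall>y\<in>ball (snd (T q)) R. \<forall>z\<in>ball (snd (T q)) R. \<bar>\<gamma> y - \<gamma> z\<bar> \<le> L * dist y z) \<and>
     (\<forall>x\<in>ball q R. x \<in> G \<longleftrightarrow> \<gamma> (snd (T x)) < fst (T x)))"

lemma orthogonal_transformation_dist:
  fixes T :: "'a::real_inner \<Rightarrow> 'a"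
  assumes "orthogonal_transformation T"
  shows "dist (T x) (T y) = dist x y"
proof -
  have "T x - T y = T (x - y)"
    using orthogonal_transformation_linear[OF assms] by (simp add: linear_diff)
  then show ?thesis by (simp add: dist_norm orthogonal_transformation_norm[OF assms])
qed

lemma lipschitz_chart_mono:
  fixes G :: "'n::finite paravector set"
  assumes c: "lipschitz_chart G p R L" and q: "dist p q + R' \<le> R" and L: "L \<le> L'"
  shows "lipschitz_chart G q R' L'"
proof -
  obtain T \<gamma> where T: "orthogonal_transformation (T :: 'n paravector \<Rightarrow> 'n paravector)" and \<gamma>: "continuous_on UNIV \<gamma>"
    and lip: "\<forall>y\<in>ball (snd (T p)) R. \<forall>z\<in>ball (snd (T p)) R. \<bar>\<gamma> y - \<gamma> z\<bar> \<le> L * dist y z"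
    and G: "\<forall>x\<in>ball p R. x \<in> G \<longleftrightarrow> \<gamma> (snd (T x)) < fst (T x)"
    using c unfolding lipschitz_chart_def by (elim exE conjE) (erule (3) that)
  have "dist (snd (T p)) (snd (T q)) \<le> dist p q"
    using dist_snd_le[of "T p" "T q"] orthogonal_transformation_dist[OF T] by simp
  then have "dist (snd (T p)) (snd (T q)) + R' \<le> R" using q by linarith
  then have sub: "ball (snd (T q)) R' \<subseteq> ball (snd (T p)) R"
    by (simp add: ball_subset_ball_iff dist_commute)
  have "ball q R' \<subseteq> ball p R" using q by (simp add: ball_subset_ball_iff dist_commute)
  moreover have "\<bar>\<gamma> y - \<gamma> z\<bar> \<le> L' * dist y z" if "y \<in> ball (snd (T q)) R'" "z \<in> ball (snd (T q)) R'" for y z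
  proof -
    have "\<bar>\<gamma> y - \<gamma> z\<bar> \<le> L * dist y z" using lip that sub by blast
    also have "\<dots> \<le> L' * dist y z" using L by (rule mult_right_mono) simp
    finally show ?thesis .
  qed
  ultimately show ?thesis unfolding lipschitz_chart_def using T \<gamma> G by blast
qed

text \<open>The derivative of the graph function is continuous, hence bounded on the compact ball of
  radius \<open>R\<close>; the mean value inequality turns the bound into a Lipschitz
  constant.\<close>

lemma C2_boundary_chart:
  fixes G :: "'n::finite paravector set"
  assumes "C2_boundary G" "p \<in> frontier G"
  obtains R L where "0 < R" "0 \<le> L" "lipschitz_chart G p R L"
proof -
  obtain U T \<gamma> where U: "open U" "p \<in> U" and T: "orthogonal_transformation (T :: 'n paravector \<Rightarrow> 'n paravector)"
    and \<gamma>: "C2_function \<gamma>" and GU: "G \<inter> U = {x \<in> U. fst (T x) > \<gamma> (snd (T x))}"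
    using assms(1)[unfolded C2_boundary_def, rule_format, OF assms(2)]
    by (elim exE conjE) (erule (4) that)
  obtain \<gamma>' \<gamma>'' where d1: "\<And>x. (\<gamma> has_derivative blinfun_apply (\<gamma>' x)) (at x)"
    and d2: "\<And>x. (\<gamma>' has_derivative blinfun_apply (\<gamma>'' x)) (at x)"
    using \<gamma> unfolding C2_function_def by (elim exE conjE) (rule that; blast)
  obtain R where R: "R > 0" "ball p R \<subseteq> U" using U open_contains_ball by blast
  have c1: "continuous_on UNIV \<gamma>"
    by (rule continuous_at_imp_continuous_on) (simp add: has_derivative_continuous[OF d1])
  have c2: "continuous_on UNIV \<gamma>'"
    by (rule continuous_at_imp_continuous_on) (simp add: has_derivative_continuous[OF d2])
  have "compact (\<gamma>' ` cball (snd (T p)) R)"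
    by (intro compact_continuous_image compact_cball continuous_on_subset[OF c2]) simp
  then have "\<exists>L>0. \<forall>u\<in>\<gamma>' ` cball (snd (T p)) R. norm u \<le> L"
    unfolding bounded_pos[symmetric] by (rule compact_imp_bounded)
  then obtain L where L: "L > 0" "\<And>y. y \<in> cball (snd (T p)) R \<Longrightarrow> norm (\<gamma>' y) \<le> L"
    by (metis imageI)
  have "\<bar>\<gamma> y - \<gamma> z\<bar> \<le> L * dist y z" if "y \<in> ball (snd (T p)) R" "z \<in> ball (snd (T p)) R" for y z
  proof -
    have "norm (\<gamma> y - \<gamma> z) \<le> L * norm (y - z)"
    proof (rule differentiable_bound[of "ball (snd (T p)) R"])
      show "(\<gamma> has_derivative blinfun_apply (\<gamma>' x)) (at x within ball (snd (T p)) R)" for x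
        by (rule has_derivative_at_withinI[OF d1])
      show "onorm (blinfun_apply (\<gamma>' x)) \<le> L" if "x \<in> ball (snd (T p)) R" for x
        using L(2)[of x] that by (simp add: norm_blinfun.rep_eq)
    qed (use that in auto)
    then show ?thesis by (simp add: dist_norm)
  qed
  moreover have "x \<in> G \<longleftrightarrow> \<gamma> (snd (T x)) < fst (T x)" if "x \<in> ball p R" for x
    using that R(2) GU by blast
  ultimately have "lipschitz_chart G p R L"
    unfolding lipschitz_chart_def using T c1 by blast
  then show thesis using that R(1) L(1) by (metis less_imp_le)
qed

text \<open>Finitely many balls of half the chart radius cover the frontier, and a chart centred
  within \<open>R p / 2\<close> of \<open>q\<close> still covers the ball of radius
  \<open>R p / 2\<close> around \<open>q\<close>. Hence one radius and one Lipschitz constant serve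
  all points.\<close>

lemma C2_boundary_uniform_chart:
  assumes G: "C2_boundary G" "bounded G"
  obtains R L where "0 < R" "0 \<le> L" "\<And>q. q \<in> frontier G \<Longrightarrow> lipschitz_chart G q R L"
proof -
  have "\<exists>R L. 0 < R \<and> 0 \<le> L \<and> lipschitz_chart G p R L" if "p \<in> frontier G" for p
    using C2_boundary_chart[OF G(1) that] by metis
  then obtain R L where RL: "\<And>p. p \<in> frontier G \<Longrightarrow> 0 < R p \<and> 0 \<le> L p \<and> lipschitz_chart G p (R p) (L p)"
    by metis
  have "compact (frontier G)" using G(2) by (rule compact_frontier_bounded)
  then obtain P where P: "P \<subseteq> frontier G" "finite P" "frontier G \<subseteq> (\<Union>p\<in>P. ball p (R p / 2))"
  proof (rule compactE_image)
    show "open (ball p (R p / 2))" if "p \<in> frontier G" for p by simp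
    show "frontier G \<subseteq> (\<Union>p\<in>frontier G. ball p (R p / 2))"
    proof
      fix p assume "p \<in> frontier G"
      then show "p \<in> (\<Union>p\<in>frontier G. ball p (R p / 2))"
        using RL[of p] by (intro UN_I[of p]) auto
    qed
  qed blast
  define R0 where "R0 = Min (insert 1 ((\<lambda>p. R p / 2) ` P))"
  define L0 where "L0 = Max (insert 0 (L ` P))"
  have RP: "0 < R p" if "p \<in> P" for p using RL P(1) that by blast
  have R0: "0 < R0" using P(2) RP by (simp add: R0_def)
  have R0_le: "R0 \<le> R p / 2" if "p \<in> P" for p
    unfolding R0_def by (rule Min_le) (use P(2) that in auto)
  have L0: "0 \<le> L0" "\<And>p. p \<in> P \<Longrightarrow> L p \<le> L0"
    using P by (auto simp: L0_def)
  have "lipschitz_chart G q R0 L0" if q: "q \<in> frontier G" for q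
  proof -
    obtain p where p: "p \<in> P" "dist p q < R p / 2" using P(3) q by auto
    have "lipschitz_chart G p (R p) (L p)" using RL P(1) p(1) by blast
    then show ?thesis
      by (rule lipschitz_chart_mono) (use p R0_le[OF p(1)] L0(2)[OF p(1)] in auto)
  qed
  then show thesis using that R0 L0(1) by blast
qed

section \<open>Geometry of the frontier in a single chart\<close>

locale frontier_chart =
  fixes G :: "'n::finite paravector set" and q R L T \<gamma>
  assumes open_G: "open G" and q: "q \<in> frontier G" and R: "0 < R" and L: "0 \<le> L"
    and T: "orthogonal_transformation (T :: 'n paravector \<Rightarrow> 'n paravector)"
    and \<gamma>: "continuous_on UNIV \<gamma>"
    and lip: "\<And>y z. y \<in> ball (snd (T q)) R \<Longrightarrow> z \<in> ball (snd (T q)) R \<Longrightarrow> \<bar>\<gamma> y - \<gamma> z\<bar> \<le> L * dist y z"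
    and G: "\<And>x. x \<in> ball q R \<Longrightarrow> x \<in> G \<longleftrightarrow> \<gamma> (snd (T x)) < fst (T x)"
begin

definition T_inv where "T_inv = inv T"

lemma T_T_inv [simp]: "T (T_inv x) = x" and T_inv_T [simp]: "T_inv (T x) = x"
  using orthogonal_transformation_bij[OF T] by (simp_all add: T_inv_def bij_is_surj surj_f_inv_f bij_is_inj)

lemma dist_T: "dist (T x) (T y) = dist x y"
  by (rule orthogonal_transformation_dist[OF T])

lemma dist_T_inv: "dist (T_inv x) (T_inv y) = dist x y"
  using dist_T[of "T_inv x" "T_inv y"] by simp

text \<open>The sign of \<open>fst (T x) - \<gamma> (snd (T x))\<close> decides: the strict signs
  put \<open>x\<close> into \<open>G\<close> or into an open set disjoint from \<open>G\<close>, and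
  a zero is approached from \<open>G\<close> by moving along the first chart coordinate.\<close>

lemma frontier_iff:
  assumes x: "x \<in> ball q R"
  shows "x \<in> frontier G \<longleftrightarrow> fst (T x) = \<gamma> (snd (T x))"
proof -
  define u where "u x = fst (T x) - \<gamma> (snd (T x))" for x
  have cT: "continuous_on UNIV T"
    using orthogonal_transformation_linear[OF T] by (rule linear_continuous_on[OF linear_conv_bounded_linear[THEN iffD1]])
  have uc: "continuous_on UNIV u" unfolding u_def
    by (intro continuous_on_diff continuous_on_fst cT continuous_on_compose2[OF \<gamma>] continuous_on_snd) auto
  have notin: "x \<notin> frontier G" if "u x > 0"
  proof -
    have "x \<in> G" using that G[OF x] by (simp add: u_def)
    then show ?thesis using open_G by (simp add: frontier_def interior_open)
  qed
  have notin': "x \<notin> frontier G" if neg: "u x < 0"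
  proof -
    have "open {y. u y < 0}" by (intro open_Collect_less uc continuous_on_const)
    then have "open (ball q R \<inter> {y. u y < 0})" by (intro open_Int) auto
    moreover have "(ball q R \<inter> {y. u y < 0}) \<inter> G = {}" using G by (auto simp: u_def)
    ultimately have "(ball q R \<inter> {y. u y < 0}) \<inter> closure G = {}" by (simp add: open_Int_closure_eq_empty)
    then show ?thesis using neg x by (auto simp: frontier_def)
  qed
  have isin: "x \<in> frontier G" if zero: "u x = 0"
  proof -
    have "x \<notin> G" using zero G[OF x] by (simp add: u_def)
    moreover have "x \<in> closure G"
    proof (rule closure_approachable[THEN iffD2], intro allI impI)
      fix e :: real assume e: "0 < e"
      define d where "d = min e (R - dist q x) / 2"
      have d: "0 < d" "d < e" "d < R - dist q x" using e x by (auto simp: d_def min_def)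
      define y where "y = T_inv (T x + (d, 0))"
      have Ty: "T y = T x + (d, 0)" by (simp add: y_def)
      have dist: "dist y x = d" using dist_T[of y x] d(1) by (simp add: Ty dist_norm norm_Pair)
      have "dist q y < R" using dist d(3) dist_triangle[of q y x] by (simp add: dist_commute)
      moreover have "\<gamma> (snd (T y)) < fst (T y)" using zero d(1) by (simp add: Ty u_def)
      ultimately have "y \<in> G" using G by simp
      then show "\<exists>y\<in>G. dist y x < e" using dist d(2) by auto
    qed
    ultimately show ?thesis using open_G by (simp add: frontier_def interior_open)
  qed
  show ?thesis using notin notin' isin unfolding u_def by (metis diff_gt_0_iff_gt diff_less_0_iff_less
    eq_iff_diff_eq_0 linorder_neqE_linordered_idom)
qed

lemma q_graph: "fst (T q) = \<gamma> (snd (T q))"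
  using frontier_iff[of q] q R by simp

lemma snd_ball: "x \<in> ball q r \<Longrightarrow> snd (T x) \<in> ball (snd (T q)) r"
  using dist_snd_le[of "T q" "T x"] dist_T[of q x] by simp

text \<open>Move from \<open>q\<close> by \<open>t\<close> against the first chart coordinate. A
  frontier point at horizontal distance \<open>\<rho>\<close> lies at least
  \<open>t - L \<rho>\<close> above \<open>e\<close>, so its distance to \<open>e\<close> is at
  least the larger of this and \<open>\<rho>\<close>, and that maximum is at least
  \<open>t / (1 + L)\<close>. Frontier points outside the chart are at least
  \<open>R - t \<ge> t\<close> away.\<close>

lemma exterior_point:
  assumes t: "0 < t" "t \<le> R / 2"
  obtains e where "dist e q = t" "e \<notin> closure G" "\<And>w. w \<in> frontier G \<Longrightarrow> t / (1 + L) \<le> dist w e"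
proof -
  define e where "e = T_inv (T q - (t, 0))"
  have Te: "T e = T q - (t, 0)" by (simp add: e_def)
  have de: "dist e q = t" using dist_T[of e q] t(1) by (simp add: Te dist_norm norm_Pair)
  have tL: "t / (1 + L) \<le> t" using t(1) L by (simp add: field_simps)
  have far: "t / (1 + L) \<le> dist w e" if w: "w \<in> frontier G" for w
  proof (cases "w \<in> ball q R")
    case True
    define \<rho> where "\<rho> = dist (snd (T w)) (snd (T q))"
    have Tw: "fst (T w) = \<gamma> (snd (T w))" using frontier_iff[OF True] w by simp
    have "\<bar>\<gamma> (snd (T w)) - \<gamma> (snd (T q))\<bar> \<le> L * \<rho>" unfolding \<rho>_def
      by (rule lip) (use snd_ball[OF True] R in auto)
    moreover have "dist (fst (T w)) (fst (T e)) \<le> dist w e" "\<rho> \<le> dist w e"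
      using dist_fst_le[of "T w" "T e"] dist_snd_le[of "T w" "T e"] dist_T[of w e] by (auto simp: \<rho>_def Te)
    ultimately have "t - L * \<rho> \<le> dist w e" "\<rho> \<le> dist w e"
      using q_graph Tw by (auto simp: Te dist_real_def)
    moreover have "L * \<rho> \<le> L * dist w e" using \<open>\<rho> \<le> dist w e\<close> L by (rule mult_left_mono)
    ultimately have "t \<le> dist w e * (1 + L)" by (simp add: algebra_simps)
    then show ?thesis using L by (simp add: pos_divide_le_eq)
  next
    case False
    then have "R \<le> dist w e + t" using dist_triangle[of q w e] de by (simp add: dist_commute)
    then show ?thesis using t tL by linarith
  qed
  have "e \<in> ball q R" using de t by (simp add: dist_commute)
  then have "e \<notin> G" using G q_graph t by (simp add: Te)
  moreover have "e \<notin> frontier G" 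
  proof
    assume "e \<in> frontier G"
    from far[OF this] have "t / (1 + L) \<le> 0" by simp
    moreover have "0 < t / (1 + L)" using t(1) L by simp
    ultimately show False by linarith
  qed
  ultimately have "e \<notin> closure G" using open_G by (simp add: frontier_def interior_open)
  then show thesis using that de far by blast
qed

lemma hausdorff_frontier_ge:
  assumes r: "0 \<le> r" "r \<le> R"
  shows "ennreal (unit_ball_vol (real CARD('n)) * (r / (2 * (1 + L))) ^ CARD('n))
    \<le> hausdorff_outer CARD('n) (frontier G \<inter> ball q r)"
proof -
  \<comment> \<open>Over the smaller ball the graph stays within \<open>(1 + L) r' = r\<close> of
    \<open>q\<close>.\<close>
  define r' where "r' = r / (1 + L)"
  have r': "0 \<le> r'" "r' \<le> r" "(1 + L) * r' = r" using r L by (auto simp: r'_def field_simps)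
  have "ennreal (unit_ball_vol (real CARD('n)) * (r' / 2) ^ CARD('n))
      \<le> hausdorff_outer CARD('n) (frontier G \<inter> ball q r)"
  proof (rule hausdorff_outer_ge_of_projection[where P="\<lambda>x. snd (T x)"])
    show "dist (snd (T x)) (snd (T y)) \<le> dist x y" for x y
      using dist_snd_le[of "T x" "T y"] dist_T[of x y] by simp
    show "ball (snd (T q)) r' \<subseteq> (\<lambda>x. snd (T x)) ` (frontier G \<inter> ball q r)"
    proof
      fix y assume y: "y \<in> ball (snd (T q)) r'"
      define x where "x = T_inv (\<gamma> y, y)"
      have Tx: "T x = (\<gamma> y, y)" by (simp add: x_def)
      have rho: "dist y (snd (T q)) < r'" using y by (simp add: dist_commute)
      have "dist x q \<le> \<bar>\<gamma> y - \<gamma> (snd (T q))\<bar> + dist y (snd (T q))"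
      proof -
        have "dist x q = dist (T x) (T q)" by (simp add: dist_T)
        also have "\<dots> = norm (\<gamma> y - \<gamma> (snd (T q)), y - snd (T q))"
          using q_graph by (simp add: Tx dist_norm minus_prod_def)
        also have "\<dots> \<le> norm (\<gamma> y - \<gamma> (snd (T q))) + norm (y - snd (T q))" by (rule norm_Pair_le)
        finally show ?thesis by (simp add: dist_norm)
      qed
      also have "\<bar>\<gamma> y - \<gamma> (snd (T q))\<bar> \<le> L * dist y (snd (T q))"
        by (rule lip) (use y r' r R in auto)
      also have "L * dist y (snd (T q)) + dist y (snd (T q)) = (1 + L) * dist y (snd (T q))"
        by (simp add: algebra_simps)
      also have "\<dots> < (1 + L) * r'" using rho L by simp
      finally have "x \<in> ball q r" using r' by (simp add: dist_commute)
      moreover have "x \<in> frontier G" using frontier_iff[of x] \<open>x \<in> ball q r\<close> r by (simp add: Tx)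
      ultimately show "y \<in> (\<lambda>x. snd (T x)) ` (frontier G \<inter> ball q r)"
        by (intro image_eqI[of _ _ x]) (simp_all add: Tx)
    qed
  qed (use r' in auto)
  then show ?thesis by (simp add: r'_def field_simps)
qed

text \<open>In the chart this piece of the frontier is covered by the graph map, which is Lipschitz
  with constant \<open>1 + L\<close> since \<open>T\<close> is an isometry.\<close>

lemma hausdorff_frontier_le:
  assumes r: "0 < r" "r \<le> R"
  shows "hausdorff_outer CARD('n) (frontier G \<inter> ball q r)
    \<le> ennreal (unit_ball_vol (real CARD('n)) * ((1 + L) * CARD('n) * r) ^ CARD('n))"
proof -
  let ?\<Gamma> = "\<lambda>y. T_inv (\<gamma> y, y)"
  have "frontier G \<inter> ball q r \<subseteq> ?\<Gamma> ` ball (snd (T q)) r"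
  proof
    fix x assume x: "x \<in> frontier G \<inter> ball q r"
    then have "fst (T x) = \<gamma> (snd (T x))" using frontier_iff[of x] r by auto
    then have "x = ?\<Gamma> (snd (T x))" by (metis T_inv_T prod.collapse)
    moreover have "snd (T x) \<in> ball (snd (T q)) r" using x by (intro snd_ball) simp
    ultimately show "x \<in> ?\<Gamma> ` ball (snd (T q)) r" by (rule image_eqI)
  qed
  then have "hausdorff_outer CARD('n) (frontier G \<inter> ball q r)
      \<le> hausdorff_outer CARD('n) (?\<Gamma> ` ball (snd (T q)) r)" by (rule hausdorff_outer_mono)
  also have "\<dots> \<le> ennreal (unit_ball_vol (real CARD('n)) * ((1 + L) * CARD('n) * r) ^ CARD('n))"
  proof (rule hausdorff_outer_lipschitz_image_le)
    fix y z assume yz: "y \<in> ball (snd (T q)) r" "z \<in> ball (snd (T q)) r"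
    have "dist (?\<Gamma> y) (?\<Gamma> z) = norm (\<gamma> y - \<gamma> z, y - z)" unfolding dist_T_inv by (simp add: dist_norm)
    also have "\<dots> \<le> norm (\<gamma> y - \<gamma> z) + norm (y - z)" by (rule norm_Pair_le)
    also have "norm (\<gamma> y - \<gamma> z) \<le> L * dist y z" unfolding real_norm_def
      by (rule lip) (use yz r in auto)
    finally show "dist (?\<Gamma> y) (?\<Gamma> z) \<le> (1 + L) * dist y z" by (simp add: algebra_simps dist_norm)
  qed (use L r in auto)
  finally show ?thesis .
qed

end

lemma frontier_chart_exists:
  fixes G :: "'n::finite paravector set"
  assumes "open G" "q \<in> frontier G" "0 < R" "0 \<le> L" "lipschitz_chart G q R L"
  obtains T \<gamma> where "frontier_chart G q R L T \<gamma>"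
proof -
  obtain T \<gamma> where "orthogonal_transformation (T :: 'n paravector \<Rightarrow> 'n paravector)" "continuous_on UNIV \<gamma>"
    "\<forall>y\<in>ball (snd (T q)) R. \<forall>z\<in>ball (snd (T q)) R. \<bar>\<gamma> y - \<gamma> z\<bar> \<le> L * dist y z"
    "\<forall>x\<in>ball q R. x \<in> G \<longleftrightarrow> \<gamma> (snd (T x)) < fst (T x)"
    using assms(5) unfolding lipschitz_chart_def by (elim exE conjE) (erule (3) that)
  then have "frontier_chart G q R L T \<gamma>"
    unfolding frontier_chart_def using assms(1-4) by blast
  then show thesis by (rule that)
qed

section \<open>Bounds that hold uniformly along the frontier\<close>

theorem C2_boundary_exterior_points:
  fixes G :: "'n::finite paravector set"
  assumes G: "open G" "bounded G" "C2_boundary G"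
  obtains c t0 where "0 < c" "0 < t0"
    "\<And>q t. q \<in> frontier G \<Longrightarrow> 0 < t \<Longrightarrow> t \<le> t0 \<Longrightarrow>
      \<exists>e. dist e q = t \<and> e \<notin> closure G \<and> (\<forall>w\<in>frontier G. c * t \<le> dist w e)"
proof -
  obtain R L where RL: "0 < R" "0 \<le> L" "\<And>q. q \<in> frontier G \<Longrightarrow> lipschitz_chart G q R L"
    using C2_boundary_uniform_chart[OF G(3,2)] by metis
  have "\<exists>e. dist e q = t \<and> e \<notin> closure G \<and> (\<forall>w\<in>frontier G. 1 / (1 + L) * t \<le> dist w e)"
    if q: "q \<in> frontier G" and t: "0 < t" "t \<le> R / 2" for q t
  proof -
    obtain T \<gamma> where "frontier_chart G q R L T \<gamma>"
      using frontier_chart_exists[OF G(1) q RL(1,2) RL(3)[OF q]] by metis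
    then interpret frontier_chart G q R L T \<gamma> .
    obtain e where "dist e q = t" "e \<notin> closure G" "\<And>w. w \<in> frontier G \<Longrightarrow> t / (1 + L) \<le> dist w e"
      using exterior_point[OF t] by metis
    then show ?thesis by (intro exI[of _ e]) simp
  qed
  then show thesis using that[of "1 / (1 + L)" "R / 2"] RL by simp
qed

theorem C2_boundary_hausdorff_ge:
  fixes G :: "'n::finite paravector set"
  assumes G: "open G" "bounded G" "C2_boundary G"
  obtains c r0 where "0 < c" "0 < r0"
    "\<And>q r. q \<in> frontier G \<Longrightarrow> 0 < r \<Longrightarrow> r \<le> r0 \<Longrightarrow>
      ennreal (c * r ^ CARD('n)) \<le> hausdorff_outer CARD('n) (frontier G \<inter> ball q r)"
proof -
  obtain R L where RL: "0 < R" "0 \<le> L" "\<And>q. q \<in> frontier G \<Longrightarrow> lipschitz_chart G q R L"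
    using C2_boundary_uniform_chart[OF G(3,2)] by metis
  define c where "c = unit_ball_vol (real CARD('n)) * (1 / (2 * (1 + L))) ^ CARD('n)"
  have "ennreal (c * r ^ CARD('n)) \<le> hausdorff_outer CARD('n) (frontier G \<inter> ball q r)"
    if q: "q \<in> frontier G" and r: "0 < r" "r \<le> R" for q r
  proof -
    obtain T \<gamma> where "frontier_chart G q R L T \<gamma>"
      using frontier_chart_exists[OF G(1) q RL(1,2) RL(3)[OF q]] by metis
    then interpret frontier_chart G q R L T \<gamma> .
    show ?thesis
      using hausdorff_frontier_ge[of r] r by (simp add: c_def power_divide power_mult_distrib)
  qed
  moreover have "c > 0" using RL(2) by (simp add: c_def)
  ultimately show thesis using that RL(1) by blast
qed

text \<open>The centre is arbitrary: a ball that meets the frontier in \<open>q\<close> lies in the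
  ball of twice the radius around \<open>q\<close>. Radii beyond the chart scale are handled by the
  total measure, finite by compactness.\<close>

theorem C2_boundary_hausdorff_le:
  fixes G :: "'n::finite paravector set"
  assumes G: "open G" "bounded G" "C2_boundary G"
  obtains A where "0 < A"
    "\<And>x r. 0 < r \<Longrightarrow> hausdorff_outer CARD('n) (frontier G \<inter> ball x r) \<le> ennreal (A * r ^ CARD('n))"
    "hausdorff_outer CARD('n) (frontier G) \<le> ennreal A"
proof -
  let ?m = "CARD('n)"
  let ?H = "hausdorff_outer ?m"
  obtain R L where RL: "0 < R" "0 \<le> L" "\<And>q. q \<in> frontier G \<Longrightarrow> lipschitz_chart G q R L"
    using C2_boundary_uniform_chart[OF G(3,2)] by metis
  define A1 where "A1 = unit_ball_vol (real ?m) * ((1 + L) * ?m) ^ ?m"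
  have A1: "A1 > 0" using RL(2) by (simp add: A1_def)
  have loc: "?H (frontier G \<inter> ball q r) \<le> ennreal (A1 * r ^ ?m)"
    if q: "q \<in> frontier G" and r: "0 < r" "r \<le> R" for q r
  proof -
    obtain T \<gamma> where "frontier_chart G q R L T \<gamma>"
      using frontier_chart_exists[OF G(1) q RL(1,2) RL(3)[OF q]] by metis
    then interpret frontier_chart G q R L T \<gamma> .
    show ?thesis
      using hausdorff_frontier_le[of r] r by (simp add: A1_def power_mult_distrib mult.assoc)
  qed
  have "compact (frontier G)" using G(2) by (rule compact_frontier_bounded)
  then obtain P where P: "P \<subseteq> frontier G" "finite P" "frontier G \<subseteq> (\<Union>p\<in>P. ball p R)"
  proof (rule compactE_image)
    show "open (ball p R)" if "p \<in> frontier G" for p by simp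
    show "frontier G \<subseteq> (\<Union>p\<in>frontier G. ball p R)" using RL(1) by force
  qed blast
  have fin: "?H (\<Union>p\<in>Q. frontier G \<inter> ball p R) \<le> ennreal (card Q * (A1 * R ^ ?m))"
    if "finite Q" "Q \<subseteq> frontier G" for Q
    using that
  proof (induction Q rule: finite_induct)
    case empty
    then show ?case by (simp add: hausdorff_outer_empty)
  next
    case (insert p Q)
    have "?H (\<Union>p\<in>insert p Q. frontier G \<inter> ball p R)
        \<le> ?H (frontier G \<inter> ball p R) + ?H (\<Union>p\<in>Q. frontier G \<inter> ball p R)"
      unfolding UN_insert by (rule hausdorff_outer_Un) simp
    also have "\<dots> \<le> ennreal (A1 * R ^ ?m) + ennreal (card Q * (A1 * R ^ ?m))"
      using insert loc[of p R] RL(1) by (intro add_mono) auto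
    also have "\<dots> = ennreal (card (insert p Q) * (A1 * R ^ ?m))"
      using insert A1 RL(1) by (simp add: algebra_simps flip: ennreal_plus)
    finally show ?case .
  qed
  define A2 where "A2 = card P * (A1 * R ^ ?m)"
  have A2: "0 \<le> A2" using A1 RL(1) by (simp add: A2_def)
  have total: "?H (frontier G) \<le> ennreal A2"
  proof -
    have "?H (frontier G) \<le> ?H (\<Union>p\<in>P. frontier G \<inter> ball p R)"
      by (rule hausdorff_outer_mono) (use P(3) in blast)
    also have "\<dots> \<le> ennreal A2" unfolding A2_def by (rule fin[OF P(2,1)])
    finally show ?thesis .
  qed
  \<comment> \<open>One summand per case: doubled radius, large radii (where
    \<open>(2 / R * r) ^ m\<close> is at least 1), total measure.\<close>
  define A where "A = A1 * 2 ^ ?m + A2 * (2 / R) ^ ?m + A2"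
  have A: "A \<ge> A1 * 2 ^ ?m" "A \<ge> A2 * (2 / R) ^ ?m" "A \<ge> A2" "A > 0"
  proof -
    have "0 < A1 * 2 ^ ?m" "0 \<le> A2 * (2 / R) ^ ?m" using A1 A2 RL(1) by simp_all
    then show "A \<ge> A1 * 2 ^ ?m" "A \<ge> A2 * (2 / R) ^ ?m" "A \<ge> A2" "A > 0" using A2 by (auto simp: A_def)
  qed
  have "?H (frontier G \<inter> ball x r) \<le> ennreal (A * r ^ ?m)" if r: "0 < r" for x r
  proof (cases "frontier G \<inter> ball x r = {}")
    case True
    then show ?thesis by (simp add: hausdorff_outer_empty)
  next
    case False
    then obtain q where q: "q \<in> frontier G" "dist x q < r" by auto
    show ?thesis
    proof (cases "2 * r \<le> R")
      case True
      have "ball x r \<subseteq> ball q (2 * r)"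
      proof
        fix y assume "y \<in> ball x r"
        then show "y \<in> ball q (2 * r)" using q(2) dist_triangle[of q y x] by (simp add: dist_commute)
      qed
      then have "?H (frontier G \<inter> ball x r) \<le> ?H (frontier G \<inter> ball q (2 * r))"
        by (intro hausdorff_outer_mono) blast
      also have "\<dots> \<le> ennreal (A1 * (2 * r) ^ ?m)" by (rule loc[OF q(1)]) (use r True in auto)
      also have "\<dots> \<le> ennreal (A * r ^ ?m)"
      proof (rule ennreal_leI)
        have "A1 * (2 * r) ^ ?m = (A1 * 2 ^ ?m) * r ^ ?m" by (simp add: power_mult_distrib)
        also have "\<dots> \<le> A * r ^ ?m" using A(1) r by (intro mult_right_mono) auto
        finally show "A1 * (2 * r) ^ ?m \<le> A * r ^ ?m" .
      qed
      finally show ?thesis .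
    next
      case False
      have "?H (frontier G \<inter> ball x r) \<le> ?H (frontier G)" by (rule hausdorff_outer_mono) blast
      also have "\<dots> \<le> ennreal A2" by (rule total)
      also have "\<dots> \<le> ennreal (A * r ^ ?m)"
      proof (rule ennreal_leI)
        have "1 \<le> (2 / R * r) ^ ?m" using False RL(1) by (intro one_le_power) (simp add: field_simps)
        then have "A2 * 1 \<le> A2 * (2 / R * r) ^ ?m" using A2 by (rule mult_left_mono)
        also have "\<dots> = (A2 * (2 / R) ^ ?m) * r ^ ?m" by (simp add: power_mult_distrib power_divide)
        also have "\<dots> \<le> A * r ^ ?m" using A(2) r by (intro mult_right_mono) auto
        finally show "A2 \<le> A * r ^ ?m" by simp
      qed
      finally show ?thesis .
    qed
  qed
  moreover have "?H (frontier G) \<le> ennreal A" using total A(3) by (meson ennreal_leI order_trans)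
  ultimately show thesis using that A(4) by blast
qed

section \<open>The kernel as an extremal function and its lower bound\<close>

lemma sets_hausdorff_measure [simp]: "sets (hausdorff_measure d) = sets (borel :: 'a::metric_space measure)"
  unfolding hausdorff_measure_def
  by (subst sets_measure_of) (auto simp: sets.sigma_sets_eq[of borel, simplified])

lemma space_hausdorff_measure [simp]: "space (hausdorff_measure d) = UNIV"
  unfolding hausdorff_measure_def by (subst space_measure_of) auto

lemma space_surface_measure: "space (surface_measure G) = frontier G"
  by (simp add: surface_measure_def space_restrict_space)

lemma sets_surface_measure: "sets (surface_measure G) = sets (restrict_space borel (frontier G))"
  by (simp add: surface_measure_def sets_restrict_space)

lemma emeasure_surface_measure:
  fixes G :: "'n::finite paravector set"
  assumes "A \<in> sets borel" "A \<subseteq> frontier G"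
  shows "emeasure (surface_measure G) A = hausdorff_outer CARD('n) A"
  unfolding surface_measure_def
  using assms by (subst emeasure_restrict_space) (simp_all add: emeasure_hausdorff_measure)

lemma measurable_surface_measure: "borel_measurable (surface_measure G) = borel_measurable (restrict_space borel (frontier G))"
  by (rule measurable_cong_sets) (simp_all add: sets_surface_measure)

lemma continuous_on_surface_measurable:
  "continuous_on (frontier G) f \<Longrightarrow> f \<in> borel_measurable (surface_measure G)"
  unfolding measurable_surface_measure by (rule borel_measurable_continuous_on_restrict)

lemma surface_set_measurable: "A \<in> sets borel \<Longrightarrow> frontier G \<inter> A \<in> sets (surface_measure G)"
  unfolding sets_surface_measure sets_restrict_space by (rule imageI)

lemma finite_surface_measure:
  fixes G :: "'n::finite paravector set"
  assumes G: "open G" "bounded G" "C2_boundary G"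
  shows "finite_measure (surface_measure G)"
proof
  obtain A where "hausdorff_outer CARD('n) (frontier G) \<le> ennreal A"
    using C2_boundary_hausdorff_le[OF G] by metis
  then have "hausdorff_outer CARD('n) (frontier G) \<noteq> \<infinity>" by (auto simp: top_unique)
  then show "emeasure (surface_measure G) (space (surface_measure G)) \<noteq> \<infinity>"
    by (simp add: space_surface_measure emeasure_surface_measure)
qed

lemma integrable_surface_continuous:
  fixes G :: "'n::finite paravector set" and f :: "'n paravector \<Rightarrow> 'b::{banach,second_countable_topology}"
  assumes G: "open G" "bounded G" "C2_boundary G" and f: "continuous_on (frontier G) f"
  shows "integrable (surface_measure G) f"
proof -
  interpret finite_measure "surface_measure G" by (rule finite_surface_measure[OF G])
  have "compact (f ` frontier G)" using f G(2) by (intro compact_continuous_image compact_frontier_bounded)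
  then have "\<exists>B>0. \<forall>u\<in>f ` frontier G. norm u \<le> B"
    unfolding bounded_pos[symmetric] by (rule compact_imp_bounded)
  then obtain B where B: "\<And>w. w \<in> frontier G \<Longrightarrow> norm (f w) \<le> B" by (metis imageI)
  show ?thesis
    by (rule integrable_const_bound[of _ B])
      (auto intro!: AE_I2 B continuous_on_surface_measurable[OF f] simp: space_surface_measure)
qed

lemma cmult_bound:
  obtains B where "0 < B" "\<And>a b :: 'n::{finite,linorder} clifford. norm (a \<odot> b) \<le> B * norm a * norm b"
proof -
  obtain K where K: "0 < K" "\<And>a b :: 'n clifford. norm (a \<odot> b) \<le> norm a * norm b * K"
    using bounded_bilinear.pos_bounded[OF bounded_bilinear_cmult] by blast
  show thesis by (rule that[of K]) (use K in \<open>auto simp: mult.commute mult.left_commute\<close>)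
qed

lemma cmult_measurable:
  assumes "a \<in> borel_measurable M" "b \<in> borel_measurable M"
  shows "(\<lambda>w. a w \<odot> b w) \<in> borel_measurable M"
proof (rule borel_measurable_continuous_Pair[OF assms])
  show "continuous_on UNIV (\<lambda>x. fst x \<odot> snd x)"
    by (intro bounded_bilinear.continuous_on[OF bounded_bilinear_cmult] continuous_intros)
qed

lemma cconj_measurable: "a \<in> borel_measurable M \<Longrightarrow> (\<lambda>w. cconj (a w)) \<in> borel_measurable M"
  by (rule borel_measurable_continuous_on[OF linear_continuous_on[OF bounded_linear_cconj]])

lemma square_integrable_cmult:
  assumes a: "a \<in> borel_measurable M" "integrable M (\<lambda>w. (norm (a w))\<^sup>2)"
    and b: "b \<in> borel_measurable M" "integrable M (\<lambda>w. (norm (b w))\<^sup>2)"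
  shows "integrable M (\<lambda>w. a w \<odot> b w :: 'n::{finite,linorder} clifford)"
proof -
  obtain B where B: "0 < B" "\<And>a b :: 'n clifford. norm (a \<odot> b) \<le> B * norm a * norm b"
    using cmult_bound by metis
  have i: "integrable M (\<lambda>w. B * ((norm (a w))\<^sup>2 + (norm (b w))\<^sup>2))"
    by (intro integrable_mult_right Bochner_Integration.integrable_add a(2) b(2))
  show ?thesis
  proof (rule Bochner_Integration.integrable_bound[OF i cmult_measurable[OF a(1) b(1)]], rule AE_I2)
    fix w
    have "0 \<le> (norm (a w) - norm (b w))\<^sup>2" by simp
    moreover have "0 \<le> (norm (a w))\<^sup>2 + (norm (b w))\<^sup>2" by simp
    ultimately have "norm (a w) * norm (b w) \<le> (norm (a w))\<^sup>2 + (norm (b w))\<^sup>2"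
      unfolding power2_diff by linarith
    then have "B * norm (a w) * norm (b w) \<le> B * ((norm (a w))\<^sup>2 + (norm (b w))\<^sup>2)"
      using B(1) by simp
    then show "norm (a w \<odot> b w) \<le> norm (B * ((norm (a w))\<^sup>2 + (norm (b w))\<^sup>2))"
      using B(2)[of "a w" "b w"] B(1) by (simp add: order_trans)
  qed
qed

lemma bounded_linear_Sc: "bounded_linear Sc"
  unfolding Sc_def by (rule bounded_linear_vec_nth)

lemma Sc_cconj [simp]: "Sc (cconj a) = Sc a"
  by (simp add: Sc_def cconj_def)

lemma hardy_norm_eq:
  assumes "square_integrable G f"
  shows "hardy_norm G f = sqrt (\<integral>w. (norm (f w))\<^sup>2 \<partial>surface_measure G)"
proof -
  have "integrable (surface_measure G) (\<lambda>w. cconj (f w) \<odot> f w)"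
    using assms unfolding square_integrable_def
    by (intro square_integrable_cmult cconj_measurable) (simp_all add: norm_cconj)
  from integral_bounded_linear[OF bounded_linear_Sc this]
  show ?thesis by (simp add: hardy_norm_def hardy_inner_def Sc_cconj_cmult power2_norm_eq_inner)
qed

lemma hardy_generators_subset: "hardy_generators G \<subseteq> hardy_space G"
proof
  fix f assume f: "f \<in> hardy_generators G"
  have "hardy_norm G (\<lambda>w. f w - f w) = 0"
    by (simp add: hardy_norm_def hardy_inner_def cmult_simps Sc_def)
  then show "f \<in> hardy_space G"
    using f unfolding hardy_space_def by (auto simp: hardy_generators_def intro!: exI[of _ "\<lambda>_. f"])
qed

lemma left_monogenic_continuous_on:
  "left_monogenic G f \<Longrightarrow> continuous_on G f"
  by (intro differentiable_imp_continuous_on)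
    (auto simp: left_monogenic_def differentiable_on_def differentiable_at_withinI)

section \<open>The reproducing kernel as an extremal function\<close>

locale szego =
  fixes G :: "'n::{finite,linorder} paravector set"
    and K :: "'n paravector \<Rightarrow> 'n paravector \<Rightarrow> 'n clifford"
  assumes open_G: "open G" and bounded_G: "bounded G" and C2: "C2_boundary G"
    and K: "szego_kernel G K"
begin

abbreviation "M \<equiv> surface_measure G"

lemma hardy_space_sq:
  assumes "f \<in> hardy_space G"
  shows "f \<in> borel_measurable M" "integrable M (\<lambda>w. (norm (f w))\<^sup>2)"
  using assms by (auto simp: hardy_space_def square_integrable_def)

lemma kernel_hardy: "z \<in> G \<Longrightarrow> (\<lambda>w. cconj (K z w)) \<in> hardy_space G"
  using K by (auto simp: szego_kernel_def)

lemma reproducing: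
  assumes z: "z \<in> G" and f: "f \<in> hardy_space G"
  shows "Sc (f z) = (\<integral>w. cconj (K z w) \<bullet> f w \<partial>M)" "integrable M (\<lambda>w. cconj (K z w) \<bullet> f w)"
proof -
  have "(\<lambda>w. cconj (cconj (K z w))) \<in> borel_measurable M"
    by (rule cconj_measurable[OF hardy_space_sq(1)[OF kernel_hardy[OF z]]])
  then have i: "integrable M (\<lambda>w. K z w \<odot> f w)"
    using hardy_space_sq[OF kernel_hardy[OF z]] hardy_space_sq[OF f]
    by (intro square_integrable_cmult) (simp_all add: norm_cconj)
  have "f z = (\<integral>w. K z w \<odot> f w \<partial>M)" using K z f by (auto simp: szego_kernel_def)
  with integral_bounded_linear[OF bounded_linear_Sc i]
  show "Sc (f z) = (\<integral>w. cconj (K z w) \<bullet> f w \<partial>M)" by (simp add: Sc_cmult_cconj)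
  show "integrable M (\<lambda>w. cconj (K z w) \<bullet> f w)"
    using integrable_bounded_linear[OF bounded_linear_Sc i] by (simp add: Sc_cmult_cconj)
qed

lemma density_eq: "z \<in> G \<Longrightarrow> szego_density K z = (\<integral>w. (norm (cconj (K z w)))\<^sup>2 \<partial>M)"
  using reproducing(1)[OF _ kernel_hardy, of z z]
  by (simp add: szego_density_def power2_norm_eq_inner)

text \<open>Expand the square of \<open>norm (k - f)\<close> for the reproducing element
  \<open>k\<close> of \<open>z\<close>: the cross term integrates to \<open>2 Sc (f z)\<close>, the
  square of \<open>k\<close> to the density. With \<open>f\<close> not normalised the bound is
  affine in \<open>f z\<close>, hence continuous in \<open>z\<close> for fixed
  \<open>f\<close>.\<close>

lemma density_ge:
  assumes z: "z \<in> G" and f: "f \<in> hardy_space G"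
  shows "2 * Sc (f z) - (\<integral>w. (norm (f w))\<^sup>2 \<partial>M) \<le> szego_density K z"
proof -
  have "2 * Sc (f z) - (\<integral>w. (norm (f w))\<^sup>2 \<partial>M) = (\<integral>w. 2 * (cconj (K z w) \<bullet> f w) - (norm (f w))\<^sup>2 \<partial>M)"
    using reproducing[OF z f] hardy_space_sq[OF f]
    by (subst Bochner_Integration.integral_diff) auto
  also have "\<dots> \<le> (\<integral>w. (norm (cconj (K z w)))\<^sup>2 \<partial>M)"
  proof (rule integral_mono)
    show "integrable M (\<lambda>w. 2 * (cconj (K z w) \<bullet> f w) - (norm (f w))\<^sup>2)"
      using reproducing[OF z f] hardy_space_sq[OF f] by (intro Bochner_Integration.integrable_diff) auto
    show "integrable M (\<lambda>w. (norm (cconj (K z w)))\<^sup>2)"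
      by (rule hardy_space_sq(2)[OF kernel_hardy[OF z]])
    fix w
    have "0 \<le> (norm (cconj (K z w) - f w))\<^sup>2" by simp
    also have "\<dots> = (norm (cconj (K z w)))\<^sup>2 - 2 * (cconj (K z w) \<bullet> f w) + (norm (f w))\<^sup>2"
      unfolding power2_norm_eq_inner by (simp add: inner_diff_left inner_diff_right inner_commute)
    finally show "2 * (cconj (K z w) \<bullet> f w) - (norm (f w))\<^sup>2 \<le> (norm (cconj (K z w)))\<^sup>2" by simp
  qed
  finally show ?thesis by (simp add: density_eq[OF z])
qed

lemma density_lsc: "open {z \<in> G. a < szego_density K z}"
proof -
  define I where "I f = (\<integral>w. (norm (f w))\<^sup>2 \<partial>M)" for f :: "'n paravector \<Rightarrow> 'n clifford"
  have "{z \<in> G. a < szego_density K z} = (\<Union>f\<in>hardy_space G. {z \<in> G. a < 2 * Sc (f z) - I f})" (is "?L = ?R")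
  proof
    show "?R \<subseteq> ?L" unfolding I_def by (auto intro: less_le_trans[OF _ density_ge])
    show "?L \<subseteq> ?R"
    proof
      fix z assume z: "z \<in> ?L"
      \<comment> \<open>The supremum is attained: for the reproducing element the expression is
        twice the density minus the density.\<close>
      then have "2 * Sc (cconj (K z z)) - I (\<lambda>w. cconj (K z w)) = szego_density K z"
        using density_eq[of z] by (simp add: I_def szego_density_def)
      with z have "z \<in> {z' \<in> G. a < 2 * Sc (cconj (K z z')) - I (\<lambda>w. cconj (K z w))}" by simp
      then show "z \<in> ?R" using z by (intro UN_I[OF kernel_hardy[of z]]) simp_all
    qed
  qed
  moreover have "open {z \<in> G. a < 2 * Sc (f z) - I f}" if f: "f \<in> hardy_space G" for f
  proof -
    have "continuous_on G f" using f by (intro left_monogenic_continuous_on) (simp add: hardy_space_def)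
    then have c: "continuous_on G (\<lambda>z. 2 * Sc (f z) - I f)"
      by (intro continuous_intros bounded_linear.continuous_on[OF bounded_linear_Sc])
    have "open (G \<inter> (\<lambda>z. 2 * Sc (f z) - I f) -` {a<..})"
      by (rule continuous_open_preimage[OF c open_G open_greaterThan])
    moreover have "G \<inter> (\<lambda>z. 2 * Sc (f z) - I f) -` {a<..} = {z \<in> G. a < 2 * Sc (f z) - I f}" by auto
    ultimately show ?thesis by simp
  qed
  ultimately show ?thesis by (simp add: open_UN)
qed

end

section \<open>Test functions with an exterior pole\<close>

lemma real_dyadic_interval:
  fixes x :: real
  assumes "1 \<le> x"
  obtains j :: nat where "2 ^ j \<le> x" "x < 2 ^ Suc j"
proof -
  have "1 \<le> nat \<lfloor>x\<rfloor>" using assms by (simp add: le_nat_iff le_floor_iff)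
  then obtain j where j: "2 ^ j \<le> nat \<lfloor>x\<rfloor>" "nat \<lfloor>x\<rfloor> < 2 ^ (j + 1)"
    using ex_power_ivl1[of 2 "nat \<lfloor>x\<rfloor>"] by auto
  have fl: "real (nat \<lfloor>x\<rfloor>) \<le> x" "x < real (nat \<lfloor>x\<rfloor>) + 1" 
    using assms by (linarith, simp add: of_nat_nat)
  have "real (2 ^ j) \<le> real (nat \<lfloor>x\<rfloor>)" using j(1) by (simp only: of_nat_le_iff)
  then have "2 ^ j \<le> real (nat \<lfloor>x\<rfloor>)" by (simp only: of_nat_power of_nat_numeral)
  then have 1: "2 ^ j \<le> x" using fl(1) by linarith
  have "real (nat \<lfloor>x\<rfloor> + 1) \<le> real (2 ^ (j + 1))" using j(2) by (simp only: of_nat_le_iff)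
  then have "real (nat \<lfloor>x\<rfloor>) + 1 \<le> 2 ^ Suc j" by simp
  then have "x < 2 ^ Suc j" using fl(2) by linarith
  with 1 show thesis by (rule that)
qed

text \<open>Dyadic shells around \<open>e\<close>: shell \<open>j\<close> contributes at most
  \<open>A (2 ^ Suc j \<rho>) ^ m\<close> over \<open>(2 ^ j \<rho>) ^ (2 m)\<close>, that is
  \<open>2 ^ m A / \<rho> ^ m\<close> over \<open>2 ^ (j m)\<close>. Since \<open>m > 0\<close> the
  series is dominated by the geometric one with sum 2.\<close>

lemma nn_integral_inverse_power_le:
  fixes M :: "'a::metric_space measure" and e :: 'a
  assumes ball: "\<And>r. 0 < r \<Longrightarrow> space M \<inter> ball e r \<in> sets M \<and> emeasure M (space M \<inter> ball e r) \<le> ennreal (A * r ^ m)"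
    and A: "0 \<le> A" and m: "0 < m" and \<rho>: "0 < \<rho>" and far: "\<And>w. w \<in> space M \<Longrightarrow> \<rho> \<le> dist w e"
  shows "(\<integral>\<^sup>+w. ennreal (1 / dist w e ^ (2 * m)) \<partial>M) \<le> ennreal (2 ^ Suc m * A / \<rho> ^ m)"
proof -
  define B where "B j = space M \<inter> ball e (2 ^ Suc j * \<rho>)" for j
  have B: "B j \<in> sets M" "emeasure M (B j) \<le> ennreal (A * (2 ^ Suc j * \<rho>) ^ m)" for j
    using ball[of "2 ^ Suc j * \<rho>"] \<rho> by (auto simp: B_def)
  define c where "c j = 1 / (2 ^ j * \<rho>) ^ (2 * m)" for j :: nat
  have c: "c j \<ge> 0" for j using \<rho> by (simp add: c_def)
  have "(\<integral>\<^sup>+w. ennreal (1 / dist w e ^ (2 * m)) \<partial>M) \<le> (\<integral>\<^sup>+w. (\<Sum>j. ennreal (c j) * indicator (B j) w) \<partial>M)"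
  proof (rule nn_integral_mono)
    fix w assume w: "w \<in> space M"
    have pos: "0 < dist w e" using far[OF w] \<rho> by linarith
    have "1 \<le> dist w e / \<rho>" using far[OF w] \<rho> by simp
    then obtain j where "2 ^ j \<le> dist w e / \<rho>" "dist w e / \<rho> < 2 ^ Suc j" by (rule real_dyadic_interval)
    then have j: "2 ^ j * \<rho> \<le> dist w e" "dist w e < 2 ^ Suc j * \<rho>" using \<rho> by (simp_all add: field_simps)
    have "1 / dist w e ^ (2 * m) \<le> c j" unfolding c_def
      using j(1) \<rho> by (intro divide_left_mono power_mono mult_pos_pos zero_less_power) (auto simp: pos[simplified])
    then have "ennreal (1 / dist w e ^ (2 * m)) \<le> ennreal (c j) * indicator (B j) w"
      using w j(2) by (simp add: B_def dist_commute ennreal_leI)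
    also have "\<dots> = (\<Sum>i\<in>{j}. ennreal (c i) * indicator (B i) w)"
      by (subst sum.insert) simp_all
    also have "\<dots> \<le> (\<Sum>i. ennreal (c i) * indicator (B i) w)" by (rule sum_le_suminf) auto
    finally show "ennreal (1 / dist w e ^ (2 * m)) \<le> (\<Sum>j. ennreal (c j) * indicator (B j) w)" .
  qed
  also have "\<dots> = (\<Sum>j. \<integral>\<^sup>+w. ennreal (c j) * indicator (B j) w \<partial>M)"
    by (rule nn_integral_suminf) (use B(1) in measurable)
  also have "\<dots> = (\<Sum>j. ennreal (c j) * emeasure M (B j))"
    by (rule suminf_cong) (use B(1) in \<open>simp add: nn_integral_cmult_indicator\<close>)
  also have "\<dots> \<le> (\<Sum>j. ennreal (2 ^ m * A / \<rho> ^ m * (1/2) ^ j))"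
  proof (rule suminf_le)
    fix j
    have "ennreal (c j) * emeasure M (B j) \<le> ennreal (c j) * ennreal (A * (2 ^ Suc j * \<rho>) ^ m)"
      by (rule mult_left_mono[OF B(2)]) simp
    also have "\<dots> = ennreal (c j * (A * (2 ^ Suc j * \<rho>) ^ m))" using c by (simp add: ennreal_mult')
    also have "\<dots> \<le> ennreal (2 ^ m * A / \<rho> ^ m * (1/2) ^ j)"
    proof (rule ennreal_leI)
      define t where "t = (2::real) ^ j"
      have t: "t \<ge> 1" by (simp add: t_def)
      define T where "T = (t * \<rho>) ^ m"
      have T: "T > 0" using t \<rho> by (simp add: T_def)
      have "c j = 1 / (T * T)" by (simp add: c_def t_def T_def mult_2 power_add)
      moreover have "(2 ^ Suc j * \<rho>) ^ m = 2 ^ m * T"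
        unfolding T_def t_def by (simp add: power_mult_distrib)
      ultimately have "c j * (A * (2 ^ Suc j * \<rho>) ^ m) = 2 ^ m * A / T"
        using T by simp
      also have "\<dots> = 2 ^ m * A / \<rho> ^ m * (1 / t ^ m)"
        by (simp add: T_def power_mult_distrib mult.commute)
      also have "\<dots> \<le> 2 ^ m * A / \<rho> ^ m * (1 / t)"
      proof -
        have "t ^ 1 \<le> t ^ m" using t m by (intro power_increasing) auto
        then have "1 / t ^ m \<le> 1 / t" using t by (simp add: frac_le)
        then show ?thesis by (rule mult_left_mono) (use A \<rho> in simp)
      qed
      also have "1 / t = (1/2) ^ j" by (simp add: t_def power_divide)
      finally show "c j * (A * (2 ^ Suc j * \<rho>) ^ m) \<le> 2 ^ m * A / \<rho> ^ m * (1/2) ^ j" .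
    qed
    finally show "ennreal (c j) * emeasure M (B j) \<le> ennreal (2 ^ m * A / \<rho> ^ m * (1/2) ^ j)" .
  qed auto
  also have "\<dots> = ennreal (2 ^ m * A / \<rho> ^ m * 2)"
  proof (rule suminf_ennreal_eq)
    show "0 \<le> 2 ^ m * A / \<rho> ^ m * (1/2) ^ j" for j using A \<rho> by simp
    have "(\<lambda>j. (1/2::real) ^ j) sums 2" using geometric_sums[of "1/2::real"] by simp
    then show "(\<lambda>j. 2 ^ m * A / \<rho> ^ m * (1/2) ^ j) sums (2 ^ m * A / \<rho> ^ m * 2)" by (rule sums_mult)
  qed
  finally show ?thesis by (simp add: mult.commute mult.left_commute)
qed

text \<open>For \<open>a = 0\<close> the density in \<open>sum_cauchy_kernel_deriv\<close> vanishes,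
  and a constant factor on the right is not touched by the Dirac operator acting from the
  left.\<close>

lemma cauchy_kernel_monogenic:
  fixes e :: "'n::{finite,linorder} paravector"
  assumes e: "e \<notin> closure G"
  shows "left_monogenic G (\<lambda>w. cauchy_kernel 0 (w - e) \<odot> y)"
    and "continuous_on (closure G) (\<lambda>w. cauchy_kernel 0 (w - e) \<odot> y)"
proof -
  have d: "((\<lambda>w. cauchy_kernel 0 (w - e) \<odot> y) has_derivative (\<lambda>v. cauchy_kernel_deriv 0 (w - e) v \<odot> y)) (at w)"
    if "w \<noteq> e" for w
  proof -
    have "0 < (norm (w - e))\<^sup>2 + 0" using that by simp
    from cauchy_kernel_has_derivative[OF this]
    have "(cauchy_kernel 0 has_derivative cauchy_kernel_deriv 0 (w - e)) (at (w - e))" .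
    moreover have "((\<lambda>w. w - e) has_derivative (\<lambda>v. v)) (at w)"
      by (auto intro!: derivative_eq_intros)
    ultimately have "((\<lambda>w. cauchy_kernel 0 (w - e)) has_derivative (\<lambda>v. cauchy_kernel_deriv 0 (w - e) v)) (at w)"
      by (rule has_derivative_compose[rotated])
    then show ?thesis
      by (rule bounded_linear.has_derivative[OF bounded_bilinear.bounded_linear_left[OF bounded_bilinear_cmult]])
  qed
  have "dirac (\<lambda>w. cauchy_kernel 0 (w - e) \<odot> y) w = 0" if "w \<noteq> e" for w
  proof -
    have "frechet_derivative (\<lambda>w. cauchy_kernel 0 (w - e) \<odot> y) (at w) = (\<lambda>v. cauchy_kernel_deriv 0 (w - e) v \<odot> y)"
      using frechet_derivative_at[OF d[OF that]] by simp
    then have "dirac (\<lambda>w. cauchy_kernel 0 (w - e) \<odot> y) w = (\<Sum>b\<in>Basis. paravec b \<odot> cauchy_kernel_deriv 0 (w - e) b) \<odot> y"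
      unfolding dirac_eq by (simp add: cmult_simps cmult_assoc)
    also have "(\<Sum>b\<in>Basis. paravec b \<odot> cauchy_kernel_deriv 0 (w - e) b) = 0"
      by (subst sum_cauchy_kernel_deriv(2)) (use that in \<open>auto simp: cauchy_density_def\<close>)
    finally show ?thesis by (simp add: cmult_simps)
  qed
  moreover have "w \<noteq> e" if "w \<in> G" for w using that e closure_subset by blast
  ultimately show "left_monogenic G (\<lambda>w. cauchy_kernel 0 (w - e) \<odot> y)"
    unfolding left_monogenic_def using d differentiable_def by blast
  show "continuous_on (closure G) (\<lambda>w. cauchy_kernel 0 (w - e) \<odot> y)"
  proof (rule continuous_at_imp_continuous_on, rule ballI)
    fix w assume "w \<in> closure G"
    then have "w \<noteq> e" using e by blast
    then show "isCont (\<lambda>w. cauchy_kernel 0 (w - e) \<odot> y) w" by (rule has_derivative_continuous[OF d])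
  qed
qed

lemma powr_square_half: "0 < r \<Longrightarrow> (r\<^sup>2) powr (- (real n / 2)) = 1 / r ^ n"
proof -
  assume r: "0 < r"
  then have "(r\<^sup>2) powr (- (real n / 2)) = (r powr 2) powr (- (real n / 2))" by (simp add: powr_numeral)
  also have "\<dots> = r powr (- real n)" by (simp add: powr_powr)
  also have "\<dots> = 1 / r ^ n" using r by (simp add: powr_minus powr_realpow divide_inverse)
  finally show ?thesis .
qed

lemma norm_cauchy_kernel_0:
  fixes x :: "'n::{finite,linorder} paravector"
  assumes "x \<noteq> 0"
  shows "norm (cauchy_kernel 0 x) = 1 / norm x ^ CARD('n)"
  using assms powr_square_half[of "norm x" "DIM('n paravector)"]
  by (simp add: norm_cauchy_kernel)

lemma Sc_cauchy_kernel_0: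
  fixes x :: "'n::{finite,linorder} paravector"
  assumes "x \<noteq> 0"
  shows "Sc (cauchy_kernel 0 x \<odot> paravec ((s / norm x) *\<^sub>R x)) = s / norm x ^ CARD('n)"
proof -
  have "(norm x)\<^sup>2 powr (- (real DIM('n paravector) / 2)) = 1 / norm x ^ Suc CARD('n)"
    using assms powr_square_half[of "norm x" "DIM('n paravector)"] by simp
  then have "cauchy_kernel 0 x \<odot> paravec ((s / norm x) *\<^sub>R x)
      = (1 / norm x ^ Suc CARD('n) * (s / norm x) * (norm x)\<^sup>2) *\<^sub>R blade {}"
    by (simp only: cauchy_kernel_def add_0_right linear_cmul[OF linear_paravec] cmult_simps
        cconj_paravec_mult scaleR_scaleR mult_ac)
  also have "1 / norm x ^ Suc CARD('n) * (s / norm x) * (norm x)\<^sup>2 = s / norm x ^ CARD('n)"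
    using assms by (simp add: power2_eq_square)
  finally show ?thesis by (simp add: Sc_def blade_nth)
qed

context szego
begin

lemma density_ge_exterior:
  assumes z: "z \<in> G" and e: "e \<notin> closure G" and \<rho>: "0 < \<rho>" "\<And>w. w \<in> frontier G \<Longrightarrow> \<rho> \<le> dist w e"
    and A: "0 < A" "\<And>x r. 0 < r \<Longrightarrow> hausdorff_outer CARD('n) (frontier G \<inter> ball x r) \<le> ennreal (A * r ^ CARD('n))"
    and B: "0 < B" "\<And>a b :: 'n clifford. norm (a \<odot> b) \<le> B * norm a * norm b"
  shows "\<rho> ^ CARD('n) / (2 ^ Suc CARD('n) * A * B\<^sup>2 * dist z e ^ (2 * CARD('n))) \<le> szego_density K z"
proof -
  let ?m = "CARD('n)"
  define x where "x = z - e"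
  have x: "x \<noteq> 0" using z e closure_subset by (auto simp: x_def)
  define Q where "Q = 2 ^ Suc ?m * A / \<rho> ^ ?m"
  have Q: "Q > 0" using A(1) \<rho>(1) by (simp add: Q_def)
  define a where "a = 1 / norm x ^ ?m"
  \<comment> \<open>Maximises \<open>2 s a - (B s)^2 Q\<close>, the bound from
    \<open>density_ge\<close> as a function of the scale of the test function; the maximum is
    \<open>s a\<close>.\<close>
  define s where "s = a / (B\<^sup>2 * Q)"
  have s: "s > 0" using x Q B(1) by (simp add: s_def a_def)
  \<comment> \<open>The constant factor on the right turns the value of the Cauchy kernel at
    \<open>z\<close> into the positive scalar \<open>s a\<close>.\<close>
  define f where "f w = cauchy_kernel 0 (w - e) \<odot> paravec ((s / norm x) *\<^sub>R x)" for w
  have fc: "continuous_on (closure G) f" and fm: "left_monogenic G f"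
    unfolding f_def using cauchy_kernel_monogenic[OF e] by auto
  have fcF: "continuous_on (frontier G) f" using fc by (rule continuous_on_subset) (simp add: frontier_def)
  have fi: "integrable M (\<lambda>w. (norm (f w))\<^sup>2)"
    by (intro integrable_surface_continuous[OF open_G bounded_G C2] continuous_intros fcF)
  have "f \<in> hardy_generators G"
    unfolding hardy_generators_def square_integrable_def
    using fc fm fi continuous_on_surface_measurable[OF fcF] by simp
  then have fh: "f \<in> hardy_space G" using hardy_generators_subset by blast
  have np: "norm (paravec ((s / norm x) *\<^sub>R x)) = s" using s x by (simp add: norm_paravec)
  have "(norm (f w))\<^sup>2 \<le> (B * s)\<^sup>2 * (1 / dist w e ^ (2 * ?m))" if w: "w \<in> frontier G" for w
  proof -
    have "w \<noteq> e" using \<rho>(2)[OF w] \<rho>(1) by auto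
    then have "norm (f w) \<le> B * (1 / dist w e ^ ?m) * s"
      using B(2)[of "cauchy_kernel 0 (w - e)" "paravec ((s / norm x) *\<^sub>R x)"]
      unfolding f_def np by (simp add: norm_cauchy_kernel_0 dist_norm)
    then have "(norm (f w))\<^sup>2 \<le> (B * (1 / dist w e ^ ?m) * s)\<^sup>2" by (rule power_mono) simp
    also have "\<dots> = (B * s)\<^sup>2 * (1 / dist w e ^ (2 * ?m))"
      by (simp add: power_mult_distrib power_divide power_mult[symmetric] mult.commute[of 2])
    finally show ?thesis .
  qed
  then have "(\<integral>\<^sup>+w. ennreal ((norm (f w))\<^sup>2) \<partial>M) \<le> (\<integral>\<^sup>+w. ennreal ((B * s)\<^sup>2) * ennreal (1 / dist w e ^ (2 * ?m)) \<partial>M)"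
    by (intro nn_integral_mono) (simp add: space_surface_measure ennreal_mult'[symmetric] ennreal_leI)
  also have "\<dots> = ennreal ((B * s)\<^sup>2) * (\<integral>\<^sup>+w. ennreal (1 / dist w e ^ (2 * ?m)) \<partial>M)"
  proof (rule nn_integral_cmult)
    have "w \<noteq> e" if "w \<in> frontier G" for w using \<rho>(2)[OF that] \<rho>(1) by auto
    then have "continuous_on (frontier G) (\<lambda>w. 1 / dist w e ^ (2 * ?m))"
      by (intro continuous_intros) auto
    from continuous_on_surface_measurable[OF this]
    show "(\<lambda>w. ennreal (1 / dist w e ^ (2 * ?m))) \<in> borel_measurable M" by simp
  qed
  also have "\<dots> \<le> ennreal ((B * s)\<^sup>2) * ennreal Q"
  proof (rule mult_left_mono)
    show "(\<integral>\<^sup>+w. ennreal (1 / dist w e ^ (2 * ?m)) \<partial>M) \<le> ennreal Q"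
      unfolding Q_def
    proof (rule nn_integral_inverse_power_le)
      fix r :: real assume "0 < r"
      then show "space M \<inter> ball e r \<in> sets M \<and> emeasure M (space M \<inter> ball e r) \<le> ennreal (A * r ^ ?m)"
        using A(2)[of r e] surface_set_measurable[of "ball e r" G]
        by (simp add: space_surface_measure emeasure_surface_measure)
    qed (use A(1) \<rho> in \<open>auto simp: space_surface_measure\<close>)
  qed simp
  finally have "ennreal (\<integral>w. (norm (f w))\<^sup>2 \<partial>M) \<le> ennreal ((B * s)\<^sup>2 * Q)"
    using Q by (simp add: nn_integral_eq_integral[OF fi] ennreal_mult')
  then have "(\<integral>w. (norm (f w))\<^sup>2 \<partial>M) \<le> (B * s)\<^sup>2 * Q" using Q by (simp add: ennreal_le_iff)
  moreover have "Sc (f z) = s * a"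
    using Sc_cauchy_kernel_0[OF x, of s] by (simp add: f_def x_def[symmetric] a_def)
  ultimately have "2 * (s * a) - (B * s)\<^sup>2 * Q \<le> szego_density K z"
    using density_ge[OF z fh] by linarith
  moreover have "(B * s)\<^sup>2 * Q = s * a"
    using B(1) Q by (simp add: s_def power2_eq_square)
  ultimately have "s * a \<le> szego_density K z" by linarith
  moreover have "s * a = \<rho> ^ ?m / (2 ^ Suc ?m * A * B\<^sup>2 * dist z e ^ (2 * ?m))"
  proof -
    have alg: "(1 / N) / (b * (X / r)) = r / (X * b * N)" if "0 < N" "0 < b" "0 < X" "0 < r" for N b X r :: real
      using that by (simp add: field_simps)
    have aa: "a * a = 1 / dist z e ^ (2 * ?m)" by (simp add: a_def x_def dist_norm mult_2 power_add)
    have "s * a = (a * a) / (B\<^sup>2 * Q)" by (simp add: s_def)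
    also have "\<dots> = (1 / dist z e ^ (2 * ?m)) / (B\<^sup>2 * (2 ^ Suc ?m * A / \<rho> ^ ?m))"
      unfolding aa Q_def ..
    also have "\<dots> = \<rho> ^ ?m / (2 ^ Suc ?m * A * B\<^sup>2 * dist z e ^ (2 * ?m))"
      by (rule alg) (use x A(1) B(1) \<rho>(1) in \<open>simp_all add: x_def\<close>)
    finally show ?thesis .
  qed
  ultimately show ?thesis by simp
qed

theorem density_lower:
  obtains c where "0 < c" "\<And>z. z \<in> G \<Longrightarrow> c \<le> szego_density K z * infdist z (frontier G)"
    "\<And>z. z \<in> G \<Longrightarrow> c \<le> szego_density K z"
proof (cases "G = {}")
  case True
  then show thesis using that[of 1] by simp
next
  case False
  let ?m = "CARD('n)" and ?F = "frontier G"
  have "G \<noteq> UNIV" using bounded_G not_bounded_UNIV by blast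
  then have F: "?F \<noteq> {}" "closed ?F" using False by (auto simp: frontier_eq_empty)
  obtain A where A: "0 < A" "\<And>x r. 0 < r \<Longrightarrow> hausdorff_outer ?m (?F \<inter> ball x r) \<le> ennreal (A * r ^ ?m)"
    using C2_boundary_hausdorff_le[OF open_G bounded_G C2] by metis
  obtain B where B: "0 < B" "\<And>a b :: 'n clifford. norm (a \<odot> b) \<le> B * norm a * norm b"
    using cmult_bound by metis
  obtain c0 t0 where c0: "0 < c0" "0 < t0"
    "\<And>q t. q \<in> ?F \<Longrightarrow> 0 < t \<Longrightarrow> t \<le> t0 \<Longrightarrow>
      \<exists>e. dist e q = t \<and> e \<notin> closure G \<and> (\<forall>w\<in>?F. c0 * t \<le> dist w e)"
    using C2_boundary_exterior_points[OF open_G bounded_G C2] by metis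
  have "bounded (closure G)" using bounded_G by (rule bounded_closure)
  then obtain b where b: "\<And>w. w \<in> closure G \<Longrightarrow> norm w \<le> b" unfolding bounded_iff by blast
  define D where "D = 2 * \<bar>b\<bar> + 1"
  have D: "D \<ge> 1" by (simp add: D_def)
  have infD: "infdist z ?F \<le> D" if z: "z \<in> G" for z
  proof -
    obtain q where q: "q \<in> ?F" using F(1) by blast
    then have "norm q \<le> b" using b by (simp add: frontier_def)
    moreover have "norm z \<le> b" using b[of z] z closure_subset by blast
    ultimately have "dist z q \<le> D" using norm_triangle_ineq4[of z q] by (simp add: D_def dist_norm)
    then show ?thesis using infdist_le[OF q, of z] by linarith
  qed
  \<comment> \<open>Scales the exterior offset so that \<open>\<kappa> \<delta>\<close> is at most
    \<open>t0\<close> for every possible \<open>\<delta>\<close>, while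
    \<open>\<kappa> \<le> 1\<close> keeps the pole within \<open>2 \<delta>\<close> of
    \<open>z\<close>.\<close>
  define \<kappa> where "\<kappa> = min 1 (t0 / D)"
  have \<kappa>: "0 < \<kappa>" "\<kappa> \<le> 1" "\<kappa> * D \<le> t0" using c0(2) D by (auto simp: \<kappa>_def min_def field_simps)
  \<comment> \<open>The factor \<open>4 ^ m\<close> comes from
    \<open>(2 \<delta>) ^ (2 m)\<close>.\<close>
  define C where "C = (c0 * \<kappa>) ^ ?m / (2 ^ Suc ?m * A * B\<^sup>2 * 4 ^ ?m)"
  have C: "C > 0" using c0 \<kappa> A B by (simp add: C_def)
  \<comment> \<open>Since \<open>\<delta> \<le> D\<close> and \<open>1 \<le> D\<close>, dividing by
    \<open>D ^ m\<close> weakens \<open>C / \<delta> ^ m\<close> simultaneously to a multiple of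
    \<open>1 / \<delta>\<close> and to a constant.\<close>
  define c where "c = C / D ^ ?m"
  have main: "c \<le> szego_density K z * infdist z ?F \<and> c \<le> szego_density K z" if z: "z \<in> G" for z
  proof -
    define \<delta> where "\<delta> = infdist z ?F"
    have "z \<notin> ?F" using z open_G by (simp add: frontier_def interior_open)
    then have \<delta>: "0 < \<delta>" unfolding \<delta>_def using F by (simp add: infdist_pos_not_in_closed)
    obtain q where q: "q \<in> ?F" "dist z q = \<delta>"
      using infdist_attains_inf[OF F(2,1), of z] unfolding \<delta>_def by metis
    have \<delta>D: "\<delta> \<le> D" using infD[OF z] by (simp add: \<delta>_def)
    have "\<kappa> * \<delta> \<le> t0" using \<delta>D \<kappa> by (meson less_imp_le mult_left_mono order_trans)
    then obtain e where e: "dist e q = \<kappa> * \<delta>" "e \<notin> closure G" "\<And>w. w \<in> ?F \<Longrightarrow> c0 * (\<kappa> * \<delta>) \<le> dist w e"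
      using c0(3)[OF q(1), of "\<kappa> * \<delta>"] \<kappa>(1) \<delta> by auto
    have "dist z e \<le> \<delta> + \<kappa> * \<delta>" using dist_triangle[of z e q] q(2) e(1) by (simp add: dist_commute)
    also have "\<kappa> * \<delta> \<le> \<delta>" using \<kappa>(2) \<delta> by simp
    finally have ze: "dist z e \<le> 2 * \<delta>" by simp
    have ze0: "0 < dist z e" using z e(2) closure_subset by force
    have "C / \<delta> ^ ?m = (c0 * (\<kappa> * \<delta>)) ^ ?m / (2 ^ Suc ?m * A * B\<^sup>2 * (2 * \<delta>) ^ (2 * ?m))"
    proof -
      have "(2 * \<delta>) ^ (2 * ?m) = 4 ^ ?m * (\<delta> ^ ?m * \<delta> ^ ?m)"
        by (simp add: power_mult power2_eq_square power_mult_distrib)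
      then show ?thesis using \<delta> by (simp add: C_def power_mult_distrib)
    qed
    also have "\<dots> \<le> (c0 * (\<kappa> * \<delta>)) ^ ?m / (2 ^ Suc ?m * A * B\<^sup>2 * dist z e ^ (2 * ?m))"
      using ze ze0 c0(1) \<kappa>(1) \<delta> A(1) B(1)
      by (intro divide_left_mono mult_left_mono power_mono mult_pos_pos zero_less_power) auto
    also have "\<dots> \<le> szego_density K z"
      by (rule density_ge_exterior[OF z e(2) _ e(3) A B]) (use c0(1) \<kappa>(1) \<delta> in auto)
    finally have low: "C / \<delta> ^ ?m \<le> szego_density K z" .
    have p1: "\<delta> ^ ?m \<le> D ^ ?m" using \<delta> \<delta>D by (intro power_mono) auto
    have p2: "\<delta> ^ ?m \<le> D ^ ?m * \<delta>"
    proof -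
      have "\<delta> ^ ?m = \<delta> ^ (?m - 1) * \<delta>" by (metis power_minus_mult zero_less_card_finite)
      also have "\<dots> \<le> D ^ (?m - 1) * \<delta>" using \<delta> \<delta>D by (intro mult_right_mono power_mono) auto
      also have "\<dots> \<le> D ^ ?m * \<delta>" using D \<delta> by (intro mult_right_mono power_increasing) auto
      finally show ?thesis .
    qed
    have "c \<le> C / \<delta> ^ ?m" unfolding c_def using p1 \<delta> C D by (intro divide_left_mono) auto
    then have 1: "c \<le> szego_density K z" using low by linarith
    have "c \<le> C / \<delta> ^ ?m * \<delta>"
    proof -
      have "C * \<delta> ^ ?m \<le> C * (D ^ ?m * \<delta>)" using p2 C by (intro mult_left_mono) auto
      then show ?thesis using \<delta> D unfolding c_def by (simp add: field_simps)
    qed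
    also have "\<dots> \<le> szego_density K z * \<delta>" using low \<delta> by (intro mult_right_mono) auto
    finally show ?thesis using 1 by (simp add: \<delta>_def)
  qed
  have "c > 0" using C D by (simp add: c_def)
  then show thesis using that main by blast
qed

end

section \<open>Cutoff functions\<close>

text \<open>A finite \<open>e\<close>-cover is thinned greedily: a point is kept unless a kept one
  is closer than \<open>e\<close>, so covering degrades to \<open>2 e\<close>. Separation will make
  surface balls disjoint; the covering will make the cutoff vanish near the frontier.\<close>

lemma finite_separated_net:
  fixes F :: "'a::metric_space set"
  assumes F: "compact F" and e: "0 < e"
  obtains P where "finite P" "P \<subseteq> F" "\<And>p q. p \<in> P \<Longrightarrow> q \<in> P \<Longrightarrow> p \<noteq> q \<Longrightarrow> e \<le> dist p q"
    "\<And>x. x \<in> F \<Longrightarrow> \<exists>p\<in>P. dist p x < 2 * e"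
proof -
  obtain Q where Q: "Q \<subseteq> F" "finite Q" "F \<subseteq> (\<Union>q\<in>Q. ball q e)"
  proof (rule compactE_image[OF F])
    show "open (ball q e)" if "q \<in> F" for q by simp
    show "F \<subseteq> (\<Union>q\<in>F. ball q e)" using e by force
  qed blast
  have "\<exists>P\<subseteq>Q. (\<forall>p\<in>P. \<forall>q\<in>P. p \<noteq> q \<longrightarrow> e \<le> dist p q) \<and> (\<forall>q\<in>Q. \<exists>p\<in>P. dist p q < e)"
    using Q(2)
  proof (induction Q rule: finite_induct)
    case (insert x Q)
    obtain P where P: "P \<subseteq> Q" "\<forall>p\<in>P. \<forall>q\<in>P. p \<noteq> q \<longrightarrow> e \<le> dist p q" "\<forall>q\<in>Q. \<exists>p\<in>P. dist p q < e"
      using insert.IH by (elim exE conjE) (erule (2) that)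
    show ?case
    proof (cases "\<exists>p\<in>P. dist p x < e")
      case True
      then show ?thesis using P by (intro exI[of _ P]) auto
    next
      case False
      then have "\<forall>p\<in>P. e \<le> dist p x \<and> e \<le> dist x p" by (auto simp: not_less dist_commute)
      then show ?thesis using P e by (intro exI[of _ "insert x P"]) auto
    qed
  qed simp
  then obtain P where P: "P \<subseteq> Q" "\<forall>p\<in>P. \<forall>q\<in>P. p \<noteq> q \<longrightarrow> e \<le> dist p q" "\<forall>q\<in>Q. \<exists>p\<in>P. dist p q < e"
    by (elim exE conjE) (erule (2) that)
  show thesis
  proof (rule that)
    show "finite P" "P \<subseteq> F" using P(1) Q finite_subset by auto
    show "e \<le> dist p q" if "p \<in> P" "q \<in> P" "p \<noteq> q" for p q using P(2) that by blast
    fix x assume "x \<in> F"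
    then obtain q where q: "q \<in> Q" "dist q x < e" using Q(3) by auto
    then obtain p where "p \<in> P" "dist p q < e" using P(3) by blast
    then show "\<exists>p\<in>P. dist p x < 2 * e" using q(2) dist_triangle[of p x q] by (intro bexI[of _ p]) auto
  qed
qed

text \<open>A continuously differentiable bend at 0; nesting two of them gives a cutoff profile
  whose derivative is continuous, as the divergence argument asks.\<close>

lemma has_real_derivative_max_0_square:
  "((\<lambda>x::real. (max 0 x)\<^sup>2) has_real_derivative 2 * max 0 x) (at x)"
proof -
  consider "x > 0" | "x < 0" | "x = 0" by linarith
  then show ?thesis
  proof cases
    case 1
    have "((\<lambda>x::real. x\<^sup>2) has_real_derivative 2 * x) (at x)" by (auto intro!: derivative_eq_intros)
    then show ?thesis using 1
      by (rule_tac has_field_derivative_transform_within_open[where S="{0<..}" and f="\<lambda>x. x\<^sup>2"]) auto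
  next
    case 2
    have "((\<lambda>x::real. 0) has_real_derivative 0) (at x)" by simp
    then show ?thesis using 2
      by (rule_tac has_field_derivative_transform_within_open[where S="{..<0}" and f="\<lambda>x. 0"]) auto
  next
    case 3
    have "((\<lambda>h. ((max 0 h)\<^sup>2) / h) \<longlongrightarrow> 0) (at (0::real))"
    proof (rule Lim_null_comparison)
      show "\<forall>\<^sub>F h in at (0::real). norm ((max 0 h)\<^sup>2 / h) \<le> \<bar>h\<bar>"
        by (rule always_eventually) (auto simp: max_def power2_eq_square)
      show "((\<lambda>h::real. \<bar>h\<bar>) \<longlongrightarrow> 0) (at 0)" by (auto intro!: tendsto_eq_intros)
    qed
    then show ?thesis using 3 by (simp add: has_field_derivative_iff)
  qed
qed

text \<open>The constants put the transition of \<open>cutoff\<close> below at distance between \<open>3 \<epsilon>\<close> and \<open>4 \<epsilon>\<close> from \<open>P\<close>.\<close>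

definition cutoff_step :: "real \<Rightarrow> real" where
  "cutoff_step s = 1 - (max 0 (1 - (max 0 ((s - 9) / 7))\<^sup>2))\<^sup>2"

definition cutoff_step_deriv :: "real \<Rightarrow> real" where
  "cutoff_step_deriv s = 4 / 7 * max 0 (1 - (max 0 ((s - 9) / 7))\<^sup>2) * max 0 ((s - 9) / 7)"

lemma cutoff_step_has_derivative: "(cutoff_step has_real_derivative cutoff_step_deriv s) (at s)"
proof -
  have 1: "((\<lambda>s. (s - 9) / 7) has_real_derivative 1 / 7) (at s)"
    by (auto intro!: derivative_eq_intros)
  have 2: "((\<lambda>s. 1 - (max 0 ((s - 9) / 7))\<^sup>2) has_real_derivative - (2 * max 0 ((s - 9) / 7) * (1 / 7))) (at s)"
    using DERIV_diff[OF DERIV_const DERIV_chain2[OF has_real_derivative_max_0_square 1], of 1] by simp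
  from DERIV_diff[OF DERIV_const DERIV_chain2[OF has_real_derivative_max_0_square 2], of 1]
  show ?thesis unfolding cutoff_step_def cutoff_step_deriv_def
    by (rule DERIV_cong) simp
qed

lemma cutoff_step_low: "s \<le> 9 \<Longrightarrow> cutoff_step s = 0" "s \<le> 9 \<Longrightarrow> cutoff_step_deriv s = 0"
  by (simp_all add: cutoff_step_def cutoff_step_deriv_def max_def)

lemma cutoff_step_high:
  assumes "16 \<le> s"
  shows "cutoff_step s = 1" "cutoff_step_deriv s = 0"
proof -
  have "1 \<le> max 0 ((s - 9) / 7)" using assms by simp
  then have "1 \<le> (max 0 ((s - 9) / 7))\<^sup>2" by (rule one_le_power)
  then have "max 0 (1 - (max 0 ((s - 9) / 7))\<^sup>2) = 0" by simp
  then show "cutoff_step s = 1" "cutoff_step_deriv s = 0"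
    by (simp_all only: cutoff_step_def cutoff_step_deriv_def) simp_all
qed

lemma cutoff_step_range: "0 \<le> cutoff_step s" "cutoff_step s \<le> 1"
proof -
  have "0 \<le> max 0 (1 - (max 0 ((s - 9) / 7))\<^sup>2)" "max 0 (1 - (max 0 ((s - 9) / 7))\<^sup>2) \<le> 1" by simp_all
  then have "(max 0 (1 - (max 0 ((s - 9) / 7))\<^sup>2))\<^sup>2 \<le> 1" by (simp only: power_le_one)
  then show "0 \<le> cutoff_step s" "cutoff_step s \<le> 1" by (simp_all add: cutoff_step_def)
qed

lemma cutoff_step_deriv_bound: "\<bar>cutoff_step_deriv s\<bar> \<le> 1"
proof (cases "16 \<le> s")
  case True
  then show ?thesis by (simp add: cutoff_step_high)
next
  case False
  define u where "u = max 0 ((s - 9) / 7)"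
  have u: "0 \<le> u" "u \<le> 1" using False by (auto simp: u_def)
  have v: "0 \<le> max 0 (1 - u\<^sup>2)" "max 0 (1 - u\<^sup>2) \<le> 1" by simp_all
  have "0 \<le> max 0 (1 - u\<^sup>2) * u" "max 0 (1 - u\<^sup>2) * u \<le> 1"
    using u v by (simp_all add: mult_le_one)
  then show ?thesis unfolding cutoff_step_deriv_def u_def[symmetric] by simp
qed

lemma continuous_cutoff_step_deriv: "continuous_on UNIV cutoff_step_deriv"
  unfolding cutoff_step_deriv_def by (intro continuous_intros) auto

text \<open>For a net of mesh \<open>2 \<epsilon>\<close>, a point within \<open>\<epsilon>\<close>
  of the frontier is within \<open>3 \<epsilon>\<close> of a net point, so some factor vanishes
  there. Squared norms keep the factors differentiable at the net points.\<close>

definition cutoff :: "'a::euclidean_space set \<Rightarrow> real \<Rightarrow> 'a \<Rightarrow> real" where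
  "cutoff P \<epsilon> w = (\<Prod>p\<in>P. cutoff_step ((norm (w - p))\<^sup>2 / \<epsilon>\<^sup>2))"

definition cutoff_grad :: "'a::euclidean_space set \<Rightarrow> real \<Rightarrow> 'a \<Rightarrow> 'a" where
  "cutoff_grad P \<epsilon> w = (\<Sum>p\<in>P. (cutoff_step_deriv ((norm (w - p))\<^sup>2 / \<epsilon>\<^sup>2) * (2 / \<epsilon>\<^sup>2) *
     (\<Prod>q\<in>P - {p}. cutoff_step ((norm (w - q))\<^sup>2 / \<epsilon>\<^sup>2))) *\<^sub>R (w - p))"

lemma cutoff_has_derivative:
  fixes P :: "'a::euclidean_space set"
  shows "(cutoff P \<epsilon> has_derivative (\<lambda>v. cutoff_grad P \<epsilon> w \<bullet> v)) (at w)"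
proof -
  have 1: "((\<lambda>w. (norm (w - p))\<^sup>2 / \<epsilon>\<^sup>2) has_derivative (\<lambda>v. 2 * ((w - p) \<bullet> v) / \<epsilon>\<^sup>2)) (at w)" for p
    unfolding power2_norm_eq_inner divide_inverse
    by (auto intro!: derivative_eq_intros simp: inner_commute)
  have 2: "((\<lambda>w. cutoff_step ((norm (w - p))\<^sup>2 / \<epsilon>\<^sup>2)) has_derivative
    (\<lambda>v. cutoff_step_deriv ((norm (w - p))\<^sup>2 / \<epsilon>\<^sup>2) * (2 * ((w - p) \<bullet> v) / \<epsilon>\<^sup>2))) (at w)" for p
    by (rule has_derivative_compose[OF 1 cutoff_step_has_derivative[unfolded has_field_derivative_def]])
  show ?thesis unfolding cutoff_def
    by (rule has_derivative_eq_rhs[OF has_derivative_prod[OF 2]])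
      (simp add: fun_eq_iff cutoff_grad_def inner_sum_left mult_ac)
qed

lemma continuous_on_cutoff_grad: "continuous_on UNIV (cutoff_grad P \<epsilon>)"
proof -
  have s: "continuous_on UNIV cutoff_step"
    by (rule continuous_at_imp_continuous_on) (simp add: DERIV_isCont[OF cutoff_step_has_derivative])
  have c: "continuous_on UNIV (\<lambda>w::'a. (norm (w - p))\<^sup>2 / \<epsilon>\<^sup>2)" for p
    unfolding divide_inverse by (intro continuous_intros)
  show ?thesis unfolding cutoff_grad_def
    by (intro continuous_on_sum continuous_on_scaleR continuous_on_mult continuous_on_prod
        continuous_on_const continuous_on_diff continuous_on_id
        continuous_on_compose2[OF s c] continuous_on_compose2[OF continuous_cutoff_step_deriv c]) auto
qed

lemma continuous_on_cutoff: "continuous_on UNIV (cutoff P \<epsilon>)"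
  by (rule continuous_at_imp_continuous_on) (simp add: has_derivative_continuous[OF cutoff_has_derivative])

lemma cutoff_range: "0 \<le> cutoff P \<epsilon> w" "cutoff P \<epsilon> w \<le> 1"
  unfolding cutoff_def by (intro prod_nonneg prod_le_1 ballI conjI cutoff_step_range)+

lemma cutoff_near:
  assumes "finite P" "p \<in> P" "dist w p \<le> 3 * \<epsilon>" "0 < \<epsilon>"
  shows "cutoff P \<epsilon> w = 0" "cutoff_grad P \<epsilon> w = 0"
proof -
  have "(norm (w - p))\<^sup>2 \<le> (3 * \<epsilon>)\<^sup>2" using assms(3) by (intro power_mono) (auto simp: dist_norm)
  then have s: "(norm (w - p))\<^sup>2 / \<epsilon>\<^sup>2 \<le> 9" using assms(4) by (simp add: pos_divide_le_eq power_mult_distrib)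
  show "cutoff P \<epsilon> w = 0" unfolding cutoff_def
    by (rule prod_zero[OF assms(1)]) (use assms(2) cutoff_step_low(1)[OF s] in blast)
  show "cutoff_grad P \<epsilon> w = 0" unfolding cutoff_grad_def
  proof (rule sum.neutral, rule ballI)
    fix p' assume "p' \<in> P"
    show "(cutoff_step_deriv ((norm (w - p'))\<^sup>2 / \<epsilon>\<^sup>2) * (2 / \<epsilon>\<^sup>2) *
       (\<Prod>q\<in>P - {p'}. cutoff_step ((norm (w - q))\<^sup>2 / \<epsilon>\<^sup>2))) *\<^sub>R (w - p') = 0"
    proof (cases "p' = p")
      case True
      then show ?thesis using cutoff_step_low(2)[OF s] by simp
    next
      case False
      then have "(\<Prod>q\<in>P - {p'}. cutoff_step ((norm (w - q))\<^sup>2 / \<epsilon>\<^sup>2)) = 0"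
        by (intro prod_zero) (use assms(1,2) cutoff_step_low(1)[OF s] in auto)
      then show ?thesis by simp
    qed
  qed
qed

lemma cutoff_far:
  assumes "\<And>p. p \<in> P \<Longrightarrow> 4 * \<epsilon> \<le> dist w p" "0 < \<epsilon>"
  shows "cutoff P \<epsilon> w = 1"
  unfolding cutoff_def
proof (rule prod.neutral, rule ballI)
  fix p assume "p \<in> P"
  then have "(4 * \<epsilon>)\<^sup>2 \<le> (norm (w - p))\<^sup>2" using assms by (intro power_mono) (auto simp: dist_norm)
  then have "16 \<le> (norm (w - p))\<^sup>2 / \<epsilon>\<^sup>2" using assms(2) by (simp add: pos_le_divide_eq power_mult_distrib)
  then show "cutoff_step ((norm (w - p))\<^sup>2 / \<epsilon>\<^sup>2) = 1" by (rule cutoff_step_high)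
qed

text \<open>The gradient of one factor lives on the ball of radius \<open>4 \<epsilon>\<close> and
  is at most \<open>2 / \<epsilon>^2\<close> times \<open>4 \<epsilon>\<close>. Overlapping balls
  are simply added, which suits the later comparison of a sum over \<open>P\<close> with a surface
  integral.\<close>

lemma norm_cutoff_grad_le:
  fixes P :: "'a::euclidean_space set"
  assumes \<epsilon>: "0 < \<epsilon>"
  shows "norm (cutoff_grad P \<epsilon> w) \<le> (\<Sum>p\<in>P. 8 / \<epsilon> * indicator (ball p (4 * \<epsilon>)) w)"
  unfolding cutoff_grad_def
proof (rule order_trans[OF norm_sum sum_mono])
  fix p assume "p \<in> P"
  define s where "s = (norm (w - p))\<^sup>2 / \<epsilon>\<^sup>2"
  define \<pi> where "\<pi> = (\<Prod>q\<in>P - {p}. cutoff_step ((norm (w - q))\<^sup>2 / \<epsilon>\<^sup>2))"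
  have \<pi>: "0 \<le> \<pi>" "\<pi> \<le> 1" unfolding \<pi>_def by (intro prod_nonneg prod_le_1 ballI conjI cutoff_step_range)+
  show "norm ((cutoff_step_deriv s * (2 / \<epsilon>\<^sup>2) * \<pi>) *\<^sub>R (w - p)) \<le> 8 / \<epsilon> * indicator (ball p (4 * \<epsilon>)) w"
  proof (cases "w \<in> ball p (4 * \<epsilon>)")
    case True
    then have d: "norm (w - p) \<le> 4 * \<epsilon>" by (simp add: dist_norm norm_minus_commute)
    have "\<bar>cutoff_step_deriv s\<bar> * \<pi> * (2 / \<epsilon>\<^sup>2 * norm (w - p)) \<le> 1 * (2 / \<epsilon>\<^sup>2 * (4 * \<epsilon>))"
      using cutoff_step_deriv_bound[of s] \<pi> d \<epsilon>
      by (intro mult_mono mult_le_one) auto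
    also have "\<dots> = 8 / \<epsilon>" using \<epsilon> by (simp add: power2_eq_square)
    finally show ?thesis using True \<pi> by (simp add: abs_mult mult_ac)
  next
    case False
    then have "4 * \<epsilon> \<le> norm (w - p)" by (simp add: dist_norm norm_minus_commute not_less)
    then have "(4 * \<epsilon>)\<^sup>2 \<le> (norm (w - p))\<^sup>2" using \<epsilon> by (intro power_mono) auto
    then have "16 \<le> s" using \<epsilon> by (simp add: s_def pos_le_divide_eq power_mult_distrib)
    then show ?thesis using False by (simp add: cutoff_step_high)
  qed
qed

text \<open>The balls of radius \<open>r\<close> are disjoint by separation, and on each the
  integrand is at least \<open>s p\<close> over a set of measure at least \<open>c\<close>. This
  turns a finite sum over the net into a surface integral without parametrising the
  frontier.\<close>

lemma sum_local_lower_bounds_le_integral: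
  fixes M :: "'a::metric_space measure" and g :: "'a \<Rightarrow> real" and s :: "'a \<Rightarrow> real"
  assumes M: "finite_measure M" and P: "finite P" and sep: "\<And>p q. p \<in> P \<Longrightarrow> q \<in> P \<Longrightarrow> p \<noteq> q \<Longrightarrow> 2 * r \<le> dist p q"
    and meas: "\<And>p. p \<in> P \<Longrightarrow> space M \<inter> ball p r \<in> sets M"
    and g: "integrable M g" "\<And>y. y \<in> space M \<Longrightarrow> 0 \<le> g y"
    and s: "\<And>p. p \<in> P \<Longrightarrow> 0 \<le> s p" "\<And>p y. p \<in> P \<Longrightarrow> y \<in> space M \<inter> ball p r \<Longrightarrow> s p \<le> g y"
    and c: "\<And>p. p \<in> P \<Longrightarrow> ennreal c \<le> emeasure M (space M \<inter> ball p r)" "0 \<le> c"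
  shows "(\<Sum>p\<in>P. s p) * c \<le> (\<integral>y. g y \<partial>M)"
proof -
  interpret finite_measure M by (rule M)
  define B where "B p = space M \<inter> ball p r" for p
  have B: "B p \<in> sets M" if "p \<in> P" for p using meas[OF that] by (simp add: B_def)
  have Bi: "integrable M (\<lambda>y. indicator (B p) y :: real)" if "p \<in> P" for p
    by (rule integrable_real_indicator[OF B[OF that]]) (simp add: less_top[symmetric] emeasure_eq_measure)
  have Bs: "integrable M (\<lambda>y. s p * indicator (B p) y)" if "p \<in> P" for p
    by (rule integrable_mult_right) (rule Bi[OF that])
  have BS: "B p \<inter> space M = B p" for p by (auto simp: B_def)
  have "(\<Sum>p\<in>P. s p) * c = (\<Sum>p\<in>P. s p * c)" by (rule sum_distrib_right)
  also have "\<dots> \<le> (\<Sum>p\<in>P. s p * measure M (B p))"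
  proof (intro sum_mono mult_left_mono s(1))
    fix p assume "p \<in> P"
    then have "ennreal c \<le> ennreal (measure M (B p))" using c(1) by (simp add: B_def emeasure_eq_measure)
    then show "c \<le> measure M (B p)" by (simp add: ennreal_le_iff)
  qed
  also have "\<dots> = (\<Sum>p\<in>P. \<integral>y. s p * indicator (B p) y \<partial>M)"
    by (rule sum.cong) (simp_all add: BS)
  also have "\<dots> = (\<integral>y. (\<Sum>p\<in>P. s p * indicator (B p) y) \<partial>M)"
    by (rule Bochner_Integration.integral_sum[symmetric]) (rule Bs)
  also have "\<dots> \<le> (\<integral>y. g y \<partial>M)"
  proof (rule integral_mono)
    show "integrable M (\<lambda>y. \<Sum>p\<in>P. s p * indicator (B p) y)"
      by (rule Bochner_Integration.integrable_sum) (rule Bs)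
    fix y assume y: "y \<in> space M"
    show "(\<Sum>p\<in>P. s p * indicator (B p) y) \<le> g y"
    proof (cases "\<exists>p\<in>P. y \<in> B p")
      case True
      then obtain p where p: "p \<in> P" "y \<in> B p" by blast
      have "y \<notin> B q" if q: "q \<in> P" "q \<noteq> p" for q
      proof
        assume "y \<in> B q"
        then have "dist p q < 2 * r" using p(2) dist_triangle[of p q y] by (simp add: B_def dist_commute)
        then show False using sep[OF p(1) q(1)] q(2) by simp
      qed
      then have "(\<Sum>q\<in>P. s q * indicator (B q) y) = s p * indicator (B p) y"
        by (subst sum.remove[OF P p(1)]) (simp add: sum.neutral)
      then show ?thesis using s(2)[of p y] p by (simp add: B_def)
    next
      case False
      then have "(\<Sum>p\<in>P. s p * indicator (B p) y) = 0" by (intro sum.neutral) auto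
      then show ?thesis using g(2)[OF y] by simp
    qed
  qed (rule g(1))
  finally show ?thesis .
qed

section \<open>Boundedness of point evaluations\<close>

lemma norm_cauchy_kernel_le:
  fixes x :: "'n::{finite,linorder} paravector"
  assumes "0 \<le> a" "0 < r" "r \<le> norm x"
  shows "norm (cauchy_kernel a x) \<le> 1 / r ^ CARD('n)"
proof -
  have x: "0 < norm x" using assms by linarith
  have "((norm x)\<^sup>2 + a) powr (- (real DIM('n paravector) / 2)) \<le> ((norm x)\<^sup>2 + 0) powr (- (real DIM('n paravector) / 2))"
    using x assms(1) by (intro powr_mono2') auto
  then have "norm (cauchy_kernel a x) \<le> norm (cauchy_kernel 0 x)"
    unfolding norm_cauchy_kernel by (rule mult_right_mono) simp
  also have "\<dots> = 1 / norm x ^ CARD('n)" using x by (intro norm_cauchy_kernel_0) auto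
  also have "\<dots> \<le> 1 / r ^ CARD('n)" using assms x by (intro divide_left_mono power_mono) auto
  finally show ?thesis .
qed

lemma cauchy_density_nonneg: "0 \<le> a \<Longrightarrow> 0 \<le> cauchy_density a x"
  by (simp add: cauchy_density_def)

lemma cauchy_density_exponent:
  assumes "0 < r"
  shows "(r\<^sup>2) powr (- (real k / 2) - 1) = 1 / r ^ (k + 2)"
proof -
  have "- (real k / 2) - 1 = - (real (k + 2) / 2)" by (simp add: field_simps)
  then show ?thesis using powr_square_half[OF assms, of "k + 2"] by simp
qed

text \<open>On the ball of radius \<open>\<alpha>\<close> the base of the power is at most
  \<open>2 \<alpha>^2\<close>. The bound scales inversely to the volume of that ball, so the mass
  over it has a lower bound independent of \<open>\<alpha>\<close>; this replaces computing the
  total mass.\<close>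

lemma cauchy_density_ge:
  fixes x :: "'n::{finite,linorder} paravector"
  assumes "0 < \<alpha>" "norm x \<le> \<alpha>"
  shows "real DIM('n paravector) * 2 powr (- (real DIM('n paravector) / 2) - 1) / \<alpha> ^ DIM('n paravector)
    \<le> cauchy_density (\<alpha>\<^sup>2) x"
proof -
  define k where "k = DIM('n paravector)"
  have "(norm x)\<^sup>2 \<le> \<alpha>\<^sup>2" using assms(2) by (intro power_mono) auto
  then have "(2 * \<alpha>\<^sup>2) powr (- (real k / 2) - 1) \<le> ((norm x)\<^sup>2 + \<alpha>\<^sup>2) powr (- (real k / 2) - 1)"
    using assms(1) by (intro powr_mono2') (auto simp: add_nonneg_pos)
  moreover have "(2 * \<alpha>\<^sup>2) powr (- (real k / 2) - 1) = 2 powr (- (real k / 2) - 1) * (1 / \<alpha> ^ (k + 2))"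
    using assms(1) cauchy_density_exponent[of \<alpha> k] by (simp add: powr_mult)
  ultimately have "real k * \<alpha>\<^sup>2 * (2 powr (- (real k / 2) - 1) * (1 / \<alpha> ^ (k + 2)))
      \<le> real k * \<alpha>\<^sup>2 * ((norm x)\<^sup>2 + \<alpha>\<^sup>2) powr (- (real k / 2) - 1)"
    by (intro mult_left_mono) auto
  also have "real k * \<alpha>\<^sup>2 * (2 powr (- (real k / 2) - 1) * (1 / \<alpha> ^ (k + 2)))
      = real k * 2 powr (- (real k / 2) - 1) / \<alpha> ^ k"
    using assms(1) by (simp add: power_add power2_eq_square)
  finally show ?thesis unfolding cauchy_density_def k_def .
qed

text \<open>At fixed distance from the pole the density tends to 0 with \<open>\<alpha>\<close>,
  which makes the far part of the approximate identity negligible.\<close>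

lemma cauchy_density_le:
  fixes x :: "'n::{finite,linorder} paravector"
  assumes "0 < d" "d \<le> norm x"
  shows "cauchy_density (\<alpha>\<^sup>2) x \<le> real DIM('n paravector) * \<alpha>\<^sup>2 / d ^ (DIM('n paravector) + 2)"
proof -
  define k where "k = DIM('n paravector)"
  have "d\<^sup>2 \<le> (norm x)\<^sup>2" using assms by (intro power_mono) auto
  then have "((norm x)\<^sup>2 + \<alpha>\<^sup>2) powr (- (real k / 2) - 1) \<le> (d\<^sup>2) powr (- (real k / 2) - 1)"
    using assms(1) by (intro powr_mono2') (auto simp: add_increasing2)
  then have "real k * \<alpha>\<^sup>2 * ((norm x)\<^sup>2 + \<alpha>\<^sup>2) powr (- (real k / 2) - 1) \<le> real k * \<alpha>\<^sup>2 * (1 / d ^ (k + 2))"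
    unfolding cauchy_density_exponent[OF assms(1)] by (intro mult_left_mono) auto
  then show ?thesis unfolding cauchy_density_def k_def by simp
qed

lemma continuous_on_cauchy_kernel: "0 < a \<Longrightarrow> continuous_on UNIV (\<lambda>w. cauchy_kernel a (w - z))"
proof -
  assume a: "0 < a"
  have "continuous_on UNIV (cauchy_kernel a :: 'a paravector \<Rightarrow> _)"
    by (rule continuous_at_imp_continuous_on)
      (simp add: has_derivative_continuous[OF cauchy_kernel_has_derivative] a add_nonneg_pos)
  then show ?thesis by (rule continuous_on_compose2) (auto intro!: continuous_intros)
qed

lemma continuous_on_cauchy_density: "0 < a \<Longrightarrow> continuous_on UNIV (\<lambda>w. cauchy_density a (w - z))"
proof -
  assume a: "0 < a"
  have "(norm (w - z))\<^sup>2 + a \<noteq> 0" for w using a by (metis add_nonneg_pos less_irrefl zero_le_power2)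
  then show ?thesis unfolding cauchy_density_def by (intro continuous_intros) auto
qed

text \<open>\<open>integral_monogenic_test\<close> for the kernel times the cutoff: \<open>X\<close>
  comes from differentiating the kernel, \<open>Y\<close> from differentiating the cutoff.
  \<open>S\<close> is a compact subset of \<open>G\<close> because every frontier point is within
  \<open>2 \<epsilon>\<close> of \<open>P\<close>; restricting to it makes integrability
  immediate.\<close>

lemma monogenic_cutoff_identity:
  fixes G :: "'n::{finite,linorder} paravector set" and z :: "'n paravector"
  assumes G: "open G" "bounded G" and f: "left_monogenic G f"
    and P: "finite P" "\<And>x. x \<in> frontier G \<Longrightarrow> \<exists>p\<in>P. dist p x < 2 * \<epsilon>" and \<epsilon>: "0 < \<epsilon>" and a: "0 < a"
  defines "S \<equiv> closure G \<inter> {w. \<forall>p\<in>P. 3 * \<epsilon> \<le> dist w p}"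
  defines "X \<equiv> \<lambda>w. indicator S w *\<^sub>R ((cutoff P \<epsilon> w * cauchy_density a (w - z)) *\<^sub>R f w)"
  defines "Y \<equiv> \<lambda>w. indicator S w *\<^sub>R ((cauchy_kernel a (w - z) \<odot> paravec (cutoff_grad P \<epsilon> w)) \<odot> f w)"
  shows "compact S" "S \<subseteq> G" "integrable lborel X" "integrable lborel Y"
    "(\<integral>w. X w \<partial>lborel) = - (\<integral>w. Y w \<partial>lborel)"
proof -
  have "{w. \<forall>p\<in>P. 3 * \<epsilon> \<le> dist w p} = (\<Inter>p\<in>P. {w. 3 * \<epsilon> \<le> dist w p})" by auto
  moreover have "closed (\<Inter>p\<in>P. {w. 3 * \<epsilon> \<le> dist w p})"
    by (intro closed_INT ballI closed_Collect_le continuous_intros)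
  ultimately have "closed {w. \<forall>p\<in>P. 3 * \<epsilon> \<le> dist w p}" by simp
  then show S: "compact S" unfolding S_def using G(2)
    by (intro compact_Int_closed) (simp_all add: compact_closure)
  show SG: "S \<subseteq> G"
  proof
    fix w assume w: "w \<in> S"
    have "w \<notin> frontier G"
    proof
      assume "w \<in> frontier G"
      then obtain p where "p \<in> P" "dist p w < 2 * \<epsilon>" using P(2) by blast
      moreover from this have "3 * \<epsilon> \<le> dist w p" using w by (simp add: S_def)
      ultimately show False using \<epsilon> by (simp add: dist_commute)
    qed
    then show "w \<in> G" using w G(1) by (simp add: S_def frontier_def interior_open)
  qed
  have off: "cutoff P \<epsilon> w = 0 \<and> cutoff_grad P \<epsilon> w = 0" if w: "w \<in> G" "w \<notin> S" for w
  proof -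
    have "w \<in> closure G" using w(1) closure_subset by blast
    then obtain p where "p \<in> P" "dist w p < 3 * \<epsilon>" using w(2) by (auto simp: S_def not_le)
    then show ?thesis using cutoff_near[OF P(1), of p w \<epsilon>] \<epsilon> by simp
  qed
  define h where "h w = cutoff P \<epsilon> w *\<^sub>R cauchy_kernel a (w - z)" for w
  define h' where "h' w v = cutoff P \<epsilon> w *\<^sub>R cauchy_kernel_deriv a (w - z) v
     + (cutoff_grad P \<epsilon> w \<bullet> v) *\<^sub>R cauchy_kernel a (w - z)" for w v
  have pos: "0 < (norm (w - z))\<^sup>2 + a" for w using a by (simp add: add_nonneg_pos)
  have hd: "(h has_derivative h' w) (at w)" for w
  proof -
    have "((\<lambda>w. w - z) has_derivative (\<lambda>v. v)) (at w)" by (auto intro!: derivative_eq_intros)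
    from has_derivative_compose[OF this cauchy_kernel_has_derivative[OF pos]]
    have "((\<lambda>w. cauchy_kernel a (w - z)) has_derivative cauchy_kernel_deriv a (w - z)) (at w)" by simp
    from has_derivative_scaleR[OF cutoff_has_derivative this]
    show ?thesis unfolding h_def h'_def .
  qed
  have R: "(\<Sum>b\<in>Basis. h' w b \<odot> paravec b) = (cutoff P \<epsilon> w * cauchy_density a (w - z)) *\<^sub>R blade {}
      + cauchy_kernel a (w - z) \<odot> paravec (cutoff_grad P \<epsilon> w)" for w
  proof -
    have "(\<Sum>b\<in>Basis. h' w b \<odot> paravec b) = cutoff P \<epsilon> w *\<^sub>R (\<Sum>b\<in>Basis. cauchy_kernel_deriv a (w - z) b \<odot> paravec b)
        + cauchy_kernel a (w - z) \<odot> (\<Sum>b\<in>Basis. (cutoff_grad P \<epsilon> w \<bullet> b) *\<^sub>R paravec b)"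
      unfolding h'_def by (simp add: cmult_simps sum.distrib scaleR_sum_right)
    then show ?thesis unfolding sum_cauchy_kernel_deriv(1)[OF pos] sum_Basis_paravec by simp
  qed
  have gc: "continuous_on UNIV (\<lambda>w. cauchy_kernel a (w - z) \<odot> paravec (cutoff_grad P \<epsilon> w))"
    by (intro bounded_bilinear.continuous_on[OF bounded_bilinear_cmult] continuous_on_cauchy_kernel a
        bounded_linear.continuous_on[OF bounded_linear_paravec] continuous_on_cutoff_grad)
  have cc: "continuous_on UNIV (\<lambda>w. cutoff P \<epsilon> w * cauchy_density a (w - z))"
    by (intro continuous_on_mult continuous_on_cutoff continuous_on_cauchy_density a)
  have Rc: "continuous_on UNIV (\<lambda>w. \<Sum>b\<in>Basis. h' w b \<odot> paravec b)"
    unfolding R by (intro continuous_on_add continuous_on_scaleR cc gc continuous_on_const)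
  have fc: "continuous_on S f" using left_monogenic_continuous_on[OF f] SG by (rule continuous_on_subset)
  show iX: "integrable lborel X" unfolding X_def
    by (rule borel_integrable_compact[OF S]) (intro continuous_on_scaleR fc continuous_on_subset[OF cc] subset_UNIV)
  show iY: "integrable lborel Y" unfolding Y_def
    by (rule borel_integrable_compact[OF S])
      (intro bounded_bilinear.continuous_on[OF bounded_bilinear_cmult] fc continuous_on_subset[OF gc] subset_UNIV)
  have "((\<lambda>w. if w \<in> G then (\<Sum>b\<in>Basis. h' w b \<odot> paravec b) \<odot> f w else 0) has_integral 0) UNIV"
  proof (rule integral_monogenic_test(2)[OF G(1) f S SG])
    show "h w = 0" if "w \<in> G" "w \<notin> S" for w using off[OF that] by (simp add: h_def)
    show "(h has_derivative h' w) (at w)" for w by (rule hd)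
    show "continuous_on G (\<lambda>w. \<Sum>b\<in>Basis. h' w b \<odot> paravec b)"
      by (rule continuous_on_subset[OF Rc]) simp
  qed
  moreover have "(if w \<in> G then (\<Sum>b\<in>Basis. h' w b \<odot> paravec b) \<odot> f w else 0) = X w + Y w" for w
  proof (cases "w \<in> S")
    case True
    then show ?thesis using SG unfolding R X_def Y_def by (auto simp: cmult_simps cmult_one)
  next
    case False
    then show ?thesis using off[of w] unfolding R X_def Y_def
      by (auto simp: cmult_simps paravec_def)
  qed
  ultimately have "((\<lambda>w. X w + Y w) has_integral 0) UNIV" by simp
  moreover have "((\<lambda>w. X w + Y w) has_integral (\<integral>w. X w + Y w \<partial>lborel)) UNIV"
    by (rule has_integral_integral_lborel) (intro Bochner_Integration.integrable_add iX iY)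
  ultimately have "(\<integral>w. X w + Y w \<partial>lborel) = 0" by (rule has_integral_unique[symmetric])
  then show "(\<integral>w. X w \<partial>lborel) = - (\<integral>w. Y w \<partial>lborel)"
    by (simp add: Bochner_Integration.integral_add[OF iX iY] eq_neg_iff_add_eq_0)
qed

text \<open>\<open>Y\<close> lives on the balls of radius \<open>4 \<epsilon>\<close> about the net,
  with size of order \<open>|f| / \<epsilon>\<close>; times the volume of order
  \<open>\<epsilon> ^ (m + 1)\<close> this leaves \<open>\<epsilon> ^ m\<close>, the order of a
  surface ball. Values of \<open>f\<close> inside are replaced by values on the frontier at the
  price of the oscillation \<open>\<eta>\<close>; the scale \<open>5 \<epsilon>\<close> exceeds
  \<open>4 \<epsilon> + \<epsilon> / 2\<close>.\<close>

lemma cutoff_error_bound: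
  fixes G :: "'n::{finite,linorder} paravector set" and f :: "'n paravector \<Rightarrow> 'n clifford"
    and z :: "'n paravector"
  assumes G: "open G" "bounded G" "C2_boundary G" and f: "continuous_on (closure G) f"
    and P: "finite P" "P \<subseteq> frontier G" "\<And>p q. p \<in> P \<Longrightarrow> q \<in> P \<Longrightarrow> p \<noteq> q \<Longrightarrow> \<epsilon> \<le> dist p q"
    and \<epsilon>: "0 < \<epsilon>" "8 * \<epsilon> \<le> \<rho>" and a: "0 < a"
    and z: "\<And>w. w \<in> frontier G \<Longrightarrow> \<rho> \<le> dist z w"
    and \<eta>: "0 \<le> \<eta>" and osc: "\<And>x y. x \<in> closure G \<Longrightarrow> y \<in> closure G \<Longrightarrow> dist x y < 5 * \<epsilon> \<Longrightarrow> norm (f x - f y) \<le> \<eta>"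
    and c: "0 < c" "\<And>q. q \<in> frontier G \<Longrightarrow>
      ennreal (c * (\<epsilon> / 2) ^ CARD('n)) \<le> hausdorff_outer CARD('n) (frontier G \<inter> ball q (\<epsilon> / 2))"
    and B: "0 < B" "\<And>a b :: 'n clifford. norm (a \<odot> b) \<le> B * norm a * norm b"
    and S: "compact S" "S \<subseteq> G"
  defines "Y \<equiv> \<lambda>w. indicator S w *\<^sub>R ((cauchy_kernel a (w - z) \<odot> paravec (cutoff_grad P \<epsilon> w)) \<odot> f w)"
  assumes iY: "integrable lborel Y"
  shows "norm (\<integral>w. Y w \<partial>lborel) \<le>
    B\<^sup>2 * (2 / \<rho>) ^ CARD('n) * (8 * unit_ball_vol (real DIM('n paravector)) * 4 ^ DIM('n paravector) * 2 ^ CARD('n) / c)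
    * (\<integral>w. norm (f w) + \<eta> \<partial>surface_measure G)"
proof -
  let ?F = "frontier G" and ?m = "CARD('n)" and ?M = "surface_measure G"
  let ?\<omega> = "unit_ball_vol (real DIM('n paravector))"
  have Fc: "?F \<subseteq> closure G" by (simp add: frontier_def)
  have dimS: "DIM('n paravector) = Suc ?m" by simp
  have \<rho>: "0 < \<rho>" using \<epsilon> by linarith
  define g where "g y = norm (f y) + \<eta>" for y
  \<comment> \<open>The infimum over a small surface ball is a single number that dominates
    \<open>|f|\<close> on the part of \<open>S\<close> near \<open>p\<close> and stays below
    \<open>g\<close> on that surface ball, as \<open>sum_local_lower_bounds_le_integral\<close>
    demands.\<close>
  define s where "s p = (INF y\<in>?F \<inter> ball p (\<epsilon> / 2). g y)" for p
  have g0: "0 \<le> g y" for y using \<eta> by (simp add: g_def)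
  have ne: "?F \<inter> ball p (\<epsilon> / 2) \<noteq> {}" if "p \<in> P" for p using that P(2) \<epsilon>(1) by force
  have bdd: "bdd_below (g ` (?F \<inter> ball p (\<epsilon> / 2)))" if "p \<in> P" for p
    by (rule bdd_belowI[of _ 0]) (use g0 in auto)
  have s_le: "s p \<le> g y" if "p \<in> P" "y \<in> ?F \<inter> ball p (\<epsilon> / 2)" for p y
    unfolding s_def by (rule cINF_lower[OF bdd[OF that(1)] that(2)])
  have s0: "0 \<le> s p" if "p \<in> P" for p
    unfolding s_def by (rule cINF_greatest[OF ne[OF that]]) (rule g0)
  have f_le: "norm (f w) \<le> s p" if p: "p \<in> P" and w: "w \<in> S" "w \<in> ball p (4 * \<epsilon>)" for p w
    unfolding s_def
  proof (rule cINF_greatest[OF ne[OF p]])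
    fix y assume y: "y \<in> ?F \<inter> ball p (\<epsilon> / 2)"
    have "dist w y < 5 * \<epsilon>" using w(2) y dist_triangle[of w y p] \<epsilon>(1) by (simp add: dist_commute)
    moreover have "w \<in> closure G" "y \<in> closure G" using w(1) S(2) closure_subset y Fc by blast+
    ultimately have "norm (f w - f y) \<le> \<eta>" using osc by blast
    then show "norm (f w) \<le> g y" using norm_triangle_sub[of "f w" "f y"] by (simp add: g_def)
  qed
  \<comment> \<open>Two Clifford products give \<open>B\<close> squared, the distance
    \<open>\<rho> / 2\<close> from the pole gives \<open>(2 / \<rho>) ^ m\<close>, the cutoff
    gradient gives \<open>8 / \<epsilon>\<close>.\<close>
  define k where "k = B\<^sup>2 * (2 / \<rho>) ^ ?m * (8 / \<epsilon>)"
  have k: "0 \<le> k" using \<rho> \<epsilon>(1) by (simp add: k_def)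
  have Y_le: "norm (Y w) \<le> (\<Sum>p\<in>P. k * s p * indicator (ball p (4 * \<epsilon>)) w)" for w
  proof (cases "w \<in> S \<and> cutoff_grad P \<epsilon> w \<noteq> 0")
    case False
    then have "Y w = 0" by (auto simp: Y_def cmult_simps paravec_def)
    moreover have "0 \<le> (\<Sum>p\<in>P. k * s p * indicator (ball p (4 * \<epsilon>)) w)"
      by (intro sum_nonneg mult_nonneg_nonneg k s0) auto
    ultimately show ?thesis by simp
  next
    case True
    have gr: "norm (cutoff_grad P \<epsilon> w) \<le> (\<Sum>p\<in>P. 8 / \<epsilon> * indicator (ball p (4 * \<epsilon>)) w)"
      by (rule norm_cutoff_grad_le[OF \<epsilon>(1)])
    have "\<exists>p\<in>P. w \<in> ball p (4 * \<epsilon>)"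
    proof (rule ccontr)
      assume "\<not> ?thesis"
      then have "(\<Sum>p\<in>P. 8 / \<epsilon> * indicator (ball p (4 * \<epsilon>)) w) = 0" by (intro sum.neutral) auto
      then show False using gr True by simp
    qed
    then obtain p where p: "p \<in> P" "dist p w < 4 * \<epsilon>" by auto
    have "\<rho> \<le> dist z p" using z p(1) P(2) by blast
    then have "\<rho> / 2 \<le> norm (w - z)"
      using p(2) \<epsilon>(2) dist_triangle[of z p w] by (simp add: dist_norm norm_minus_commute)
    then have E: "norm (cauchy_kernel a (w - z)) \<le> 1 / (\<rho> / 2) ^ ?m"
      using a \<rho> by (intro norm_cauchy_kernel_le) auto
    have "norm (Y w) \<le> B * norm (cauchy_kernel a (w - z) \<odot> paravec (cutoff_grad P \<epsilon> w)) * norm (f w)"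
      using True B(2) by (simp add: Y_def)
    also have "\<dots> \<le> B * (B * norm (cauchy_kernel a (w - z)) * norm (cutoff_grad P \<epsilon> w)) * norm (f w)"
      using B(2)[of "cauchy_kernel a (w - z)" "paravec (cutoff_grad P \<epsilon> w)"] B(1)
      by (intro mult_right_mono mult_left_mono) (simp_all add: norm_paravec)
    also have "\<dots> \<le> B * (B * (1 / (\<rho> / 2) ^ ?m) * (\<Sum>p\<in>P. 8 / \<epsilon> * indicator (ball p (4 * \<epsilon>)) w)) * norm (f w)"
      using B(1) E gr \<rho> by (intro mult_right_mono mult_left_mono mult_mono) auto
    also have "\<dots> = (\<Sum>p\<in>P. k * norm (f w) * indicator (ball p (4 * \<epsilon>)) w)"
      by (simp add: k_def sum_distrib_left sum_distrib_right power_divide power2_eq_square mult_ac)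
    also have "\<dots> \<le> (\<Sum>p\<in>P. k * s p * indicator (ball p (4 * \<epsilon>)) w)"
    proof (rule sum_mono)
      fix p assume p: "p \<in> P"
      show "k * norm (f w) * indicator (ball p (4 * \<epsilon>)) w \<le> k * s p * indicator (ball p (4 * \<epsilon>)) w"
        using f_le[OF p, of w] True k by (cases "w \<in> ball p (4 * \<epsilon>)") (auto intro!: mult_left_mono)
    qed
    finally show ?thesis .
  qed
  have Bi: "integrable lborel (\<lambda>w::'n paravector. indicator (ball p (4 * \<epsilon>)) w :: real)" for p
    by (rule integrable_real_indicator) (use emeasure_bounded_finite[OF bounded_ball, of p "4 * \<epsilon>"] in simp_all)
  have Bs: "integrable lborel (\<lambda>w. k * s p * indicator (ball p (4 * \<epsilon>)) w)" for p
    by (rule integrable_mult_right) (rule Bi)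
  have "norm (\<integral>w. Y w \<partial>lborel) \<le> (\<integral>w. norm (Y w) \<partial>lborel)" by (rule integral_norm_bound)
  also have "\<dots> \<le> (\<integral>w. (\<Sum>p\<in>P. k * s p * indicator (ball p (4 * \<epsilon>)) w) \<partial>lborel)"
    by (rule integral_mono[OF integrable_norm[OF iY] Bochner_Integration.integrable_sum[OF Bs]]) (rule Y_le)
  also have "\<dots> = (\<Sum>p\<in>P. \<integral>w. k * s p * indicator (ball p (4 * \<epsilon>)) w \<partial>lborel)"
    by (rule Bochner_Integration.integral_sum) (rule Bs)
  also have "\<dots> = (\<Sum>p\<in>P. k * s p * (?\<omega> * (4 * \<epsilon>) ^ DIM('n paravector)))"
    by (rule sum.cong[OF refl]) (use \<epsilon>(1) in \<open>simp add: content_ball\<close>)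
  \<comment> \<open>The powers of \<open>\<epsilon>\<close> cancel here:
    \<open>8 / \<epsilon>\<close> times \<open>(4 \<epsilon>) ^ Suc m\<close> is regrouped around
    \<open>(\<epsilon> / 2) ^ m\<close>, and the constant in front no longer depends on
    \<open>\<epsilon>\<close>.\<close>
  also have "\<dots> = B\<^sup>2 * (2 / \<rho>) ^ ?m * (8 * ?\<omega> * 4 ^ DIM('n paravector) * 2 ^ ?m / c) * ((\<Sum>p\<in>P. s p) * (c * (\<epsilon> / 2) ^ ?m))"
    unfolding sum_distrib_right[symmetric] sum_distrib_left[symmetric] k_def dimS
    using c(1) \<epsilon>(1) by (simp add: power_mult_distrib power_divide)
  also have "\<dots> \<le> B\<^sup>2 * (2 / \<rho>) ^ ?m * (8 * ?\<omega> * 4 ^ DIM('n paravector) * 2 ^ ?m / c) * (\<integral>w. g w \<partial>?M)"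
  proof (rule mult_left_mono)
    show "(\<Sum>p\<in>P. s p) * (c * (\<epsilon> / 2) ^ ?m) \<le> (\<integral>w. g w \<partial>?M)"
      proof (rule sum_local_lower_bounds_le_integral[OF finite_surface_measure[OF G] P(1), where r="\<epsilon> / 2"])
        show "2 * (\<epsilon> / 2) \<le> dist p q" if "p \<in> P" "q \<in> P" "p \<noteq> q" for p q using P(3)[OF that] by simp
        show "space ?M \<inter> ball p (\<epsilon> / 2) \<in> sets ?M" for p
          unfolding space_surface_measure by (rule surface_set_measurable) simp
        show "integrable ?M g" unfolding g_def
          by (intro integrable_surface_continuous[OF G] continuous_intros continuous_on_subset[OF f Fc])
        show "0 \<le> g y" for y by (rule g0)
        show "0 \<le> s p" if "p \<in> P" for p by (rule s0[OF that])
        show "s p \<le> g y" if "p \<in> P" "y \<in> space ?M \<inter> ball p (\<epsilon> / 2)" for p y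
          using s_le that by (simp add: space_surface_measure)
        show "ennreal (c * (\<epsilon> / 2) ^ ?m) \<le> emeasure ?M (space ?M \<inter> ball p (\<epsilon> / 2))" if "p \<in> P" for p
          using c(2)[of p] that P(2) by (auto simp: space_surface_measure emeasure_surface_measure)
        show "0 \<le> c * (\<epsilon> / 2) ^ ?m" using c(1) \<epsilon>(1) by simp
      qed
    show "0 \<le> B\<^sup>2 * (2 / \<rho>) ^ ?m * (8 * ?\<omega> * 4 ^ DIM('n paravector) * 2 ^ ?m / c)"
      using \<rho> c(1) B(1) by (intro mult_nonneg_nonneg divide_nonneg_nonneg zero_le_power) auto
  qed
  finally show ?thesis by (simp add: g_def)
qed

text \<open>\<open>X\<close> integrates \<open>f\<close> against the bump \<open>u\<close>.
  Replacing \<open>f w\<close> by \<open>f z\<close> costs \<open>\<eta>'\<close> where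
  \<open>w\<close> is within \<open>d\<close> of \<open>z\<close>, and a multiple of
  \<open>\<alpha>^2\<close> elsewhere. The result is divided by the mass \<open>I\<close> of the
  bump, which is known only through \<open>J \<le> I\<close>.\<close>

lemma monogenic_point_estimate:
  fixes G :: "'n::{finite,linorder} paravector set" and f :: "'n paravector \<Rightarrow> 'n clifford"
    and z :: "'n paravector"
  assumes G: "open G" "bounded G" "C2_boundary G"
    and f: "continuous_on (closure G) f" "left_monogenic G f"
    and z: "z \<in> G" "\<rho> \<le> infdist z (frontier G)"
    and \<epsilon>: "0 < \<epsilon>" "8 * \<epsilon> \<le> \<rho>" and \<alpha>: "0 < \<alpha>" "2 * \<alpha> \<le> \<rho>" and d: "0 < d"
    and near: "\<And>w. w \<in> closure G \<Longrightarrow> dist w z < d \<Longrightarrow> norm (f z - f w) \<le> \<eta>'"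
    and Mf: "\<And>w. w \<in> closure G \<Longrightarrow> norm (f w) \<le> Mf"
    and \<eta>: "0 \<le> \<eta>" "\<And>x y. x \<in> closure G \<Longrightarrow> y \<in> closure G \<Longrightarrow> dist x y < 5 * \<epsilon> \<Longrightarrow> norm (f x - f y) \<le> \<eta>"
    and c: "0 < c" "\<And>q. q \<in> frontier G \<Longrightarrow>
      ennreal (c * (\<epsilon> / 2) ^ CARD('n)) \<le> hausdorff_outer CARD('n) (frontier G \<inter> ball q (\<epsilon> / 2))"
    and B: "0 < B" "\<And>a b :: 'n clifford. norm (a \<odot> b) \<le> B * norm a * norm b"
  defines "N \<equiv> DIM('n paravector)"
  defines "J \<equiv> real N * 2 powr (- (real N / 2) - 1) * unit_ball_vol (real N)"
  shows "norm (f z) \<le> \<eta>' + (B\<^sup>2 * (2 / \<rho>) ^ CARD('n) *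
      (8 * unit_ball_vol (real N) * 4 ^ N * 2 ^ CARD('n) / c)
        * (\<integral>w. norm (f w) + \<eta> \<partial>surface_measure G)
      + 2 * Mf * (real N * \<alpha>\<^sup>2 / d ^ (N + 2)) * measure lborel (closure G)) / J"
proof -
  let ?F = "frontier G"
  have \<rho>: "0 < \<rho>" using \<epsilon> by linarith
  have ballG: "ball z \<rho> \<subseteq> G"
    using ball_infdist_frontier_subset[OF z(1)] z(2) subset_ball by blast
  have zF: "\<rho> \<le> dist z w" if "w \<in> ?F" for w using infdist_le[OF that, of z] z(2) by linarith
  have "compact ?F" using G(2) by (rule compact_frontier_bounded)
  from finite_separated_net[OF this \<epsilon>(1)] obtain P where P: "finite P" "P \<subseteq> ?F"
    "\<And>p q. p \<in> P \<Longrightarrow> q \<in> P \<Longrightarrow> p \<noteq> q \<Longrightarrow> \<epsilon> \<le> dist p q"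
    "\<And>x. x \<in> ?F \<Longrightarrow> \<exists>p\<in>P. dist p x < 2 * \<epsilon>"
    by metis
  define S where "S = closure G \<inter> {w. \<forall>p\<in>P. 3 * \<epsilon> \<le> dist w p}"
  define u where "u w = cutoff P \<epsilon> w * cauchy_density (\<alpha>\<^sup>2) (w - z)" for w
  define X where "X w = indicator S w *\<^sub>R (u w *\<^sub>R f w)" for w
  define Y where "Y w = indicator S w *\<^sub>R ((cauchy_kernel (\<alpha>\<^sup>2) (w - z) \<odot> paravec (cutoff_grad P \<epsilon> w)) \<odot> f w)" for w
  have a2: "0 < \<alpha>\<^sup>2" using \<alpha>(1) by simp
  note cut = G(1,2) f(2) P(1) P(4) \<epsilon>(1) a2
  have S: "compact S" "S \<subseteq> G"
    using monogenic_cutoff_identity(1)[OF cut] monogenic_cutoff_identity(2)[OF cut]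
    by (simp_all only: S_def)
  have iX: "integrable lborel X" and iY: "integrable lborel Y" and XY: "(\<integral>w. X w \<partial>lborel) = - (\<integral>w. Y w \<partial>lborel)"
    using monogenic_cutoff_identity(3)[OF cut, of z] monogenic_cutoff_identity(4)[OF cut, of z]
      monogenic_cutoff_identity(5)[OF cut, of z]
    by (simp_all only: X_def[abs_def] Y_def[abs_def] S_def u_def)
  define T1 where "T1 = B\<^sup>2 * (2 / \<rho>) ^ CARD('n) *
      (8 * unit_ball_vol (real N) * 4 ^ N * 2 ^ CARD('n) / c) * (\<integral>w. norm (f w) + \<eta> \<partial>surface_measure G)"
  have T1: "norm (\<integral>w. X w \<partial>lborel) \<le> T1"
    unfolding XY norm_minus_cancel T1_def N_def Y_def
    by (rule cutoff_error_bound[OF G f(1) P(1-3) \<epsilon> a2 zF \<eta> c B S iY[unfolded Y_def[abs_def]]])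
  define \<kappa> where "\<kappa> = real N * \<alpha>\<^sup>2 / d ^ (N + 2)"
  have \<kappa>: "0 \<le> \<kappa>" using d by (simp add: \<kappa>_def)
  define T2 where "T2 = 2 * Mf * \<kappa> * measure lborel (closure G)"
  have Mf0: "0 \<le> Mf" using Mf[of z] z(1) closure_subset norm_ge_zero order_trans by blast
  have T2: "0 \<le> T2" unfolding T2_def using Mf0 \<kappa> by (intro mult_nonneg_nonneg) auto
  have u0: "0 \<le> u w" for w unfolding u_def by (intro mult_nonneg_nonneg cutoff_range cauchy_density_nonneg) simp
  have uc: "continuous_on UNIV u" unfolding u_def
    by (intro continuous_on_mult continuous_on_cutoff continuous_on_cauchy_density a2)
  have iu: "integrable lborel (\<lambda>w. indicator S w *\<^sub>R u w)"
    by (rule borel_integrable_compact[OF S(1) continuous_on_subset[OF uc subset_UNIV]])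
  define I where "I = (\<integral>w. indicator S w *\<^sub>R u w \<partial>lborel)"
  \<comment> \<open>On \<open>ball z \<alpha>\<close> the cutoff is 1, because
    \<open>2 \<alpha> \<le> \<rho>\<close> and \<open>8 \<epsilon> \<le> \<rho>\<close> leave a
    distance of \<open>4 \<epsilon>\<close> to every net point; the density alone gives mass at
    least \<open>J\<close> there.\<close>
  have IJ: "J \<le> I"
  proof -
    define v where "v = real N * 2 powr (- (real N / 2) - 1) / \<alpha> ^ N"
    have ib: "integrable lborel (\<lambda>w. v * indicator (ball z \<alpha>) w)"
      by (rule integrable_mult_right, rule integrable_real_indicator)
        (use emeasure_bounded_finite[OF bounded_ball, of z \<alpha>] in simp_all)
    have "J = (\<integral>w. v * indicator (ball z \<alpha>) w \<partial>lborel)"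
      using \<alpha>(1) by (simp add: content_ball J_def v_def N_def)
    also have "\<dots> \<le> I" unfolding I_def
    proof (rule integral_mono[OF ib iu])
      fix w
      show "v * indicator (ball z \<alpha>) w \<le> indicator S w *\<^sub>R u w"
      proof (cases "w \<in> ball z \<alpha>")
        case True
        have far: "4 * \<epsilon> \<le> dist w p" if "p \<in> P" for p
        proof -
          have "\<rho> \<le> dist z p" using zF that P(2) by blast
          then show ?thesis using True \<alpha>(2) \<epsilon>(2) dist_triangle[of z p w] by simp
        qed
        have "w \<in> G" using True \<alpha> ballG by auto
        then have "w \<in> S" using far \<epsilon>(1) closure_subset by (force simp: S_def)
        moreover have "u w = cauchy_density (\<alpha>\<^sup>2) (w - z)" using cutoff_far[OF far \<epsilon>(1)] by (simp add: u_def)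
        moreover have "v \<le> cauchy_density (\<alpha>\<^sup>2) (w - z)" unfolding v_def N_def
          by (rule cauchy_density_ge[OF \<alpha>(1)]) (use True in \<open>simp add: dist_norm norm_minus_commute\<close>)
        ultimately show ?thesis using True by simp
      next
        case False
        then show ?thesis using u0 by simp
      qed
    qed
    finally show ?thesis .
  qed
  have J: "0 < J" by (simp add: J_def N_def)
  have vol: "integrable lborel (\<lambda>w. 2 * Mf * \<kappa> * indicator (closure G) w)"
    by (rule integrable_mult_right, rule integrable_real_indicator)
      (use emeasure_bounded_finite[OF bounded_closure[OF G(2)]] in simp_all)
  have diff: "norm (\<integral>w. indicator S w *\<^sub>R (u w *\<^sub>R (f z - f w)) \<partial>lborel) \<le> \<eta>' * I + T2"
  proof -
    have le: "norm (indicator S w *\<^sub>R (u w *\<^sub>R (f z - f w)))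
        \<le> \<eta>' * (indicator S w *\<^sub>R u w) + 2 * Mf * \<kappa> * indicator (closure G) w" for w
    proof (cases "w \<in> S")
      case False
      then show ?thesis using Mf0 \<kappa> by simp
    next
      case True
      then have w: "w \<in> closure G" using S(2) closure_subset by blast
      have "u w * norm (f z - f w) \<le> \<eta>' * u w + 2 * Mf * \<kappa>"
      proof (cases "dist w z < d")
        case True
        have "u w * norm (f z - f w) \<le> u w * \<eta>'" by (rule mult_left_mono[OF near[OF w True] u0])
        moreover have "u w * \<eta>' = \<eta>' * u w" by (rule mult.commute)
        moreover have "0 \<le> 2 * Mf * \<kappa>" using Mf0 \<kappa> by simp
        ultimately show ?thesis by linarith
      next
        case False
        have "u w \<le> 1 * cauchy_density (\<alpha>\<^sup>2) (w - z)" unfolding u_def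
          by (intro mult_right_mono cutoff_range cauchy_density_nonneg) simp
        also have "\<dots> \<le> \<kappa>" unfolding \<kappa>_def N_def using False d
          by (simp only: mult_1) (rule cauchy_density_le, auto simp: dist_norm)
        finally have u\<kappa>: "u w \<le> \<kappa>" .
        have "norm (f z - f w) \<le> 2 * Mf"
          using norm_triangle_ineq4[of "f z" "f w"] Mf[OF w] Mf[of z] z(1) closure_subset by force
        then have "u w * norm (f z - f w) \<le> \<kappa> * (2 * Mf)" using u\<kappa> u0 \<kappa> by (intro mult_mono) auto
        moreover have "0 \<le> \<eta>'" using near[of z] z(1) closure_subset d by force
        then have "0 \<le> \<eta>' * u w" using u0 by simp
        moreover have "\<kappa> * (2 * Mf) = 2 * Mf * \<kappa>" by simp
        ultimately show ?thesis by linarith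
      qed
      then show ?thesis using True w u0[of w] by simp
    qed
    have i1: "integrable lborel (\<lambda>w. \<eta>' * (indicator S w *\<^sub>R u w))" by (rule integrable_mult_right[OF iu])
    have i2: "integrable lborel (\<lambda>w. indicator S w *\<^sub>R (u w *\<^sub>R (f z - f w)))"
      by (rule borel_integrable_compact[OF S(1)])
        (intro continuous_on_scaleR continuous_on_diff continuous_on_const continuous_on_subset[OF uc]
          continuous_on_subset[OF f(1)] subset_UNIV order_trans[OF S(2) closure_subset])
    have "norm (\<integral>w. indicator S w *\<^sub>R (u w *\<^sub>R (f z - f w)) \<partial>lborel)
        \<le> (\<integral>w. norm (indicator S w *\<^sub>R (u w *\<^sub>R (f z - f w))) \<partial>lborel)" by (rule integral_norm_bound)
    also have "\<dots> \<le> (\<integral>w. \<eta>' * (indicator S w *\<^sub>R u w) + 2 * Mf * \<kappa> * indicator (closure G) w \<partial>lborel)"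
      by (rule integral_mono[OF integrable_norm[OF i2] Bochner_Integration.integrable_add[OF i1 vol] le])
    also have "\<dots> = \<eta>' * I + T2"
      unfolding Bochner_Integration.integral_add[OF i1 vol] T2_def I_def by simp
    finally show ?thesis .
  qed
  have split: "I *\<^sub>R f z = (\<integral>w. X w \<partial>lborel) + (\<integral>w. indicator S w *\<^sub>R (u w *\<^sub>R (f z - f w)) \<partial>lborel)"
  proof -
    have i3: "integrable lborel (\<lambda>w. (indicator S w *\<^sub>R u w) *\<^sub>R f z)" by (rule integrable_scaleR_left) (rule iu)
    have "(\<lambda>w. indicator S w *\<^sub>R (u w *\<^sub>R (f z - f w))) = (\<lambda>w. (indicator S w *\<^sub>R u w) *\<^sub>R f z - X w)"
      by (simp add: fun_eq_iff X_def scaleR_diff_right)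
    then have "(\<integral>w. indicator S w *\<^sub>R (u w *\<^sub>R (f z - f w)) \<partial>lborel)
        = (\<integral>w. (indicator S w *\<^sub>R u w) *\<^sub>R f z \<partial>lborel) - (\<integral>w. X w \<partial>lborel)"
      by (simp only: Bochner_Integration.integral_diff[OF i3 iX])
    also have "(\<integral>w. (indicator S w *\<^sub>R u w) *\<^sub>R f z \<partial>lborel) = I *\<^sub>R f z"
      unfolding I_def using iu by (intro integral_scaleR_left) blast
    finally show ?thesis by simp
  qed
  have I: "0 < I" using IJ J by linarith
  have "I * norm (f z) = norm (I *\<^sub>R f z)" using I by simp
  also have "\<dots> \<le> T1 + (\<eta>' * I + T2)"
    unfolding split by (rule norm_triangle_mono[OF T1 diff])
  finally have "norm (f z) \<le> \<eta>' + (T1 + T2) / I" using I by (simp add: field_simps)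
  \<comment> \<open>Only the error terms are divided by \<open>J\<close>; the term
    \<open>\<eta>' I\<close> has been divided by \<open>I\<close> exactly and enters without a
    constant.\<close>
  also have "(T1 + T2) / I \<le> (T1 + T2) / J"
  proof (rule divide_left_mono[OF IJ])
    have "0 \<le> T1" using T1 norm_ge_zero order_trans by blast
    then show "0 \<le> T1 + T2" using T2 by simp
  qed (use I J in simp)
  finally show ?thesis by (simp add: T1_def T2_def \<kappa>_def mult.assoc)
qed

text \<open>The small parameters of the point estimate may depend on \<open>f\<close> and on the
  error \<open>e\<close>, whereas the factor \<open>C1 / J\<close> contains none of them; so the
  constant depends only on \<open>G\<close> and \<open>\<rho>\<close>.\<close>

theorem monogenic_boundary_bound:
  fixes G :: "'n::{finite,linorder} paravector set"
  assumes G: "open G" "bounded G" "C2_boundary G" and \<rho>: "0 < \<rho>"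
  obtains C where "0 \<le> C" "\<And>f z. f \<in> hardy_generators G \<Longrightarrow> z \<in> G \<Longrightarrow> \<rho> \<le> infdist z (frontier G) \<Longrightarrow>
    norm (f z) \<le> C * (\<integral>w. norm (f w) \<partial>surface_measure G)"
proof -
  obtain c r0 where c: "0 < c" "0 < r0"
    "\<And>q r. q \<in> frontier G \<Longrightarrow> 0 < r \<Longrightarrow> r \<le> r0 \<Longrightarrow>
      ennreal (c * r ^ CARD('n)) \<le> hausdorff_outer CARD('n) (frontier G \<inter> ball q r)"
    using C2_boundary_hausdorff_ge[OF G] by metis
  obtain B where B: "0 < B" "\<And>a b :: 'n clifford. norm (a \<odot> b) \<le> B * norm a * norm b"
    using cmult_bound by metis
  define N where "N = DIM('n paravector)"
  define J where "J = real N * 2 powr (- (real N / 2) - 1) * unit_ball_vol (real N)"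
  have J: "0 < J" by (simp add: J_def N_def)
  define C1 where "C1 = B\<^sup>2 * (2 / \<rho>) ^ CARD('n) * (8 * unit_ball_vol (real N) * 4 ^ N * 2 ^ CARD('n) / c)"
  have C1: "0 \<le> C1" unfolding C1_def using \<rho> c(1) B(1)
    by (intro mult_nonneg_nonneg divide_nonneg_nonneg zero_le_power) auto
  interpret finite_measure "surface_measure G" by (rule finite_surface_measure[OF G])
  define V where "V = measure (surface_measure G) (space (surface_measure G))"
  have "norm (f z) \<le> C1 / J * (\<integral>w. norm (f w) \<partial>surface_measure G)"
    if f: "f \<in> hardy_generators G" and z: "z \<in> G" "\<rho> \<le> infdist z (frontier G)" for f z
  proof (rule field_le_epsilon)
    fix e :: real assume e: "0 < e"
    have fc: "continuous_on (closure G) f" and fm: "left_monogenic G f"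
      using f by (auto simp: hardy_generators_def)
    have cG: "compact (closure G)" using G(2) by (simp add: compact_closure)
    have zc: "z \<in> closure G" using z(1) closure_subset by blast
    have "bounded (f ` closure G)" by (intro compact_imp_bounded compact_continuous_image fc cG)
    then obtain Mf where Mf: "\<And>w. w \<in> closure G \<Longrightarrow> norm (f w) \<le> Mf"
      unfolding bounded_iff by (metis imageI)
    have Mf0: "0 \<le> Mf" using Mf[OF zc] norm_ge_zero order_trans by blast
    have uc: "uniformly_continuous_on (closure G) f" by (rule compact_uniformly_continuous[OF fc cG])
    obtain d where d: "0 < d" "\<And>x y. x \<in> closure G \<Longrightarrow> y \<in> closure G \<Longrightarrow> dist y x < d \<Longrightarrow> dist (f y) (f x) < e / 3"
      using uc e unfolding uniformly_continuous_on_def by (metis zero_less_divide_iff zero_less_numeral)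
    \<comment> \<open>Keeps \<open>C1 * V * \<eta> / J\<close> below \<open>e / 3\<close>; the
      \<open>+ 1\<close> covers \<open>C1 * V = 0\<close>.\<close>
    define \<eta> where "\<eta> = e * J / (3 * (C1 * V + 1))"
    have CV: "0 \<le> C1 * V" using C1 by (simp add: V_def)
    have \<eta>: "0 < \<eta>" using e J CV by (simp add: \<eta>_def)
    obtain d' where d': "0 < d'" "\<And>x y. x \<in> closure G \<Longrightarrow> y \<in> closure G \<Longrightarrow> dist y x < d' \<Longrightarrow> dist (f y) (f x) < \<eta>"
      using uc \<eta> unfolding uniformly_continuous_on_def by metis
    define \<epsilon> where "\<epsilon> = min (d' / 5) (min (\<rho> / 8) r0)"
    have \<epsilon>: "0 < \<epsilon>" "8 * \<epsilon> \<le> \<rho>" "5 * \<epsilon> \<le> d'" "\<epsilon> \<le> r0"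
      using d'(1) \<rho> c(2) by (auto simp: \<epsilon>_def)
    define b where "b = 2 * Mf * (real N / d ^ (N + 2)) * measure lborel (closure G)"
    have b: "0 \<le> b" using Mf0 d(1) by (simp add: b_def)
    \<comment> \<open>\<open>\<alpha> \<le> 1\<close> lets \<open>\<alpha>^2\<close> be replaced by
      \<open>\<alpha>\<close>, and the last entry makes the far term at most
      \<open>e / 3\<close>.\<close>
    define \<alpha> where "\<alpha> = min 1 (min (\<rho> / 2) (e * J / (3 * (b + 1))))"
    have \<alpha>: "0 < \<alpha>" "2 * \<alpha> \<le> \<rho>" "\<alpha> \<le> 1" "\<alpha> \<le> e * J / (3 * (b + 1))"
      using \<rho> e J b by (auto simp: \<alpha>_def)
    have "norm (f z) \<le> e / 3 + (C1 * (\<integral>w. norm (f w) + \<eta> \<partial>surface_measure G)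
      + 2 * Mf * (real N * \<alpha>\<^sup>2 / d ^ (N + 2)) * measure lborel (closure G)) / J"
      unfolding C1_def J_def N_def
    proof (rule monogenic_point_estimate[OF G fc fm z \<epsilon>(1,2) \<alpha>(1,2) d(1) _ Mf _ _ c(1) _ B])
      show "norm (f z - f w) \<le> e / 3" if "w \<in> closure G" "dist w z < d" for w
        using d(2)[OF that(1) zc] that(2) by (simp add: dist_norm norm_minus_commute less_imp_le)
      show "0 \<le> \<eta>" using \<eta> by simp
      show "norm (f x - f y) \<le> \<eta>" if "x \<in> closure G" "y \<in> closure G" "dist x y < 5 * \<epsilon>" for x y
        using d'(2)[OF that(2,1)] that(3) \<epsilon>(3) by (simp add: dist_norm less_imp_le)
      show "ennreal (c * (\<epsilon> / 2) ^ CARD('n)) \<le> hausdorff_outer CARD('n) (frontier G \<inter> ball q (\<epsilon> / 2))"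
        if "q \<in> frontier G" for q
        by (rule c(3)[OF that]) (use \<epsilon> in auto)
    qed
    also have "(\<integral>w. norm (f w) + \<eta> \<partial>surface_measure G) = (\<integral>w. norm (f w) \<partial>surface_measure G) + \<eta> * V"
    proof -
      have "integrable (surface_measure G) (\<lambda>w. norm (f w))"
        by (intro integrable_surface_continuous[OF G] continuous_on_norm continuous_on_subset[OF fc])
          (simp add: frontier_def)
      then show ?thesis by (subst Bochner_Integration.integral_add) (simp_all add: V_def)
    qed
    also have "2 * Mf * (real N * \<alpha>\<^sup>2 / d ^ (N + 2)) * measure lborel (closure G) = b * \<alpha>\<^sup>2"
      by (simp add: b_def)
    also have "e / 3 + (C1 * ((\<integral>w. norm (f w) \<partial>surface_measure G) + \<eta> * V) + b * \<alpha>\<^sup>2) / J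
        = C1 / J * (\<integral>w. norm (f w) \<partial>surface_measure G) + (e / 3 + (C1 * V * \<eta>) / J + (b * \<alpha>\<^sup>2) / J)"
      by (simp add: add_divide_distrib distrib_left mult.commute mult.left_commute)
    also have "C1 * V * \<eta> / J \<le> e / 3"
    proof -
      have "C1 * V * \<eta> \<le> (C1 * V + 1) * \<eta>" using \<eta> by simp
      also have "\<dots> = e * J / 3"
      proof -
        have "t * (e * J / (3 * t)) = e * J / 3" if "0 < t" for t :: real using that by simp
        from this[of "C1 * V + 1"] show ?thesis unfolding \<eta>_def using CV by linarith
      qed
      finally show ?thesis using J by (simp add: pos_divide_le_eq)
    qed
    also have "b * \<alpha>\<^sup>2 / J \<le> e / 3"
    proof -
      have "\<alpha>\<^sup>2 \<le> \<alpha>" using \<alpha>(1,3) by (simp add: power2_eq_square mult_left_le)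
      then have "b * \<alpha>\<^sup>2 \<le> (b + 1) * \<alpha>" using b \<alpha>(1) by (intro mult_mono) auto
      also have "\<dots> \<le> (b + 1) * (e * J / (3 * (b + 1)))" using \<alpha>(4) b by (intro mult_left_mono) auto
      also have "\<dots> = e * J / 3"
      proof -
        have "t * (e * J / (3 * t)) = e * J / 3" if "0 < t" for t :: real using that by simp
        from this[of "b + 1"] show ?thesis using b by linarith
      qed
      finally show ?thesis using J by (simp add: pos_divide_le_eq)
    qed
    finally show "norm (f z) \<le> C1 / J * (\<integral>w. norm (f w) \<partial>surface_measure G) + e" by simp
  qed
  then show thesis using that[of "C1 / J"] C1 J by simp
qed

section \<open>Point evaluations on the Hardy space\<close>

context szego
begin

text \<open>On the generators, Cauchy-Schwarz for the finite frontier measure turns the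
  \<open>L1\<close> bound into an \<open>L2\<close> bound; it passes to the closure because the
  approximating generators converge both at \<open>z\<close> and in norm. The factor 2 is the price
  of splitting \<open>F n\<close> into \<open>f\<close> and the difference.\<close>

lemma hardy_point_bound:
  assumes \<rho>: "0 < \<rho>"
  obtains C where "0 \<le> C" "\<And>f z. f \<in> hardy_space G \<Longrightarrow> z \<in> G \<Longrightarrow> \<rho> \<le> infdist z (frontier G) \<Longrightarrow>
    (norm (f z))\<^sup>2 \<le> C * (\<integral>w. (norm (f w))\<^sup>2 \<partial>M)"
proof -
  note G = open_G bounded_G C2
  obtain C where C: "0 \<le> C" "\<And>f z. f \<in> hardy_generators G \<Longrightarrow> z \<in> G \<Longrightarrow> \<rho> \<le> infdist z (frontier G) \<Longrightarrow>
    norm (f z) \<le> C * (\<integral>w. norm (f w) \<partial>M)"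
    using monogenic_boundary_bound[OF G \<rho>] by metis
  interpret finite_measure M by (rule finite_surface_measure[OF G])
  define V where "V = measure M (space M)"
  have gen: "(norm (F z))\<^sup>2 \<le> C\<^sup>2 * V * (\<integral>w. (norm (F w))\<^sup>2 \<partial>M)"
    if F: "F \<in> hardy_generators G" and z: "z \<in> G" "\<rho> \<le> infdist z (frontier G)" for F z
  proof -
    define a where "a = (\<integral>w. norm (F w) \<partial>M)"
    define q where "q = (\<integral>w. (norm (F w))\<^sup>2 \<partial>M)"
    have Fc: "continuous_on (frontier G) F"
      using F by (auto simp: hardy_generators_def frontier_def intro: continuous_on_subset)
    have i1: "integrable M (\<lambda>w. norm (F w))" and i2: "integrable M (\<lambda>w. (norm (F w))\<^sup>2)"
      by (intro integrable_surface_continuous[OF G] continuous_intros Fc)+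
    have a0: "0 \<le> a" unfolding a_def by (rule Bochner_Integration.integral_nonneg) simp
    \<comment> \<open>Cauchy-Schwarz in variance form: the integral of \<open>(V |F| - a)^2\<close>
      is nonnegative. Dividing by \<open>V\<close> requires \<open>V > 0\<close>; if
      \<open>V = 0\<close> then \<open>a = 0\<close>.\<close>
    have "a\<^sup>2 \<le> V * q"
    proof -
      have "0 \<le> (\<integral>w. (V * norm (F w) - a)\<^sup>2 \<partial>M)" by (rule Bochner_Integration.integral_nonneg) simp
      also have "\<dots> = (\<integral>w. V\<^sup>2 * (norm (F w))\<^sup>2 - 2 * V * a * norm (F w) + a\<^sup>2 \<partial>M)"
        by (rule Bochner_Integration.integral_cong) (auto simp: power2_diff power_mult_distrib)
      also have "\<dots> = V\<^sup>2 * q - 2 * V * a * a + a\<^sup>2 * V"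
        using i1 i2 by (simp add: a_def q_def V_def)
      also have "\<dots> = V * (V * q - a\<^sup>2)" by (simp add: power2_eq_square algebra_simps)
      finally have "0 \<le> V * (V * q - a\<^sup>2)" .
      moreover have "V \<ge> 0" by (simp add: V_def)
      moreover have "a = 0" if "V = 0"
      proof -
        have "emeasure M (space M) = 0" using that by (simp add: V_def emeasure_eq_measure)
        then have "space M \<in> null_sets M" by (simp add: null_setsI)
        then have "AE w in M. norm (F w) = 0" by (rule AE_I') auto
        then show ?thesis unfolding a_def by (simp add: integral_eq_zero_AE)
      qed
      ultimately show ?thesis by (cases "V = 0") (auto simp: zero_le_mult_iff)
    qed
    have "(norm (F z))\<^sup>2 \<le> (C * a)\<^sup>2" using C(2)[OF F z] by (intro power_mono) (auto simp: a_def)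
    also have "\<dots> \<le> C\<^sup>2 * (V * q)" unfolding power_mult_distrib using \<open>a\<^sup>2 \<le> V * q\<close> by (intro mult_left_mono) auto
    finally show ?thesis by (simp add: q_def mult.assoc)
  qed
  have "(norm (f z))\<^sup>2 \<le> 2 * C\<^sup>2 * V * (\<integral>w. (norm (f w))\<^sup>2 \<partial>M)"
    if f: "f \<in> hardy_space G" and z: "z \<in> G" "\<rho> \<le> infdist z (frontier G)" for f z
  proof -
    obtain F where F: "\<And>n. F n \<in> hardy_generators G"
      "(\<lambda>n. hardy_norm G (\<lambda>w. F n w - f w)) \<longlonglongrightarrow> 0" "(\<lambda>n. F n z) \<longlonglongrightarrow> f z"
      using f z(1) unfolding hardy_space_def by blast
    define r where "r n = (\<integral>w. (norm (F n w - f w))\<^sup>2 \<partial>M)" for n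
    have Fm: "F n \<in> borel_measurable M" "integrable M (\<lambda>w. (norm (F n w))\<^sup>2)" for n
      using F(1)[of n] by (auto simp: hardy_generators_def square_integrable_def)
    note fm = hardy_space_sq[OF f]
    have sq: "(norm (a + b))\<^sup>2 \<le> 2 * (norm a)\<^sup>2 + 2 * (norm b)\<^sup>2" for a b :: "'n clifford"
    proof -
      have "(norm (a + b))\<^sup>2 \<le> (norm a + norm b)\<^sup>2" by (intro power_mono norm_triangle_ineq) simp
      moreover have "0 \<le> (norm a - norm b)\<^sup>2" by simp
      ultimately show ?thesis unfolding power2_sum power2_diff by linarith
    qed
    have dm: "integrable M (\<lambda>w. (norm (F n w - f w))\<^sup>2)" for n
    proof (rule Bochner_Integration.integrable_bound)
      show "integrable M (\<lambda>w. 2 * (norm (F n w))\<^sup>2 + 2 * (norm (f w))\<^sup>2)"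
        by (intro Bochner_Integration.integrable_add integrable_mult_right Fm fm)
      show "(\<lambda>w. (norm (F n w - f w))\<^sup>2) \<in> borel_measurable M"
        using Fm(1)[of n] fm(1) by measurable
      show "AE w in M. norm ((norm (F n w - f w))\<^sup>2) \<le> norm (2 * (norm (F n w))\<^sup>2 + 2 * (norm (f w))\<^sup>2)"
      proof (rule AE_I2)
        fix w
        show "norm ((norm (F n w - f w))\<^sup>2) \<le> norm (2 * (norm (F n w))\<^sup>2 + 2 * (norm (f w))\<^sup>2)"
          using sq[of "F n w" "- f w"] by simp
      qed
    qed
    have r0: "0 \<le> r n" for n unfolding r_def by (rule Bochner_Integration.integral_nonneg) simp
    have "hardy_norm G (\<lambda>w. F n w - f w) = sqrt (r n)" for n
      unfolding r_def by (rule hardy_norm_eq) (use Fm(1)[of n] fm(1) dm[of n] in \<open>auto simp: square_integrable_def\<close>)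
    then have "(\<lambda>n. (sqrt (r n))\<^sup>2) \<longlonglongrightarrow> 0\<^sup>2" using tendsto_power[OF F(2), of 2] by simp
    then have r: "r \<longlonglongrightarrow> 0" using r0 by simp
    have le: "(norm (F n z))\<^sup>2 \<le> C\<^sup>2 * V * (2 * r n + 2 * (\<integral>w. (norm (f w))\<^sup>2 \<partial>M))" for n
    proof -
      have "(\<integral>w. (norm (F n w))\<^sup>2 \<partial>M) \<le> (\<integral>w. 2 * (norm (F n w - f w))\<^sup>2 + 2 * (norm (f w))\<^sup>2 \<partial>M)"
      proof (rule integral_mono)
        show "integrable M (\<lambda>w. 2 * (norm (F n w - f w))\<^sup>2 + 2 * (norm (f w))\<^sup>2)"
          by (intro Bochner_Integration.integrable_add integrable_mult_right dm fm)
        show "(norm (F n w))\<^sup>2 \<le> 2 * (norm (F n w - f w))\<^sup>2 + 2 * (norm (f w))\<^sup>2" for w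
          using sq[of "F n w - f w" "f w"] by simp
      qed (rule Fm)
      also have "\<dots> = 2 * r n + 2 * (\<integral>w. (norm (f w))\<^sup>2 \<partial>M)"
        unfolding r_def using dm[of n] fm(2) by simp
      finally have "C\<^sup>2 * V * (\<integral>w. (norm (F n w))\<^sup>2 \<partial>M) \<le> C\<^sup>2 * V * (2 * r n + 2 * (\<integral>w. (norm (f w))\<^sup>2 \<partial>M))"
        by (rule mult_left_mono) (simp add: V_def)
      then show ?thesis using gen[OF F(1) z, of n] by linarith
    qed
    have "(norm (f z))\<^sup>2 \<le> C\<^sup>2 * V * (2 * 0 + 2 * (\<integral>w. (norm (f w))\<^sup>2 \<partial>M))"
    proof (rule LIMSEQ_le)
      show "(\<lambda>n. (norm (F n z))\<^sup>2) \<longlonglongrightarrow> (norm (f z))\<^sup>2" by (intro tendsto_intros F(3))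
      show "(\<lambda>n. C\<^sup>2 * V * (2 * r n + 2 * (\<integral>w. (norm (f w))\<^sup>2 \<partial>M))) \<longlonglongrightarrow> C\<^sup>2 * V * (2 * 0 + 2 * (\<integral>w. (norm (f w))\<^sup>2 \<partial>M))"
        by (intro tendsto_intros r)
    qed (use le in blast)
    then show ?thesis by simp
  qed
  moreover have "0 \<le> 2 * C\<^sup>2 * V" by (simp add: V_def)
  ultimately show thesis using that by blast
qed

text \<open>Evaluate the reproducing element of \<open>w\<close> at \<open>w\<close> itself: its
  squared norm is again the density, so the point bound says that the square of the density is at
  most \<open>C\<close> times the density.\<close>

lemma density_locally_bounded:
  assumes z: "z \<in> G"
  shows "\<exists>r>0. \<exists>B. \<forall>w\<in>ball z r \<inter> G. szego_density K w \<le> B"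
proof -
  have F: "frontier G \<noteq> {}" "closed (frontier G)"
    using z bounded_G not_bounded_UNIV by (auto simp: frontier_eq_empty)
  define \<delta> where "\<delta> = infdist z (frontier G)"
  have "z \<notin> frontier G" using z open_G by (simp add: frontier_def interior_open)
  then have \<delta>: "0 < \<delta>" unfolding \<delta>_def using F by (simp add: infdist_pos_not_in_closed)
  then have "0 < \<delta> / 2" by simp
  from hardy_point_bound[OF this] obtain C where C: "0 \<le> C"
    "\<And>f w. f \<in> hardy_space G \<Longrightarrow> w \<in> G \<Longrightarrow> \<delta> / 2 \<le> infdist w (frontier G) \<Longrightarrow>
      (norm (f w))\<^sup>2 \<le> C * (\<integral>w. (norm (f w))\<^sup>2 \<partial>M)"
    by metis
  have "szego_density K w \<le> C" if w: "w \<in> ball z (\<delta> / 2) \<inter> G" for w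
  proof -
    have wG: "w \<in> G" using w by simp
    have "\<delta> \<le> infdist w (frontier G) + dist z w" unfolding \<delta>_def by (rule infdist_triangle)
    then have "\<delta> / 2 \<le> infdist w (frontier G)" using w by simp
    then have "(norm (cconj (K w w)))\<^sup>2 \<le> C * szego_density K w"
      using C(2)[OF kernel_hardy[OF wG] wG] density_eq[OF wG] by simp
    moreover have "szego_density K w \<le> norm (cconj (K w w))"
    proof -
      have "\<bar>Sc (K w w)\<bar> \<le> norm (K w w)" unfolding Sc_def by (rule component_le_norm_cart)
      then show ?thesis by (simp add: szego_density_def norm_cconj)
    qed
    moreover have d0: "0 \<le> szego_density K w"
      unfolding density_eq[OF wG] by (rule Bochner_Integration.integral_nonneg) simp
    ultimately have "(szego_density K w)\<^sup>2 \<le> C * szego_density K w"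
      by (meson order_trans power_mono)
    then show ?thesis using d0 C(1) by (cases "szego_density K w = 0") (auto simp: power2_eq_square)
  qed
  then have "\<forall>w\<in>ball z (\<delta> / 2) \<inter> G. szego_density K w \<le> C" by blast
  then show ?thesis using \<open>0 < \<delta> / 2\<close> by blast
qed

end

theorem theorem11:
  fixes G :: "'n::{finite,linorder} paravector set"
    and K :: "'n paravector \<Rightarrow> 'n paravector \<Rightarrow> 'n clifford"
  assumes "open G" and "connected G" and "G \<noteq> {}" and "bounded G"
    and "C2_boundary G"
    and "szego_kernel G K"
  shows "Metric_space G (metric_dist G (szego_density K)) \<and>
    Metric_space.mcomplete G (metric_dist G (szego_density K))"
proof -
  interpret szego G K by (rule szego.intro) (use assms in auto)
  interpret lsc_density G "szego_density K"
    by (rule lsc_density.intro[OF assms(1) density_lsc])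
  obtain c where c: "0 < c" "\<And>z. z \<in> G \<Longrightarrow> c \<le> szego_density K z * infdist z (frontier G)"
    "\<And>z. z \<in> G \<Longrightarrow> c \<le> szego_density K z"
    using density_lower by metis
  \<comment> \<open>The same \<open>c\<close> serves as the uniform lower bound of the density and
    as the constant in the bound against the boundary distance.\<close>
  show ?thesis
    by (rule metric_dist_complete[OF assms(2) c(1) c(1) density_locally_bounded c(3) c(2)])
qed

end
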